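(* Let $q=p^n$ with $p$ prime and $q>2$, and let $\alpha,\beta$ be two primitive elements in $\mathbb{F}_q$. (1) The quandles $F_{q,\alpha}$ and $F_{q,\beta}$ are isomorphic if and only if $\alpha$ and $\beta$ are prime-power equivalent. (2) There are a total of $\dfrac{\varphi(p^n-1)}{n}$ isomorphism classes of cyclic quandles of order $p^n$, where $\varphi$ is Euler's totient function.
   Context: A quandle is a set $X$ with a binary operation $\triangleright$ such that (i) for all $x,y\in X$ there is a unique $z\in X$ with $y=z\triangleright x$; (ii) $(x\triangleright y)\triangleright z=(x\triangleright z)\triangleright(y\triangleright z)$; (iii) $x\triangleright x=x$. A finite quandle $X$ of cardinality $m>2$ is cyclic (of cyclic type) if for every $i\in X$ the right multiplication $R_i:X\to X$, $R_i(y)=y\triangleright i$, is a cycle of length $m-1$. A primitive element of $\mathbb{F}_q$ is a generator of $\mathbb{F}_q^*$. For a primitive element $\alpha$ and nonzero $r\in\mathbb{F}_q$, $\log_\alpha r$ is the unique integer $0\le\log_\alpha r\le q-2$ with $\alpha^{\log_\alpha r}=r$. Words are left-associated: $ab^k$ denotes $(\cdots((a\triangleright b)\triangleright b)\cdots)\triangleright b$ with $k$ factors $b$. $F_{q,\alpha}$ is the quandle presented by generators $x,y$ and relations $ab^{q-1}=a$ and $ab^k=ba^{\log_\alpha(1-\alpha^k)}$ for $(a,b)\in\{(x,y),(y,x)\}$ and $1\le k\le q-2$. Two primitive elements $\alpha,\beta$ of $\mathbb{F}_{p^n}$ are prime-power equivalent if $\alpha=\beta^{p^s}$ for some integer $s\ge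 0$; this is an equivalence relation on primitive elements. *)

theory Defs
  imports "HOL-Algebra.Algebra" "HOL-Number_Theory.Totient" "HOL-Combinatorics.Cycles"
begin

section \<open>Quandles\<close>

record 'a quandle = "'a partial_object" +
  qop :: "['a, 'a] \<Rightarrow> 'a" (infixl \<open>\<triangleright>\<index>\<close> 70)

locale quandle =
  fixes Q :: "('a, 'b) quandle_scheme" (structure)
  assumes closed: "\<lbrakk>x \<in> carrier Q; y \<in> carrier Q\<rbrakk> \<Longrightarrow> x \<triangleright> y \<in> carrier Q"
    and right_div: "\<lbrakk>x \<in> carrier Q; y \<in> carrier Q\<rbrakk> \<Longrightarrow> \<exists>!z. z \<in> carrier Q \<and> y = z \<triangleright> x"
    and self_dist: "\<lbrakk>x \<in> carrier Q; y \<in> carrier Q; z \<in> carrier Q\<rbrakk>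
      \<Longrightarrow> (x \<triangleright> y) \<triangleright> z = (x \<triangleright> z) \<triangleright> (y \<triangleright> z)"
    and idem: "x \<in> carrier Q \<Longrightarrow> x \<triangleright> x = x"

definition quandle_hom ::
    "('a, 'c) quandle_scheme \<Rightarrow> ('b, 'd) quandle_scheme \<Rightarrow> ('a \<Rightarrow> 'b) set" where
  "quandle_hom Q K = {h \<in> carrier Q \<rightarrow> carrier K.
     \<forall>x\<in>carrier Q. \<forall>y\<in>carrier Q. h (x \<triangleright>\<^bsub>Q\<^esub> y) = h x \<triangleright>\<^bsub>K\<^esub> h y}"

definition quandle_isomorphic ::
    "('a, 'c) quandle_scheme \<Rightarrow> ('b, 'd) quandle_scheme \<Rightarrow> bool" where
  "quandle_isomorphic Q K \<longleftrightarrow> (\<exists>h\<in>quandle_hom Q K. bij_betw h (carrier Q) (carrier K))"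

text \<open>The list \<open>cs\<close> below is the support of the cycle: \<^term>\<open>cycle_of_list cs\<close> rotates the
  entries of \<open>cs\<close> and fixes every other point.\<close>

definition cyclic_quandle :: "('a, 'b) quandle_scheme \<Rightarrow> bool" where
  "cyclic_quandle Q \<longleftrightarrow>
     quandle Q \<and> finite (carrier Q) \<and> card (carrier Q) > 2 \<and>
     (\<forall>i\<in>carrier Q. \<exists>cs. cycle cs \<and> set cs \<subseteq> carrier Q \<and> length cs = card (carrier Q) - 1 \<and>
        (\<forall>y\<in>carrier Q. y \<triangleright>\<^bsub>Q\<^esub> i = cycle_of_list cs y))"

text \<open>Every finite quandle is isomorphic to one whose elements are natural numbers, so the
  isomorphism classes of cyclic quandles of order \<open>m\<close> are counted on that type.\<close>

definition cyclic_quandles :: "nat \<Rightarrow> nat quandle set" where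
  "cyclic_quandles m = {Q. cyclic_quandle Q \<and> card (carrier Q) = m}"

definition cyclic_quandle_classes :: "nat \<Rightarrow> nat quandle set set" where
  "cyclic_quandle_classes m = cyclic_quandles m //
     {(Q, K). Q \<in> cyclic_quandles m \<and> K \<in> cyclic_quandles m \<and> quandle_isomorphic Q K}"


section \<open>Quandles given by generators and relations\<close>

text \<open>Quandles are the algebras with two operations, \<open>x \<triangleright> y\<close> and its right inverse
  \<open>x / y\<close> (the unique \<open>z\<close> with \<open>z \<triangleright> y = x\<close>), subject to identities.  The presented quandle
  is therefore the algebra of terms in both operations modulo the least congruence that contains
  the relations and all instances of the quandle identities.\<close>

datatype 'g qterm = Gen 'g | Rmul "'g qterm" "'g qterm" | Rdiv "'g qterm" "'g qterm"

inductive_set qcong :: "('g qterm \<times> 'g qterm) set \<Rightarrow> ('g qterm \<times> 'g qterm) set"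
  for rels :: "('g qterm \<times> 'g qterm) set" where
  relation: "(s, t) \<in> rels \<Longrightarrow> (s, t) \<in> qcong rels"
| refl: "(s, s) \<in> qcong rels"
| sym: "(s, t) \<in> qcong rels \<Longrightarrow> (t, s) \<in> qcong rels"
| trans: "(s, t) \<in> qcong rels \<Longrightarrow> (t, u) \<in> qcong rels \<Longrightarrow> (s, u) \<in> qcong rels"
| Rmul_cong: "(s, s') \<in> qcong rels \<Longrightarrow> (t, t') \<in> qcong rels \<Longrightarrow>
    (Rmul s t, Rmul s' t') \<in> qcong rels"
| Rdiv_cong: "(s, s') \<in> qcong rels \<Longrightarrow> (t, t') \<in> qcong rels \<Longrightarrow>
    (Rdiv s t, Rdiv s' t') \<in> qcong rels"
| Rmul_Rdiv: "(Rmul (Rdiv s t) t, s) \<in> qcong rels"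
| Rdiv_Rmul: "(Rdiv (Rmul s t) t, s) \<in> qcong rels"
| self_dist: "(Rmul (Rmul s t) u, Rmul (Rmul s u) (Rmul t u)) \<in> qcong rels"
| idem: "(Rmul s s, s) \<in> qcong rels"

definition presented_quandle :: "('g qterm \<times> 'g qterm) set \<Rightarrow> 'g qterm set quandle" where
  "presented_quandle rels =
     \<lparr>carrier = UNIV // qcong rels,
      qop = \<lambda>A B. \<Union>s\<in>A. \<Union>t\<in>B. qcong rels `` {Rmul s t}\<rparr>"

lemma equiv_qcong: "equiv UNIV (qcong rels)"
proof (rule equivI)
  show "refl (qcong rels)" by (rule refl_onI) (rule qcong.refl)
  show "sym (qcong rels)" by (rule symI) (rule qcong.sym)
  show "trans (qcong rels)" by (rule transI) (rule qcong.trans)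
qed simp

lemma qcong_class_eq_iff:
  "qcong rels `` {s} = qcong rels `` {t} \<longleftrightarrow> (s, t) \<in> qcong rels"
  using equiv_qcong[of rels] by (simp add: eq_equiv_class_iff)

lemma carrier_presented_quandle:
  "carrier (presented_quandle rels) = range (\<lambda>s. qcong rels `` {s})"
  by (auto simp: presented_quandle_def quotient_def)

lemma qop_presented_quandle:
  "qcong rels `` {s} \<triangleright>\<^bsub>presented_quandle rels\<^esub> qcong rels `` {t} = qcong rels `` {Rmul s t}"
proof -
  have *: "qcong rels `` {Rmul s' t'} = qcong rels `` {Rmul s t}"
    if "s' \<in> qcong rels `` {s}" "t' \<in> qcong rels `` {t}" for s' t'
    using that qcong.sym[OF qcong.Rmul_cong] by (simp add: qcong_class_eq_iff)
  have "(\<Union>s'\<in>qcong rels `` {s}. \<Union>t'\<in>qcong rels `` {t}. qcong rels `` {Rmul s' t'}) =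
      (\<Union>s'\<in>qcong rels `` {s}. \<Union>t'\<in>qcong rels `` {t}. qcong rels `` {Rmul s t})"
    by (intro SUP_cong HOL.refl *)
  also have "\<dots> = qcong rels `` {Rmul s t}"
    using qcong.refl[of s rels] qcong.refl[of t rels] by blast
  finally show ?thesis
    by (simp add: presented_quandle_def)
qed

lemma quandle_presented_quandle: "quandle (presented_quandle rels)"
proof
  fix x y assume "x \<in> carrier (presented_quandle rels)" "y \<in> carrier (presented_quandle rels)"
  then obtain s t where xy: "x = qcong rels `` {s}" "y = qcong rels `` {t}"
    by (auto simp: carrier_presented_quandle)
  show "x \<triangleright>\<^bsub>presented_quandle rels\<^esub> y \<in> carrier (presented_quandle rels)"
    by (auto simp: xy qop_presented_quandle carrier_presented_quandle)
  show "\<exists>!z. z \<in> carrier (presented_quandle rels) \<and> y = z \<triangleright>\<^bsub>presented_quandle rels\<^esub> x"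
  proof (rule ex1I[of _ "qcong rels `` {Rdiv t s}"])
    show "qcong rels `` {Rdiv t s} \<in> carrier (presented_quandle rels) \<and>
        y = qcong rels `` {Rdiv t s} \<triangleright>\<^bsub>presented_quandle rels\<^esub> x"
      by (auto simp: xy qop_presented_quandle carrier_presented_quandle qcong_class_eq_iff
          qcong.sym[OF qcong.Rmul_Rdiv])
  next
    fix z assume z: "z \<in> carrier (presented_quandle rels) \<and> y = z \<triangleright>\<^bsub>presented_quandle rels\<^esub> x"
    then obtain u where u: "z = qcong rels `` {u}"
      by (auto simp: carrier_presented_quandle)
    with z have "(t, Rmul u s) \<in> qcong rels"
      by (simp add: xy qop_presented_quandle qcong_class_eq_iff)
    then have "(Rdiv t s, u) \<in> qcong rels"
      by (rule qcong.trans[OF qcong.Rdiv_cong[OF _ qcong.refl] qcong.Rdiv_Rmul])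
    then show "z = qcong rels `` {Rdiv t s}"
      using qcong.sym by (simp add: u qcong_class_eq_iff)
  qed
qed (clarsimp simp: carrier_presented_quandle qop_presented_quandle qcong_class_eq_iff
    qcong.self_dist qcong.idem)+


text \<open>The universal property of the presentation.\<close>

fun qeval :: "('a, 'b) quandle_scheme \<Rightarrow> ('g \<Rightarrow> 'a) \<Rightarrow> 'g qterm \<Rightarrow> 'a" where
  "qeval Q f (Gen g) = f g"
| "qeval Q f (Rmul s t) = qeval Q f s \<triangleright>\<^bsub>Q\<^esub> qeval Q f t"
| "qeval Q f (Rdiv s t) = (THE z. z \<in> carrier Q \<and> qeval Q f s = z \<triangleright>\<^bsub>Q\<^esub> qeval Q f t)"

lemma (in quandle) the_right_div:
  assumes "x \<in> carrier Q" "y \<in> carrier Q"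
  shows "(THE z. z \<in> carrier Q \<and> y = z \<triangleright> x) \<in> carrier Q"
    and "(THE z. z \<in> carrier Q \<and> y = z \<triangleright> x) \<triangleright> x = y"
  using theI'[OF right_div[OF assms]] by auto

lemma (in quandle) right_cancel:
  assumes "x \<in> carrier Q" "y \<in> carrier Q" "z \<in> carrier Q" "y \<triangleright> x = z \<triangleright> x"
  shows "y = z"
  using right_div[of x "z \<triangleright> x"] assms closed by metis

lemma (in quandle) qeval_closed:
  assumes "range f \<subseteq> carrier Q"
  shows "qeval Q f s \<in> carrier Q"
  using assms by (induction s) (auto simp: closed the_right_div)

lemma (in quandle) qeval_qcong:
  assumes f: "range f \<subseteq> carrier Q"
    and rels: "\<And>s t. (s, t) \<in> rels \<Longrightarrow> qeval Q f s = qeval Q f t"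
    and "(s, t) \<in> qcong rels"
  shows "qeval Q f s = qeval Q f t"
  using assms(3)
proof induction
  case (Rdiv_Rmul s t)
  show ?case
    by (rule right_cancel[of "qeval Q f t"])
      (auto simp: qeval_closed[OF f] closed the_right_div)
next
  case (self_dist s t u)
  show ?case
    by (simp only: qeval.simps)
      (rule quandle.self_dist[OF quandle_axioms qeval_closed qeval_closed qeval_closed, OF f f f])
qed (simp_all add: rels qeval_closed[OF f] the_right_div quandle.idem[OF quandle_axioms])

lemma (in quandle) presented_quandle_universal:
  fixes f :: "'g \<Rightarrow> 'a"
  assumes f: "range f \<subseteq> carrier Q"
    and rels: "\<And>s t. (s, t) \<in> rels \<Longrightarrow> qeval Q f s = qeval Q f t"
  shows "\<exists>!h. h \<in> extensional (carrier (presented_quandle rels)) \<and>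
    h \<in> quandle_hom (presented_quandle rels) Q \<and> (\<forall>g. h (qcong rels `` {Gen g}) = f g)"
proof (rule ex_ex1I)
  define k where "k = (\<lambda>A. qeval Q f (SOME s. s \<in> A))"
  define h where "h = restrict k (carrier (presented_quandle rels))"
  have k: "k (qcong rels `` {s}) = qeval Q f s" for s
  proof -
    have "(SOME t. t \<in> qcong rels `` {s}) \<in> qcong rels `` {s}"
      by (rule someI[of _ s]) (auto intro: qcong.refl)
    then show ?thesis
      unfolding k_def using qeval_qcong[OF f rels] by auto
  qed
  have h: "h (qcong rels `` {s}) = qeval Q f s" for s
    by (auto simp: h_def k carrier_presented_quandle)
  have "h \<in> quandle_hom (presented_quandle rels) Q"
    by (auto simp: quandle_hom_def carrier_presented_quandle h qop_presented_quandle
        qeval_closed[OF f])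
  then show "\<exists>h. h \<in> extensional (carrier (presented_quandle rels)) \<and>
      h \<in> quandle_hom (presented_quandle rels) Q \<and> (\<forall>g. h (qcong rels `` {Gen g}) = f g)"
    using h by (intro exI[of _ h]) (auto simp: h_def)
next
  fix h h' :: "'g qterm set \<Rightarrow> 'a"
  let ?P = "\<lambda>h. h \<in> extensional (carrier (presented_quandle rels)) \<and>
    h \<in> quandle_hom (presented_quandle rels) Q \<and> (\<forall>g. h (qcong rels `` {Gen g}) = f g)"
  assume P: "?P h" "?P h'"
  have eval: "k (qcong rels `` {s}) = qeval Q f s" if "?P k" for k s
  proof (induction s)
    case (Gen g)
    then show ?case using that by simp
  next
    case (Rmul s t)
    then show ?case
      using that unfolding quandle_hom_def
      by (simp add: carrier_presented_quandle flip: qop_presented_quandle)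
  next
    case (Rdiv s t)
    have "k (qcong rels `` {Rdiv s t}) \<triangleright> k (qcong rels `` {t}) =
        k (qcong rels `` {Rmul (Rdiv s t) t})"
      using that unfolding quandle_hom_def
      by (simp add: carrier_presented_quandle flip: qop_presented_quandle)
    also have "\<dots> = qeval Q f s"
      using Rdiv.IH(1) qcong.Rmul_Rdiv[of s t rels] by (simp add: qcong_class_eq_iff[THEN iffD2])
    finally have *: "k (qcong rels `` {Rdiv s t}) \<triangleright> qeval Q f t = qeval Q f s"
      using Rdiv by simp
    have "k (qcong rels `` {Rdiv s t}) \<in> carrier Q"
      using that by (auto simp: quandle_hom_def carrier_presented_quandle)
    moreover have "qeval Q f (Rdiv s t) \<triangleright> qeval Q f t = qeval Q f s"
      using the_right_div(2)[OF qeval_closed[OF f] qeval_closed[OF f]] by simp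
    ultimately show ?case
      using right_cancel[OF qeval_closed[OF f, of t] _ qeval_closed[OF f, of "Rdiv s t"]] * by metis
  qed
  show "h = h'"
  proof (rule extensionalityI[of _ "carrier (presented_quandle rels)"])
    fix A assume "A \<in> carrier (presented_quandle rels)"
    then show "h A = h' A"
      using eval[OF P(1)] eval[OF P(2)] by (auto simp: carrier_presented_quandle)
  qed (use P in auto)
qed


section \<open>Primitive elements and the quandles \<open>F\<^bsub>q,\<alpha>\<^esub>\<close>\<close>

definition primitive_element :: "('a, 'b) ring_scheme \<Rightarrow> 'a \<Rightarrow> bool" where
  "primitive_element R \<alpha> \<longleftrightarrow>
     \<alpha> \<in> carrier (mult_of R) \<and> generate (mult_of R) {\<alpha>} = carrier (mult_of R)"

definition field_log :: "('a, 'b) ring_scheme \<Rightarrow> 'a \<Rightarrow> 'a \<Rightarrow> nat" where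
  "field_log R \<alpha> r = (THE i. i \<le> card (carrier R) - 2 \<and> \<alpha> [^]\<^bsub>R\<^esub> i = r)"

definition prime_power_equiv :: "('a, 'b) ring_scheme \<Rightarrow> nat \<Rightarrow> 'a \<Rightarrow> 'a \<Rightarrow> bool" where
  "prime_power_equiv R p \<alpha> \<beta> \<longleftrightarrow> (\<exists>s::nat. \<alpha> = \<beta> [^]\<^bsub>R\<^esub> (p ^ s))"

definition qword :: "'g qterm \<Rightarrow> 'g qterm \<Rightarrow> nat \<Rightarrow> 'g qterm" where
  "qword a b k = ((\<lambda>t. Rmul t b) ^^ k) a"

datatype gen = Gen_x | Gen_y

definition F_rels :: "('a, 'b) ring_scheme \<Rightarrow> 'a \<Rightarrow> (gen qterm \<times> gen qterm) set" where
  "F_rels R \<alpha> = (let q = card (carrier R) in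
     \<Union>(a, b)\<in>{(Gen Gen_x, Gen Gen_y), (Gen Gen_y, Gen Gen_x)}.
       {(qword a b (q - 1), a)} \<union>
       {(qword a b k, qword b a (field_log R \<alpha> (\<one>\<^bsub>R\<^esub> \<ominus>\<^bsub>R\<^esub> \<alpha> [^]\<^bsub>R\<^esub> k))) | k. 1 \<le> k \<and> k \<le> q - 2})"

text \<open>The quandle \<open>F\<^bsub>q,\<alpha>\<^esub>\<close>, where \<open>R\<close> is a field with \<open>q\<close> elements.\<close>

definition F_quandle :: "('a, 'b) ring_scheme \<Rightarrow> 'a \<Rightarrow> gen qterm set quandle" where
  "F_quandle R \<alpha> = presented_quandle (F_rels R \<alpha>)"

end

theory Submission
  imports Defs "HOL-Computational_Algebra.Polynomial" "HOL-Number_Theory.Residues"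
begin

text \<open>Write $R_i$ for right multiplication by \<open>i\<close>.  Eliminating words shows that $F_{q,\alpha}$ has
  at most \<open>q\<close> elements, so it is the affine quandle $x \triangleright y = \alpha x + (1-\alpha) y$ on
  the field.  An isomorphism of two such quandles, normalised to fix 0 and 1, is additive and maps
  $\alpha^k$ to $\beta^k$; it is thus an additive power map, which forces a power of the Frobenius map.

  Conversely every cyclic quandle is of this form.  Automorphisms are determined by two values, and
  left multiplication by \<open>w\<close> is a power of $R_w$, so the products $R_w R_v^{-1}$ with
  $v \neq w$ have no fixed points.  Counting shows that such a product is determined by a single value,
  so these products are the translations of a group structure on the quandle.  This group is abelian by
  idempotency, and the powers of $R_0$ make it a field.  By uniqueness of finite fields the isomorphism
  classes are the orbits of the Frobenius map on primitive elements, and all orbits have \<open>n\<close>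
  elements.\<close>

section \<open>Cyclic quandles and isomorphisms\<close>

text \<open>The constructions are read off from the affine model. There R_w R_v^(-1) is the
  translation by (1-\<alpha>)(w-v), R_0 is multiplication by \<alpha>, and the elements
  \<open>0 \<triangleright> w\<close> and \<open>c \<triangleright> 0\<close>, that is (1-\<alpha>)w
  and \<alpha>c, add up to \<open>c \<triangleright> w\<close>. This last identity becomes the
  definition of addition in an abstract cyclic quandle, with any two distinct points as 0 and 1. The
  obstacle is that cyclicity speaks of right multiplications only, while this definition also needs
  left division; it is obtained because left multiplication commutes with a full cycle. For the
  presented quandle an upper bound on the number of elements is enough, since the universal property
  supplies a surjection onto the affine quandle. The number of classes is a statement without a
  field in it, so a field with p^n elements has to be constructed: it consists of the fixed points
  of the p^n-th power map in an algebraic closure of the integers modulo p.\<close>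

abbreviation qpow :: "('a, 'b) quandle_scheme \<Rightarrow> 'a \<Rightarrow> nat \<Rightarrow> 'a \<Rightarrow> 'a" where
  "qpow Q i k \<equiv> (\<lambda>y. y \<triangleright>\<^bsub>Q\<^esub> i) ^^ k"

lemma (in quandle) qpow_closed [simp]:
  "\<lbrakk>i \<in> carrier Q; y \<in> carrier Q\<rbrakk> \<Longrightarrow> qpow Q i k y \<in> carrier Q"
  by (induction k) (auto simp: closed)

lemma quandle_isomorphic_refl: "quandle_isomorphic Q Q"
  unfolding quandle_isomorphic_def quandle_hom_def by (rule bexI[of _ id]) auto

lemma quandle_isomorphic_trans:
  assumes "quandle_isomorphic Q K" "quandle_isomorphic K M"
  shows "quandle_isomorphic Q M"
proof -
  obtain f g where f: "f \<in> quandle_hom Q K" "bij_betw f (carrier Q) (carrier K)"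
    and g: "g \<in> quandle_hom K M" "bij_betw g (carrier K) (carrier M)"
    using assms unfolding quandle_isomorphic_def by auto
  have "g \<circ> f \<in> quandle_hom Q M"
    using f(1) g(1) by (auto simp: quandle_hom_def Pi_iff)
  with bij_betw_trans[OF f(2) g(2)] show ?thesis
    unfolding quandle_isomorphic_def by blast
qed

lemma (in quandle) quandle_isomorphic_sym:
  assumes "quandle_isomorphic Q K"
  shows "quandle_isomorphic K Q"
proof -
  obtain h where h: "\<And>x y. \<lbrakk>x \<in> carrier Q; y \<in> carrier Q\<rbrakk> \<Longrightarrow> h (x \<triangleright> y) = h x \<triangleright>\<^bsub>K\<^esub> h y"
    and b: "bij_betw h (carrier Q) (carrier K)"
    using assms unfolding quandle_isomorphic_def quandle_hom_def by auto
  let ?g = "the_inv_into (carrier Q) h"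
  have g: "?g x \<in> carrier Q" "h (?g x) = x" if "x \<in> carrier K" for x
    using that b f_the_inv_into_f_bij_betw[OF b] bij_betw_the_inv_into[OF b] bij_betwE by force+
  have gh: "?g (h x) = x" if "x \<in> carrier Q" for x
    using that b by (simp add: bij_betw_def the_inv_into_f_f)
  have "?g \<in> quandle_hom K Q"
    unfolding quandle_hom_def
  proof (intro CollectI conjI ballI Pi_I)
    fix x y assume xy: "x \<in> carrier K" "y \<in> carrier K"
    then have "x \<triangleright>\<^bsub>K\<^esub> y = h (?g x \<triangleright> ?g y)" by (simp add: h g)
    then show "?g (x \<triangleright>\<^bsub>K\<^esub> y) = ?g x \<triangleright> ?g y" using xy by (simp add: gh closed g)
  qed (rule g)
  with bij_betw_the_inv_into[OF b] show ?thesis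
    unfolding quandle_isomorphic_def by blast
qed

lemma (in quandle) quandle_isomorphic_quandle:
  assumes "quandle_isomorphic Q K"
  shows "quandle K"
proof -
  obtain h where h: "\<And>x y. \<lbrakk>x \<in> carrier Q; y \<in> carrier Q\<rbrakk> \<Longrightarrow> h (x \<triangleright> y) = h x \<triangleright>\<^bsub>K\<^esub> h y"
    and b: "bij_betw h (carrier Q) (carrier K)"
    using assms unfolding quandle_isomorphic_def quandle_hom_def by auto
  have K: "carrier K = h ` carrier Q" and inj: "inj_on h (carrier Q)"
    using b by (auto simp: bij_betw_def)
  show ?thesis
  proof
    show "x \<triangleright>\<^bsub>K\<^esub> x = x" if "x \<in> carrier K" for x
      using that by (auto simp: K idem simp flip: h)
    show "x \<triangleright>\<^bsub>K\<^esub> y \<in> carrier K" if "x \<in> carrier K" "y \<in> carrier K" for x y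
      using that by (auto simp: K closed simp flip: h)
    show "(x \<triangleright>\<^bsub>K\<^esub> y) \<triangleright>\<^bsub>K\<^esub> z = (x \<triangleright>\<^bsub>K\<^esub> z) \<triangleright>\<^bsub>K\<^esub> (y \<triangleright>\<^bsub>K\<^esub> z)"
      if "x \<in> carrier K" "y \<in> carrier K" "z \<in> carrier K" for x y z
    proof -
      obtain a b c where "a \<in> carrier Q" "b \<in> carrier Q" "c \<in> carrier Q" "x = h a" "y = h b" "z = h c"
        using \<open>x \<in> carrier K\<close> \<open>y \<in> carrier K\<close> \<open>z \<in> carrier K\<close> by (auto simp: K)
      then show ?thesis using self_dist[of a b c] by (metis h closed)
    qed
    show "\<exists>!z. z \<in> carrier K \<and> y = z \<triangleright>\<^bsub>K\<^esub> x" if xy: "x \<in> carrier K" "y \<in> carrier K" for x y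
    proof -
      obtain a b where ab: "a \<in> carrier Q" "b \<in> carrier Q" "x = h a" "y = h b"
        using xy by (auto simp: K)
      obtain c where c: "c \<in> carrier Q" "b = c \<triangleright> a" using right_div[OF ab(1,2)] by auto
      show ?thesis
      proof (rule ex1I[of _ "h c"])
        show "h c \<in> carrier K \<and> y = h c \<triangleright>\<^bsub>K\<^esub> x" using ab c h by (auto simp: K)
        fix z assume "z \<in> carrier K \<and> y = z \<triangleright>\<^bsub>K\<^esub> x"
        then obtain d where d: "d \<in> carrier Q" "z = h d" "h b = h (d \<triangleright> a)"
          using ab h by (auto simp: K)
        then have "b = d \<triangleright> a" using inj_onD[OF inj d(3)] ab closed by blast
        then show "z = h c" using right_cancel[OF ab(1) d(1) c(1)] c(2) d(2) by metis
      qed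
    qed
  qed
qed

text \<open>Idempotency forces the point left out of the cycle to be \<open>i\<close> itself, so R_i
  runs through all other points from any start \<open>b\<close>. Cycles are used later only in this
  orbit form.\<close>

lemma cyclic_quandle_enumeration:
  fixes Q (structure)
  assumes "cyclic_quandle Q" "i \<in> carrier Q" "b \<in> carrier Q" "b \<noteq> i"
  shows "bij_betw (\<lambda>k. qpow Q i k b) {..<card (carrier Q) - 1} (carrier Q - {i})"
    and "qpow Q i (card (carrier Q) - 1) b = b"
proof -
  interpret quandle Q using assms(1) by (simp add: cyclic_quandle_def)
  define m where "m = card (carrier Q) - 1"
  obtain cs where cs: "distinct cs" "set cs \<subseteq> carrier Q" "length cs = m"
    and op: "\<And>y. y \<in> carrier Q \<Longrightarrow> y \<triangleright> i = cycle_of_list cs y"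
    using assms(1,2) unfolding cyclic_quandle_def m_def by blast
  have fin: "finite (carrier Q)" and m: "m > 1"
    using assms(1) by (auto simp: cyclic_quandle_def m_def)
  have pow: "qpow Q i k y = (cycle_of_list cs ^^ k) y" if "y \<in> carrier Q" for k y
  proof (induction k)
    case (Suc k)
    show ?case using op[OF qpow_closed[OF assms(2) that, of k]] Suc by simp
  qed simp
  have nth: "(cycle_of_list cs ^^ k) (cs ! j) = cs ! ((k + j) mod m)" if "j < m" for k j
    using arg_cong[OF cyclic_rotation[OF cs(1), of k], of "\<lambda>l. l ! j"] that cs(3)
    by (simp add: nth_rotate)
  \<comment> \<open>A rotation of at least two distinct entries moves each of them, whereas
    \<open>i \<triangleright> i = i\<close>; \<open>m > 1\<close> comes from a cardinality above
    2.\<close>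
  have "i \<notin> set cs"
  proof
    assume "i \<in> set cs"
    then obtain j where j: "j < m" "cs ! j = i" using cs(3) by (auto simp: in_set_conv_nth)
    have "cs ! j = cs ! ((1 + j) mod m)"
      using nth[OF j(1), of 1] op[OF assms(2)] idem[OF assms(2)] j by simp
    then have "j = (1 + j) mod m"
      using nth_eq_iff_index_eq[OF cs(1)] j cs(3) m by simp
    then show False using m j by (cases "1 + j = m") auto
  qed
  then have set: "set cs = carrier Q - {i}"
    using cs fin assms(2) distinct_card[OF cs(1)]
    by (intro card_subset_eq) (auto simp: card_Diff_singleton m_def)
  then obtain j where j: "j < m" "b = cs ! j"
    using assms(3,4) cs(3) by (metis Diff_iff in_set_conv_nth singletonD)
  have b: "qpow Q i k b = cs ! ((k + j) mod m)" for k
    using pow[OF assms(3)] nth[OF j(1)] j(2) by simp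
  have inj: "inj_on (\<lambda>k. qpow Q i k b) {..<m}"
  proof (rule inj_onI)
    fix k l assume kl: "k \<in> {..<m}" "l \<in> {..<m}" "qpow Q i k b = qpow Q i l b"
    then have "(k + j) mod m = (l + j) mod m"
      using nth_eq_iff_index_eq[OF cs(1), of "(k + j) mod m" "(l + j) mod m"] cs(3) m b by simp
    then have "k mod m = l mod m"
      using cong_add_rcancel_nat[of k j l m] by (simp add: cong_def)
    then show "k = l" using kl by simp
  qed
  have "(\<lambda>k. qpow Q i k b) ` {..<m} = carrier Q - {i}"
  proof (rule card_subset_eq)
    show "(\<lambda>k. qpow Q i k b) ` {..<m} \<subseteq> carrier Q - {i}"
      unfolding set[symmetric] using b cs(3) m by (auto intro!: nth_mem mod_less_divisor)
    show "card ((\<lambda>k. qpow Q i k b) ` {..<m}) = card (carrier Q - {i})"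
      using card_image[OF inj] fin assms(2) by (simp add: card_Diff_singleton m_def)
  qed (use fin in auto)
  with inj show "bij_betw (\<lambda>k. qpow Q i k b) {..<card (carrier Q) - 1} (carrier Q - {i})"
    by (simp add: bij_betw_def m_def)
  show "qpow Q i (card (carrier Q) - 1) b = b"
    using b[of m] j by (simp add: m_def)
qed

text \<open>The orbit of \<open>b\<close> is the required list. It is distinct because its entries
  are as many as the points they cover, and the last condition in \<open>enum\<close> closes the
  rotation.\<close>

lemma (in quandle) cyclic_quandleI:
  assumes fin: "finite (carrier Q)" and m: "card (carrier Q) > 2"
    and enum: "\<And>i. i \<in> carrier Q \<Longrightarrow> \<exists>b\<in>carrier Q.
      carrier Q - {i} = (\<lambda>k. qpow Q i k b) ` {..<card (carrier Q) - 1} \<and>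
      qpow Q i (card (carrier Q) - 1) b = b"
  shows "cyclic_quandle Q"
  unfolding cyclic_quandle_def
proof (intro conjI ballI)
  fix i assume i: "i \<in> carrier Q"
  let ?m = "card (carrier Q) - 1"
  obtain b where b: "b \<in> carrier Q" "carrier Q - {i} = (\<lambda>k. qpow Q i k b) ` {..<?m}"
      "qpow Q i ?m b = b"
    using enum[OF i] by auto
  define cs where "cs = map (\<lambda>k. qpow Q i k b) [0..<?m]"
  have len: "length cs = ?m" by (simp add: cs_def)
  have set: "set cs = carrier Q - {i}" unfolding b(2) by (auto simp: cs_def atLeast0LessThan)
  have dist: "distinct cs"
    by (rule card_distinct) (simp add: set len fin i card_Diff_singleton)
  have "y \<triangleright> i = cycle_of_list cs y" if y: "y \<in> carrier Q" for y
  proof (cases "y = i")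
    case True
    then show ?thesis using idem[OF i] id_outside_supp[of y cs] set by simp
  next
    case False
    then obtain j where j: "j < ?m" "y = cs ! j"
      using set len y by (metis Diff_iff in_set_conv_nth singletonD)
    have "cycle_of_list cs (cs ! j) = cs ! (Suc j mod ?m)"
      using arg_cong[OF cyclic_rotation[OF dist, of 1], of "\<lambda>l. l ! j"] j(1) len
      by (simp add: nth_rotate1)
    also have "\<dots> = qpow Q i (Suc j) b"
      using j(1) b(3) m by (cases "Suc j = ?m") (auto simp: cs_def)
    also have "\<dots> = y \<triangleright> i" using j by (simp add: cs_def)
    finally show ?thesis using j by simp
  qed
  then show "\<exists>cs. cycle cs \<and> set cs \<subseteq> carrier Q \<and> length cs = ?m \<and>
        (\<forall>y\<in>carrier Q. y \<triangleright> i = cycle_of_list cs y)"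
    using dist set len by blast
qed (use quandle_axioms fin m in auto)

text \<open>An isomorphism carries the orbits of a right multiplication to orbits of the right
  multiplication by the image point, so the orbit form of the cycle condition transfers.\<close>

lemma quandle_isomorphic_cyclic_quandle:
  fixes Q (structure)
  assumes "cyclic_quandle Q" "quandle_isomorphic Q K"
  shows "cyclic_quandle K" and "card (carrier K) = card (carrier Q)"
proof -
  interpret quandle Q using assms(1) by (simp add: cyclic_quandle_def)
  interpret K: quandle K using quandle_isomorphic_quandle[OF assms(2)] .
  obtain h where h: "\<And>x y. \<lbrakk>x \<in> carrier Q; y \<in> carrier Q\<rbrakk> \<Longrightarrow> h (x \<triangleright> y) = h x \<triangleright>\<^bsub>K\<^esub> h y"
    and bij: "bij_betw h (carrier Q) (carrier K)"
    using assms unfolding quandle_isomorphic_def quandle_hom_def by auto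
  have K: "carrier K = h ` carrier Q" and inj: "inj_on h (carrier Q)"
    using bij by (auto simp: bij_betw_def)
  show card: "card (carrier K) = card (carrier Q)"
    using bij_betw_same_card[OF bij] by simp
  have fin: "finite (carrier Q)" and m: "card (carrier Q) > 2"
    using assms(1) by (auto simp: cyclic_quandle_def)
  have pow: "h (qpow Q i k b) = qpow K (h i) k (h b)" if "i \<in> carrier Q" "b \<in> carrier Q" for i k b
    by (induction k) (auto simp: h that)
  show "cyclic_quandle K"
  proof (rule K.cyclic_quandleI)
    fix i assume "i \<in> carrier K"
    then obtain j where j: "j \<in> carrier Q" "i = h j" by (auto simp: K)
    obtain b where b: "b \<in> carrier Q" "b \<noteq> j"
    proof -
      have "\<not> carrier Q \<subseteq> {j}" using m card_mono[of "{j}" "carrier Q"] by auto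
      then show thesis using that by auto
    qed
    note e = cyclic_quandle_enumeration[OF assms(1) j(1) b]
    have "carrier K - {i} = h ` (carrier Q - {j})"
      using inj j by (auto simp: K dest: inj_onD)
    also have "carrier Q - {j} = (\<lambda>k. qpow Q j k b) ` {..<card (carrier Q) - 1}"
      using e(1) by (simp add: bij_betw_def)
    also have "h ` \<dots> = (\<lambda>k. qpow K i k (h b)) ` {..<card (carrier K) - 1}"
      using pow[OF j(1) b(1)] by (simp add: image_image card j)
    finally show "\<exists>b\<in>carrier K. carrier K - {i} = (\<lambda>k. qpow K i k b) ` {..<card (carrier K) - 1} \<and>
      qpow K i (card (carrier K) - 1) b = b"
      using pow[OF j(1) b(1), of "card (carrier Q) - 1", unfolded e(2), folded card j(2)] b(1)
      by (intro bexI[of _ "h b"]) (auto simp: K)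
  qed (use fin m card K in auto)
qed


section \<open>Translations of cyclic quandles\<close>

definition quandle_auts :: "('a, 'b) quandle_scheme \<Rightarrow> ('a \<Rightarrow> 'a) set" where
  "quandle_auts Q = {f \<in> quandle_hom Q Q. bij_betw f (carrier Q) (carrier Q)}"

context quandle
begin

definition rdiv :: "'a \<Rightarrow> 'a \<Rightarrow> 'a" where
  "rdiv y x = (THE z. z \<in> carrier Q \<and> y = z \<triangleright> x)"

lemma rdiv_closed [simp]: "\<lbrakk>x \<in> carrier Q; y \<in> carrier Q\<rbrakk> \<Longrightarrow> rdiv y x \<in> carrier Q"
  and rdiv_mult [simp]: "\<lbrakk>x \<in> carrier Q; y \<in> carrier Q\<rbrakk> \<Longrightarrow> rdiv y x \<triangleright> x = y"
  unfolding rdiv_def by (rule the_right_div; assumption)+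

lemma rdiv_eqI: "\<lbrakk>x \<in> carrier Q; z \<in> carrier Q; z \<triangleright> x = y\<rbrakk> \<Longrightarrow> rdiv y x = z"
  using right_cancel[of x "rdiv y x" z] closed by auto

lemma mult_rdiv [simp]: "\<lbrakk>x \<in> carrier Q; z \<in> carrier Q\<rbrakk> \<Longrightarrow> rdiv (z \<triangleright> x) x = z"
  by (rule rdiv_eqI) auto

lemma aut_closed: "\<lbrakk>f \<in> quandle_auts Q; x \<in> carrier Q\<rbrakk> \<Longrightarrow> f x \<in> carrier Q"
  and aut_hom: "\<lbrakk>f \<in> quandle_auts Q; x \<in> carrier Q; y \<in> carrier Q\<rbrakk> \<Longrightarrow> f (x \<triangleright> y) = f x \<triangleright> f y"
  and aut_inj: "\<lbrakk>f \<in> quandle_auts Q; x \<in> carrier Q; y \<in> carrier Q; f x = f y\<rbrakk> \<Longrightarrow> x = y"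
  unfolding quandle_auts_def quandle_hom_def bij_betw_def by (auto dest: inj_onD)

lemma aut_comp: "\<lbrakk>f \<in> quandle_auts Q; g \<in> quandle_auts Q\<rbrakk> \<Longrightarrow> f \<circ> g \<in> quandle_auts Q"
  unfolding quandle_auts_def quandle_hom_def by (auto intro: bij_betw_trans simp: Pi_iff)

lemma aut_id: "id \<in> quandle_auts Q"
  unfolding quandle_auts_def quandle_hom_def by auto

lemma aut_right_mult:
  assumes i: "i \<in> carrier Q"
  shows "(\<lambda>y. y \<triangleright> i) \<in> quandle_auts Q"
proof -
  have "bij_betw (\<lambda>y. y \<triangleright> i) (carrier Q) (carrier Q)"
    by (rule bij_betwI[where g = "\<lambda>y. rdiv y i"]) (auto simp: i closed)
  then show ?thesis
    using i by (auto simp: quandle_auts_def quandle_hom_def closed self_dist[OF _ _ i])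
qed

lemma aut_qpow: "i \<in> carrier Q \<Longrightarrow> qpow Q i k \<in> quandle_auts Q"
proof (induction k)
  case 0
  then show ?case using aut_id by (simp add: id_def)
next
  case (Suc k)
  then show ?case using aut_comp[OF aut_right_mult[of i] Suc.IH] by (simp add: comp_def)
qed

lemma aut_rdiv:
  assumes i: "i \<in> carrier Q"
  shows "(\<lambda>y. rdiv y i) \<in> quandle_auts Q"
proof -
  have "bij_betw (\<lambda>y. rdiv y i) (carrier Q) (carrier Q)"
    by (rule bij_betwI[where g = "\<lambda>y. y \<triangleright> i"]) (auto simp: i closed)
  moreover have "rdiv (y \<triangleright> z) i = rdiv y i \<triangleright> rdiv z i" if "y \<in> carrier Q" "z \<in> carrier Q" for y z
    by (rule rdiv_eqI) (use i that self_dist[of "rdiv y i" "rdiv z i" i] in \<open>auto simp: closed\<close>)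
  ultimately show ?thesis
    using i by (auto simp: quandle_auts_def quandle_hom_def)
qed

lemma qpow_self [simp]: "i \<in> carrier Q \<Longrightarrow> qpow Q i k i = i"
  by (induction k) (auto simp: idem)

lemma qpow_add: "qpow Q i (j + k) x = qpow Q i j (qpow Q i k x)"
  by (simp add: funpow_add)

lemma aut_qpow_commute:
  assumes "f \<in> quandle_auts Q" "i \<in> carrier Q" "x \<in> carrier Q"
  shows "f (qpow Q i k x) = qpow Q (f i) k (f x)"
  using assms by (induction k) (auto simp: aut_hom)

end

locale cyclic_type_quandle = quandle +
  assumes cyclic: "cyclic_quandle Q"
begin

lemma finite_carrier [simp]: "finite (carrier Q)" and card_carrier_gt: "card (carrier Q) > 2"
  using cyclic by (auto simp: cyclic_quandle_def)

lemma orbitE: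
  assumes "i \<in> carrier Q" "b \<in> carrier Q" "b \<noteq> i" "y \<in> carrier Q" "y \<noteq> i"
  obtains k where "k < card (carrier Q) - 1" "y = qpow Q i k b"
proof -
  have "y \<in> (\<lambda>k. qpow Q i k b) ` {..<card (carrier Q) - 1}"
    using bij_betw_imp_surj_on[OF cyclic_quandle_enumeration(1)[OF cyclic assms(1-3)]] assms(4,5)
    by blast
  then show thesis using that by blast
qed

lemma qpow_eq_iff:
  assumes "i \<in> carrier Q" "b \<in> carrier Q" "b \<noteq> i"
    "j < card (carrier Q) - 1" "k < card (carrier Q) - 1"
  shows "qpow Q i j b = qpow Q i k b \<longleftrightarrow> j = k"
  using inj_on_eq_iff[OF bij_betw_imp_inj_on[OF cyclic_quandle_enumeration(1)[OF cyclic assms(1-3)]],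
      of j k] assms(4,5)
  by simp

lemma qpow_order: "\<lbrakk>i \<in> carrier Q; b \<in> carrier Q\<rbrakk> \<Longrightarrow> qpow Q i (card (carrier Q) - 1) b = b"
  using cyclic_quandle_enumeration(2)[OF cyclic] by (cases "b = i") auto

text \<open>With more than two points, 0 and 1 are different exponents below the orbit length, so
  R_i moves every point but \<open>i\<close>.\<close>

lemma fixed_iff:
  assumes "i \<in> carrier Q" "w \<in> carrier Q"
  shows "w \<triangleright> i = w \<longleftrightarrow> w = i"
  using qpow_eq_iff[OF assms, of 1 0] idem[OF assms(1)] card_carrier_gt by fastforce

text \<open>The R_a-orbit of \<open>c\<close> exhausts the points other than \<open>a\<close>, and
  an automorphism \<open>f\<close> turns R_a into R_(f a); hence two values determine it.\<close>

lemma aut_eqI: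
  assumes "f \<in> quandle_auts Q" "g \<in> quandle_auts Q" "a \<in> carrier Q" "c \<in> carrier Q" "a \<noteq> c"
    "f a = g a" "f c = g c" "z \<in> carrier Q"
  shows "f z = g z"
proof (cases "z = a")
  case False
  then obtain k where "z = qpow Q a k c"
    using orbitE[of a c z] assms by auto
  then show ?thesis
    using aut_qpow_commute[OF assms(1,3,4), of k] aut_qpow_commute[OF assms(2,3,4), of k] assms(6,7)
    by simp
qed (use assms in simp)

text \<open>Left multiplication by \<open>w\<close> commutes with the cycle given by right multiplication by
  \<open>w\<close>, and is therefore a power of it.\<close>

lemma left_mult_qpow:
  assumes w: "w \<in> carrier Q" and x: "x \<in> carrier Q"
  shows "w \<triangleright> qpow Q w k x = qpow Q w k (w \<triangleright> x)"
  using aut_hom[OF aut_qpow[OF w, of k] w x] w by simp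

text \<open>If \<open>y\<close> is R_w^k x, then equal products mean that R_w^k fixes
  \<open>w \<triangleright> x\<close>; this point differs from \<open>w\<close>, so it lies on the
  long cycle and k = 0.\<close>

lemma left_cancel:
  assumes "w \<in> carrier Q" "x \<in> carrier Q" "y \<in> carrier Q" "w \<triangleright> x = w \<triangleright> y"
  shows "x = y"
proof (cases "x = w \<or> y = w")
  case True
  then show ?thesis using fixed_iff[OF assms(2,1)] fixed_iff[OF assms(3,1)] idem[OF assms(1)] assms(4)
    by auto
next
  case False
  then obtain k where k: "k < card (carrier Q) - 1" "y = qpow Q w k x"
    using orbitE[of w x y] assms by auto
  then have "qpow Q w k (w \<triangleright> x) = qpow Q w 0 (w \<triangleright> x)"
    using assms left_mult_qpow[of w x k] by simp
  then have "k = 0"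
    using qpow_eq_iff[of w "w \<triangleright> x" k 0] k False fixed_iff[of x w] assms closed card_carrier_gt
    by auto
  then show ?thesis using k by simp
qed

lemma left_mult_eq_qpow:
  assumes w: "w \<in> carrier Q"
  obtains e where "\<And>x. x \<in> carrier Q \<Longrightarrow> w \<triangleright> x = qpow Q w e x"
proof -
  have "\<not> carrier Q \<subseteq> {w}" using card_carrier_gt card_mono[of "{w}" "carrier Q"] by auto
  then obtain b where b: "b \<in> carrier Q" "b \<noteq> w" by auto
  then have "w \<triangleright> b \<noteq> w" using fixed_iff[of b w] w by auto
  then obtain e where e: "w \<triangleright> b = qpow Q w e b"
    using orbitE[OF w b closed[OF w b(1)]] by auto
  have "w \<triangleright> x = qpow Q w e x" if x: "x \<in> carrier Q" for x
  proof (cases "x = w")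
    case False
    then obtain k where k: "x = qpow Q w k b" using orbitE[OF w b x] by auto
    have "w \<triangleright> x = qpow Q w (k + e) b"
      by (simp add: k left_mult_qpow w b e qpow_add)
    then show ?thesis by (simp add: k add.commute flip: qpow_add)
  qed (simp add: w idem)
  then show thesis by (rule that)
qed

text \<open>A power of R_w is an automorphism, hence so is left multiplication by \<open>w\<close>:
  the quandle is left distributive and admits left division. This puts both sides on an equal
  footing in the definition of \<open>plus\<close>.\<close>

lemma aut_left_mult:
  assumes "w \<in> carrier Q"
  shows "(\<lambda>x. w \<triangleright> x) \<in> quandle_auts Q"
proof -
  obtain e where e: "\<And>x. x \<in> carrier Q \<Longrightarrow> w \<triangleright> x = qpow Q w e x"
    using left_mult_eq_qpow[OF assms] by blast
  have "bij_betw (\<lambda>x. w \<triangleright> x) (carrier Q) (carrier Q)"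
    using aut_qpow[OF assms, of e] e by (simp add: quandle_auts_def cong: bij_betw_cong)
  then show ?thesis
    using aut_qpow[OF assms, of e] e assms closed
    by (auto simp: quandle_auts_def quandle_hom_def)
qed

text \<open>Let \<open>m\<close> be the order of the quandle.  An automorphism is determined by its values at
  \<open>a\<close> and \<open>c\<close>, so at most \<open>m - 1\<close> of them map \<open>a\<close> to \<open>b\<close>.  Powers of right multiplications
  already give \<open>m - 2\<close> of these, one for every fixed point other than \<open>a\<close> and \<open>b\<close>.\<close>

lemma fixed_point_free_aut_eq:
  assumes s: "s \<in> quandle_auts Q" "\<And>z. z \<in> carrier Q \<Longrightarrow> s z \<noteq> z"
    and t: "t \<in> quandle_auts Q" "\<And>z. z \<in> carrier Q \<Longrightarrow> t z \<noteq> z"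
    and a: "a \<in> carrier Q" "s a = t a" and c: "c \<in> carrier Q"
  shows "s c = t c"
proof (cases "c = a")
  case ca: False
  define b where "b = s a"
  have b: "b \<in> carrier Q" "b \<noteq> a" using aut_closed[OF s(1) a(1)] s(2)[OF a(1)] by (auto simp: b_def)
  \<comment> \<open>A suitable power of R_z fixes \<open>z\<close> and takes \<open>a\<close> to
    \<open>b\<close>, since both lie on its cycle.\<close>
  have "\<exists>f\<in>quandle_auts Q. f z = z \<and> f a = b" if "z \<in> carrier Q - {a, b}" for z
    using that orbitE[of z a b] a(1) b aut_qpow[of z] qpow_self[of z] by (metis Diff_iff insertCI)
  then obtain F where F: "\<And>z. z \<in> carrier Q - {a, b} \<Longrightarrow> F z \<in> quandle_auts Q"
      "\<And>z. z \<in> carrier Q - {a, b} \<Longrightarrow> F z z = z" "\<And>z. z \<in> carrier Q - {a, b} \<Longrightarrow> F z a = b"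
    by metis
  define I where "I = (\<lambda>z. F z c) ` (carrier Q - {a, b})"
  \<comment> \<open>If \<open>F z\<close> and \<open>F z'\<close> agreed at \<open>c\<close> as well
    as at \<open>a\<close>, they would coincide; then \<open>F z\<close> fixes two points and is the
    identity, although it moves \<open>a\<close>.\<close>
  have inj: "inj_on (\<lambda>z. F z c) (carrier Q - {a, b})"
  proof (rule inj_onI, rule ccontr)
    fix z z' assume z: "z \<in> carrier Q - {a, b}" "z' \<in> carrier Q - {a, b}" "F z c = F z' c" "z \<noteq> z'"
    have zX: "z \<in> carrier Q" "z' \<in> carrier Q" using z by auto
    have "F z z' = F z' z'"
      by (rule aut_eqI[OF F(1)[OF z(1)] F(1)[OF z(2)] a(1) c ca[symmetric] _ z(3) zX(2)])
        (simp add: F(3)[OF z(1)] F(3)[OF z(2)])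
    then have "F z a = id a"
      by (intro aut_eqI[OF F(1)[OF z(1)] aut_id zX z(4) _ _ a(1)])
        (simp_all add: F(2)[OF z(1)] F(2)[OF z(2)])
    then show False using F(3)[OF z(1)] b by simp
  qed
  \<comment> \<open>Agreement with some \<open>F z\<close> at both \<open>a\<close> and
    \<open>c\<close> would make \<open>u\<close> equal to it, but \<open>F z\<close> has the fixed
    point \<open>z\<close>.\<close>
  have notin: "u c \<notin> I" if u: "u \<in> quandle_auts Q" "\<And>z. z \<in> carrier Q \<Longrightarrow> u z \<noteq> z" "u a = b" for u
  proof
    assume "u c \<in> I"
    then obtain z where z: "z \<in> carrier Q - {a, b}" "u c = F z c" by (auto simp: I_def)
    then have "u z = F z z"
      using aut_eqI[OF u(1) F(1)[OF z(1)] a(1) c ca[symmetric] _ z(2), of z] F(3)[OF z(1)] u(3) by simp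
    then show False using F(2)[OF z(1)] u(2) z(1) by simp
  qed
  have st: "s c \<notin> I" "t c \<notin> I"
    using notin[OF s] notin[OF t] a(2) by (simp_all add: b_def)
  have range: "u c \<in> carrier Q - {b}" if u: "u \<in> quandle_auts Q" "u a = b" for u
    using aut_closed[OF u(1) c] aut_inj[OF u(1) c a(1)] u(2) ca by auto
  have "I \<subseteq> carrier Q - {b}"
    unfolding I_def by (intro image_subsetI range F)
  then have "insert (s c) (insert (t c) I) \<subseteq> carrier Q - {b}"
    using range[OF s(1)] range[OF t(1)] a(2) by (simp add: b_def)
  then have le: "card (insert (s c) (insert (t c) I)) \<le> card (carrier Q) - 1"
    using card_mono[of "carrier Q - {b}"] b by fastforce
  have I: "card I = card (carrier Q) - 2"
    using card_image[OF inj] b a(1) by (simp add: I_def card_Diff_subset)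
  have "finite I" by (simp add: I_def)
  \<comment> \<open>Of the m-1 values possible at \<open>c\<close>, where m is the order of the
    quandle, m-2 belong to \<open>I\<close>; the one that remains is shared by \<open>s\<close> and
    \<open>t\<close>.\<close>
  show ?thesis
  proof (rule ccontr)
    assume "s c \<noteq> t c"
    then have "card (insert (s c) (insert (t c) I)) = card I + 2"
      using st \<open>finite I\<close> by simp
    then show False using le I card_carrier_gt by linarith
  qed
qed (use a in simp)

text \<open>The maps R_w R_v^(-1) and R_w' R_v'^(-1) agree at the point
  \<open>a \<triangleright> v\<close>, hence everywhere. For \<open>v \<noteq> w\<close> there is no
  fixed point: it would give \<open>x \<triangleright> w = x \<triangleright> v\<close> and, by left
  cancellation, \<open>v = w\<close>. The statement is free of divisions to suit computations with
  \<open>plus\<close>.\<close>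

lemma translation_eq:
  assumes X: "v \<in> carrier Q" "w \<in> carrier Q" "v' \<in> carrier Q" "w' \<in> carrier Q"
    "a \<in> carrier Q" "a' \<in> carrier Q" "c \<in> carrier Q" "c' \<in> carrier Q"
    and a: "a \<triangleright> v = a' \<triangleright> v'" "a \<triangleright> w = a' \<triangleright> w'" and c: "c \<triangleright> v = c' \<triangleright> v'"
  shows "c \<triangleright> w = c' \<triangleright> w'"
proof (cases "v = w")
  case True
  then have "v' = w'" using left_cancel[of a' v' w'] X a by auto
  then show ?thesis using True c by simp
next
  case False
  then have False': "v' \<noteq> w'" using left_cancel[of a v w] X a by auto
  have aut: "(\<lambda>y. y \<triangleright> w) \<circ> (\<lambda>y. rdiv y v) \<in> quandle_auts Q" if "v \<in> carrier Q" "w \<in> carrier Q" for v w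
    by (intro aut_comp aut_right_mult aut_rdiv that)
  have fpf: "((\<lambda>y. y \<triangleright> w) \<circ> (\<lambda>y. rdiv y v)) z \<noteq> z"
    if "v \<in> carrier Q" "w \<in> carrier Q" "v \<noteq> w" "z \<in> carrier Q" for v w z
    using left_cancel[of "rdiv z v" v w] rdiv_mult[of v z] rdiv_closed[of v z] that by auto
  have eq: "rdiv (x \<triangleright> v) v = x" if "x \<in> carrier Q" "v \<in> carrier Q" for x v
    by (rule rdiv_eqI) (use that in auto)
  have "((\<lambda>y. y \<triangleright> w) \<circ> (\<lambda>y. rdiv y v)) (c \<triangleright> v) = ((\<lambda>y. y \<triangleright> w') \<circ> (\<lambda>y. rdiv y v')) (c \<triangleright> v)"
    by (rule fixed_point_free_aut_eq[OF aut fpf aut fpf, where a = "a \<triangleright> v"])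
      (use X False False' closed a eq[of a v] eq[of a' v'] in auto)
  then show ?thesis
    using X c eq[of c v] eq[of c' v'] by simp
qed

end


section \<open>The field of a cyclic quandle\<close>

definition affine_quandle :: "('a, 'b) ring_scheme \<Rightarrow> 'a \<Rightarrow> 'a quandle" where
  "affine_quandle R \<alpha> = \<lparr>carrier = carrier R,
     qop = \<lambda>x y. \<alpha> \<otimes>\<^bsub>R\<^esub> x \<oplus>\<^bsub>R\<^esub> (\<one>\<^bsub>R\<^esub> \<ominus>\<^bsub>R\<^esub> \<alpha>) \<otimes>\<^bsub>R\<^esub> y\<rparr>"

lemma mult_of_eq: "Multiplicative_Group.mult_of R = mult_of R"
  by (simp add: mult_of_def Multiplicative_Group.mult_of_def)

lemma (in field) mult_of_group: "group (mult_of R)"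
  using field_mult_group by (simp add: mult_of_eq)

lemma (in field) primitive_element_iff:
  assumes "finite (carrier R)"
  shows "primitive_element R \<alpha> \<longleftrightarrow>
    \<alpha> \<in> carrier R - {\<zero>} \<and> carrier R - {\<zero>} = range (\<lambda>k::nat. \<alpha> [^] k)"
proof -
  interpret M: group "mult_of R" by (rule mult_of_group)
  show ?thesis
    unfolding primitive_element_def
    using M.generate_pow_on_finite_carrier[of \<alpha>] assms
    by (auto simp: nat_pow_mult_of full_SetCompr_eq)
qed

locale pointed_cyclic_type_quandle = cyclic_type_quandle +
  fixes zer e
  assumes zer [simp]: "zer \<in> carrier Q" and e [simp]: "e \<in> carrier Q" and e_neq_o [simp]: "e \<noteq> zer"
begin

definition ldiv :: "'a \<Rightarrow> 'a" where
  "ldiv x = (THE w. w \<in> carrier Q \<and> zer \<triangleright> w = x)"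

lemma ldiv_mult [simp]: "w \<in> carrier Q \<Longrightarrow> ldiv (zer \<triangleright> w) = w"
  unfolding ldiv_def by (rule the_equality) (auto dest: left_cancel[OF zer])

lemma left_divE:
  assumes "x \<in> carrier Q" obtains w where "w \<in> carrier Q" "x = zer \<triangleright> w"
  using aut_left_mult[OF zer] assms unfolding quandle_auts_def bij_betw_def by auto

lemma right_divE:
  assumes "x \<in> carrier Q" obtains w where "w \<in> carrier Q" "x = w \<triangleright> zer"
  using right_div[OF zer assms] by blast

text \<open>Adding \<open>x\<close> is the translation, i.e. a right multiplication composed with the inverse of
  one, that maps \<open>zer\<close> to \<open>x\<close>.\<close>

definition plus :: "'a \<Rightarrow> 'a \<Rightarrow> 'a" where
  "plus x y = rdiv y zer \<triangleright> ldiv x"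

lemma plus_eq [simp]:
  "\<lbrakk>c \<in> carrier Q; w \<in> carrier Q\<rbrakk> \<Longrightarrow> plus (zer \<triangleright> w) (c \<triangleright> zer) = c \<triangleright> w"
  by (simp add: plus_def)

lemma plus_closed: "\<lbrakk>x \<in> carrier Q; y \<in> carrier Q\<rbrakk> \<Longrightarrow> plus x y \<in> carrier Q"
  by (elim left_divE[of x] right_divE[of y]) (simp add: closed)

lemma plus_o_left: "y \<in> carrier Q \<Longrightarrow> plus zer y = y"
  using plus_eq[of _ zer] idem[OF zer] by (elim right_divE[of y]) simp

text \<open>Both sides are values of translations. With
  \<open>y = b \<triangleright> zer = zer \<triangleright> v\<close>, the maps R_w R_zer^(-1) and
  R_u R_v^(-1) both take \<open>y\<close> to \<open>plus x y\<close>, so they also agree at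
  \<open>plus y z\<close>, which is \<open>d \<triangleright> zer\<close> and
  \<open>c \<triangleright> v\<close>.\<close>

lemma plus_assoc:
  assumes "x \<in> carrier Q" "y \<in> carrier Q" "z \<in> carrier Q"
  shows "plus (plus x y) z = plus x (plus y z)"
proof -
  obtain w where w: "w \<in> carrier Q" "x = zer \<triangleright> w" using left_divE assms(1) .
  obtain v where v: "v \<in> carrier Q" "y = zer \<triangleright> v" using left_divE assms(2) .
  obtain b where b: "b \<in> carrier Q" "y = b \<triangleright> zer" using right_divE assms(2) .
  obtain c where c: "c \<in> carrier Q" "z = c \<triangleright> zer" using right_divE assms(3) .
  obtain d where d: "d \<in> carrier Q" "c \<triangleright> v = d \<triangleright> zer" using right_divE closed[OF c(1) v(1)] .
  obtain u where u: "u \<in> carrier Q" "b \<triangleright> w = zer \<triangleright> u" using left_divE closed[OF b(1) w(1)] .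
  have "plus y z = d \<triangleright> zer" "plus x y = zer \<triangleright> u"
    using plus_eq[OF c(1) v(1)] plus_eq[OF b(1) w(1)] v(2) c(2) d(2) w(2) b(2) u(2) by simp_all
  then have "plus x (plus y z) = d \<triangleright> w" "plus (plus x y) z = c \<triangleright> u"
    using plus_eq[OF d(1) w(1)] plus_eq[OF c(1) u(1)] w(2) c(2) by simp_all
  moreover have "d \<triangleright> w = c \<triangleright> u"
    using translation_eq[OF zer w(1) v(1) u(1) b(1) zer d(1) c(1)] b(2) v(2) u(2) d(2) by simp
  ultimately show ?thesis by simp
qed

lemma plus_left_cancel:
  assumes "x \<in> carrier Q" "y \<in> carrier Q" "z \<in> carrier Q" "plus x y = plus x z"
  shows "y = z"
proof -
  obtain w where w: "w \<in> carrier Q" "x = zer \<triangleright> w" using left_divE assms(1) .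
  obtain b where b: "b \<in> carrier Q" "y = b \<triangleright> zer" using right_divE assms(2) .
  obtain c where c: "c \<in> carrier Q" "z = c \<triangleright> zer" using right_divE assms(3) .
  show ?thesis
    using right_cancel[OF w(1) b(1) c(1)] plus_eq[OF b(1) w(1)] plus_eq[OF c(1) w(1)] assms(4) w b c
    by simp
qed

lemma plus_right_cancel:
  assumes "x \<in> carrier Q" "y \<in> carrier Q" "z \<in> carrier Q" "plus y x = plus z x"
  shows "y = z"
proof -
  obtain w where w: "w \<in> carrier Q" "x = w \<triangleright> zer" using right_divE assms(1) .
  obtain b where b: "b \<in> carrier Q" "y = zer \<triangleright> b" using left_divE assms(2) .
  obtain c where c: "c \<in> carrier Q" "z = zer \<triangleright> c" using left_divE assms(3) .
  show ?thesis
    using left_cancel[OF w(1) b(1) c(1)] plus_eq[OF w(1) b(1)] plus_eq[OF w(1) c(1)] assms(4) w b c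
    by simp
qed

text \<open>Addition is made from the quandle operation and \<open>zer\<close> alone, so an
  automorphism that fixes \<open>zer\<close> respects it. Used for left and right multiplication by
  \<open>zer\<close> it leads to commutativity, and for powers of R_zer to the distributive
  law.\<close>

lemma aut_plus:
  assumes f: "f \<in> quandle_auts Q" "f zer = zer" and xy: "x \<in> carrier Q" "y \<in> carrier Q"
  shows "f (plus x y) = plus (f x) (f y)"
proof -
  obtain w where w: "w \<in> carrier Q" "x = zer \<triangleright> w" using left_divE xy(1) .
  obtain c where c: "c \<in> carrier Q" "y = c \<triangleright> zer" using right_divE xy(2) .
  show ?thesis
    using aut_hom[OF f(1)] aut_closed[OF f(1)] f(2) w c by simp
qed

lemmas right_mult_plus = aut_plus[OF aut_right_mult[OF zer] idem[OF zer]]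
  and left_mult_plus = aut_plus[OF aut_left_mult[OF zer] idem[OF zer]]

text \<open>By idempotency the identity is the sum of the two additive maps \<open>c \<mapsto> zer \<triangleright> c\<close> and
  \<open>c \<mapsto> c \<triangleright> zer\<close>, and a sum of additive bijections is additive only in the commutative case.\<close>

lemma plus_commute:
  assumes x: "x \<in> carrier Q" and y: "y \<in> carrier Q"
  shows "plus x y = plus y x"
proof -
  obtain d where d: "d \<in> carrier Q" "x = zer \<triangleright> d" using left_divE x .
  obtain c where c: "c \<in> carrier Q" "y = c \<triangleright> zer" using right_divE y .
  note cl = plus_closed closed
  have split: "plus (zer \<triangleright> z) (z \<triangleright> zer) = z" if "z \<in> carrier Q" for z
    using plus_eq[OF that that] idem[OF that] by simp
  have "plus (plus (zer \<triangleright> c) (zer \<triangleright> d)) (plus (c \<triangleright> zer) (d \<triangleright> zer)) =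
      plus (zer \<triangleright> plus c d) (plus c d \<triangleright> zer)"
    using left_mult_plus[OF c(1) d(1)] right_mult_plus[OF c(1) d(1)] by simp
  also have "\<dots> = plus c d"
    by (rule split) (simp add: cl c d)
  also have "\<dots> = plus (plus (zer \<triangleright> c) (c \<triangleright> zer)) (plus (zer \<triangleright> d) (d \<triangleright> zer))"
    using split[OF c(1)] split[OF d(1)] by simp
  \<comment> \<open>Regrouping leaves \<open>x = zer \<triangleright> d\<close> and
    \<open>y = c \<triangleright> zer\<close> in opposite orders between equal outer terms, which
    cancel.\<close>
  finally have "plus (zer \<triangleright> c) (plus (plus x y) (d \<triangleright> zer)) = plus (zer \<triangleright> c) (plus (plus y x) (d \<triangleright> zer))"
    using c d by (simp add: plus_assoc cl del: plus_eq)
  then have "plus (plus x y) (d \<triangleright> zer) = plus (plus y x) (d \<triangleright> zer)"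
    by (rule plus_left_cancel[rotated -1]) (use c d in \<open>simp_all add: cl\<close>)
  then show ?thesis
    by (rule plus_right_cancel[rotated -1]) (use x y d in \<open>simp_all add: cl\<close>)
qed

lemma plus_inverse:
  assumes "x \<in> carrier Q"
  shows "\<exists>y\<in>carrier Q. plus y x = zer"
proof -
  obtain w where w: "w \<in> carrier Q" "x = zer \<triangleright> w" using left_divE assms .
  have "plus x (rdiv zer w \<triangleright> zer) = zer" using w plus_eq[of "rdiv zer w" w] by simp
  then show ?thesis
    using w closed plus_commute[OF assms, of "rdiv zer w \<triangleright> zer"] by (intro bexI[of _ "rdiv zer w \<triangleright> zer"]) auto
qed

text \<open>A nonzero \<open>x\<close> is identified with the power of R_zer that takes
  \<open>e\<close> to \<open>x\<close>, and multiplication is composition of these powers. The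
  choice of the exponent is harmless, since two powers of R_zer that agree at \<open>e\<close> agree
  everywhere.\<close>

definition times :: "'a \<Rightarrow> 'a \<Rightarrow> 'a" where
  "times x y = (if x = zer then zer else qpow Q zer (SOME k. x = qpow Q zer k e) y)"

lemma qpow_e_neq_o [simp]: "qpow Q zer k e \<noteq> zer"
  using aut_inj[OF aut_qpow[OF zer] e zer, of k] by auto

lemma times_qpow [simp]:
  assumes "y \<in> carrier Q"
  shows "times (qpow Q zer k e) y = qpow Q zer k y"
proof -
  define j where "j = (SOME j. qpow Q zer k e = qpow Q zer j e)"
  have "qpow Q zer k e = qpow Q zer j e" unfolding j_def by (rule someI[of _ k]) simp
  then have "qpow Q zer j y = qpow Q zer k y"
    using aut_eqI[OF aut_qpow[OF zer] aut_qpow[OF zer] e zer e_neq_o _ _ assms, of j k] by simp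
  then show ?thesis by (simp add: times_def j_def)
qed

lemma times_o [simp]: "times zer y = zer" "x \<in> carrier Q \<Longrightarrow> times x zer = zer"
  by (simp_all add: times_def)

lemma o_or_qpow:
  assumes "x \<in> carrier Q"
  obtains "x = zer" | k where "k < card (carrier Q) - 1" "x = qpow Q zer k e"
  using orbitE[OF zer e e_neq_o assms] by blast

lemma times_closed: "\<lbrakk>x \<in> carrier Q; y \<in> carrier Q\<rbrakk> \<Longrightarrow> times x y \<in> carrier Q"
  by (rule o_or_qpow[of x]) auto

lemma times_commute:
  assumes "x \<in> carrier Q" "y \<in> carrier Q"
  shows "times x y = times y x"
proof (cases "x = zer \<or> y = zer")
  case False
  obtain j k where "x = qpow Q zer j e" "y = qpow Q zer k e"
    using False o_or_qpow[OF assms(1)] o_or_qpow[OF assms(2)] by metis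
  then show ?thesis by (simp add: add.commute flip: qpow_add)
qed (use assms in auto)

lemma times_assoc:
  assumes "x \<in> carrier Q" "y \<in> carrier Q" "z \<in> carrier Q"
  shows "times (times x y) z = times x (times y z)"
proof (cases "x = zer \<or> y = zer")
  case False
  obtain j k where "x = qpow Q zer j e" "y = qpow Q zer k e"
    using False o_or_qpow[OF assms(1)] o_or_qpow[OF assms(2)] by metis
  then show ?thesis
    using assms(3) times_qpow[of z "j + k"] by (simp add: qpow_add)
qed (use assms in \<open>auto simp: times_closed\<close>)

text \<open>Multiplication by a nonzero element is a power of R_zer, an automorphism that fixes
  \<open>zer\<close>, and therefore additive.\<close>

lemma times_plus:
  assumes "x \<in> carrier Q" "y \<in> carrier Q" "z \<in> carrier Q"
  shows "times x (plus y z) = plus (times x y) (times x z)"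
  using o_or_qpow[OF assms(1)]
proof cases
  case (2 k)
  then show ?thesis
    using aut_plus[OF aut_qpow[OF zer, of k] _ assms(2,3)] assms by (simp add: plus_closed)
qed (simp add: plus_o_left)

definition field_of :: "'a ring" where
  "field_of = \<lparr>carrier = carrier Q, monoid.mult = times, one = e, ring.zero = zer, add = plus\<rparr>"

lemma field_of_simps [simp]:
  "carrier field_of = carrier Q" "x \<otimes>\<^bsub>field_of\<^esub> y = times x y" "\<one>\<^bsub>field_of\<^esub> = e" "\<zero>\<^bsub>field_of\<^esub> = zer"
  "x \<oplus>\<^bsub>field_of\<^esub> y = plus x y"
  by (simp_all add: field_of_def)

lemma times_e: "x \<in> carrier Q \<Longrightarrow> times e x = x"
  using times_qpow[of x 0] by simp

lemma field_field_of: "field field_of"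
proof -
  have "cring field_of"
  proof (rule cringI)
    show "abelian_group field_of"
      by (rule abelian_groupI)
        (simp_all add: plus_closed plus_assoc plus_o_left plus_inverse, rule plus_commute)
    show "comm_monoid field_of"
      by (rule comm_monoidI) (simp_all add: times_closed times_assoc times_e, rule times_commute)
  next
    fix x y z assume "x \<in> carrier field_of" "y \<in> carrier field_of" "z \<in> carrier field_of"
    then show "(x \<oplus>\<^bsub>field_of\<^esub> y) \<otimes>\<^bsub>field_of\<^esub> z = x \<otimes>\<^bsub>field_of\<^esub> z \<oplus>\<^bsub>field_of\<^esub> y \<otimes>\<^bsub>field_of\<^esub> z"
      using times_plus[of z x y] times_commute[of z] by (simp add: plus_closed)
  qed
  then show ?thesis
  proof (rule cring.cring_fieldI2)
    fix a assume a: "a \<in> carrier field_of" "a \<noteq> \<zero>\<^bsub>field_of\<^esub>"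
    then obtain k where k: "k < card (carrier Q) - 1" "a = qpow Q zer k e"
      using o_or_qpow[of a] by auto
    have "times a (qpow Q zer (card (carrier Q) - 1 - k) e) = qpow Q zer (card (carrier Q) - 1) e"
      using k by (simp flip: qpow_add)
    also have "\<dots> = e" by (rule qpow_order) auto
    finally show "\<exists>b\<in>carrier field_of. a \<otimes>\<^bsub>field_of\<^esub> b = \<one>\<^bsub>field_of\<^esub>"
      by (intro bexI[of _ "qpow Q zer (card (carrier Q) - 1 - k) e"]) auto
  qed (simp add: e_neq_o[symmetric])
qed

lemma pow_field_of: "(e \<triangleright> zer) [^]\<^bsub>field_of\<^esub> (k::nat) = qpow Q zer k e"
proof -
  interpret field field_of by (rule field_field_of)
  show ?thesis
  proof (induction k)
    case (Suc k)
    then show ?case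
      using times_qpow[of "e \<triangleright> zer" k] funpow_swap1[of "\<lambda>y. y \<triangleright> zer" k e] by (simp add: closed)
  qed simp
qed

lemma primitive_element_field_of: "primitive_element field_of (e \<triangleright> zer)"
proof -
  interpret field field_of by (rule field_field_of)
  show ?thesis
    using qpow_e_neq_o[of 1] o_or_qpow closed
    by (auto simp: primitive_element_iff pow_field_of)
qed

text \<open>Idempotency splits \<open>y\<close> as the sum of \<open>zer \<triangleright> y\<close>
  and \<open>y \<triangleright> zer\<close>. With \<alpha> for
  \<open>e \<triangleright> zer\<close>, the second summand is \<alpha>y, so the first is
  (1-\<alpha>)y, and the definition of \<open>plus\<close> recombines
  \<open>x \<triangleright> zer\<close> and \<open>zer \<triangleright> y\<close> to
  \<open>x \<triangleright> y\<close>.\<close>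

lemma qop_field_of:
  assumes "x \<in> carrier Q" "y \<in> carrier Q"
  shows "x \<triangleright> y = x \<triangleright>\<^bsub>affine_quandle field_of (e \<triangleright> zer)\<^esub> y"
proof -
  interpret field field_of by (rule field_field_of)
  have \<alpha>: "times (e \<triangleright> zer) z = z \<triangleright> zer" if "z \<in> carrier Q" for z
    using times_qpow[OF that, of 1] by simp
  have "(\<one>\<^bsub>field_of\<^esub> \<ominus>\<^bsub>field_of\<^esub> (e \<triangleright> zer)) \<otimes>\<^bsub>field_of\<^esub> y = y \<ominus>\<^bsub>field_of\<^esub> (e \<triangleright> zer) \<otimes>\<^bsub>field_of\<^esub> y"
    using assms l_one[of y] l_distr[of "\<one>\<^bsub>field_of\<^esub>" "\<ominus>\<^bsub>field_of\<^esub> (e \<triangleright> zer)" y] l_minus[of "e \<triangleright> zer" y]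
      a_inv_closed[of "e \<triangleright> zer"] 
    by (simp add: a_minus_def closed)
  also have "\<dots> = y \<ominus>\<^bsub>field_of\<^esub> (y \<triangleright> zer)" using \<alpha>[OF assms(2)] by simp
  also have "\<dots> = ((zer \<triangleright> y) \<oplus>\<^bsub>field_of\<^esub> (y \<triangleright> zer)) \<ominus>\<^bsub>field_of\<^esub> (y \<triangleright> zer)"
    using plus_eq[OF assms(2,2)] idem[OF assms(2)] by simp
  also have "\<dots> = zer \<triangleright> y"
    using assms a_assoc[of "zer \<triangleright> y" "y \<triangleright> zer" "\<ominus>\<^bsub>field_of\<^esub> (y \<triangleright> zer)"] r_neg[of "y \<triangleright> zer"]
      r_zero[of "zer \<triangleright> y"] a_inv_closed[of "y \<triangleright> zer"] by (simp add: a_minus_def closed)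
  finally have "x \<triangleright>\<^bsub>affine_quandle field_of (e \<triangleright> zer)\<^esub> y = plus (x \<triangleright> zer) (zer \<triangleright> y)"
    using \<alpha>[OF assms(1)] by (simp add: affine_quandle_def)
  also have "\<dots> = x \<triangleright> y"
    using plus_commute[of "x \<triangleright> zer" "zer \<triangleright> y"] assms by (simp add: closed)
  finally show ?thesis ..
qed

end

text \<open>The field lives on the points of the quandle itself and the isomorphism is the identity
  map; a quandle on natural numbers thus yields a field on natural numbers.\<close>

theorem cyclic_quandle_affine:
  fixes Q :: "('a, 'b) quandle_scheme"
  assumes "cyclic_quandle Q"
  obtains K :: "'a ring" and \<alpha> where "field K" "carrier K = carrier Q" "primitive_element K \<alpha>"
    "quandle_isomorphic Q (affine_quandle K \<alpha>)"
proof -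
  interpret cyclic_type_quandle Q
    using assms by (auto simp: cyclic_quandle_def cyclic_type_quandle_def cyclic_type_quandle_axioms_def)
  have "\<exists>zer e. zer \<in> carrier Q \<and> e \<in> carrier Q \<and> e \<noteq> zer"
  proof -
    obtain zer where zer: "zer \<in> carrier Q" using card_carrier_gt by fastforce
    have "\<not> carrier Q \<subseteq> {zer}" using card_carrier_gt card_mono[of "{zer}" "carrier Q"] by auto
    with zer show ?thesis by auto
  qed
  then obtain zer e where oe: "zer \<in> carrier Q" "e \<in> carrier Q" "e \<noteq> zer" by auto
  interpret pointed_cyclic_type_quandle Q zer e
    by unfold_locales (rule oe)+
  have "id \<in> quandle_hom Q (affine_quandle field_of (e \<triangleright>\<^bsub>Q\<^esub> zer))"
    unfolding quandle_hom_def
    by (intro CollectI conjI ballI Pi_I) (simp add: affine_quandle_def, simp only: id_apply qop_field_of)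
  then have "quandle_isomorphic Q (affine_quandle field_of (e \<triangleright>\<^bsub>Q\<^esub> zer))"
    unfolding quandle_isomorphic_def
    by (intro bexI[of _ id]) (auto simp: affine_quandle_def)
  with field_field_of primitive_element_field_of show thesis
    by (intro that) auto
qed


section \<open>Affine quandles over fields\<close>

lemma affine_quandle_simps [simp]:
  "carrier (affine_quandle R \<alpha>) = carrier R"
  "x \<triangleright>\<^bsub>affine_quandle R \<alpha>\<^esub> y = \<alpha> \<otimes>\<^bsub>R\<^esub> x \<oplus>\<^bsub>R\<^esub> (\<one>\<^bsub>R\<^esub> \<ominus>\<^bsub>R\<^esub> \<alpha>) \<otimes>\<^bsub>R\<^esub> y"
  by (simp_all add: affine_quandle_def)

context field
begin

lemma quandle_affine_quandle:
  assumes \<alpha>: "\<alpha> \<in> carrier R" "\<alpha> \<noteq> \<zero>"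
  shows "quandle (affine_quandle R \<alpha>)"
proof
  have inv: "inv \<alpha> \<in> carrier R" "\<alpha> \<otimes> inv \<alpha> = \<one>" using \<alpha> field_Units by auto
  fix x y assume "x \<in> carrier (affine_quandle R \<alpha>)" "y \<in> carrier (affine_quandle R \<alpha>)"
  then have xy: "x \<in> carrier R" "y \<in> carrier R" by auto
  show "\<exists>!z. z \<in> carrier (affine_quandle R \<alpha>) \<and> y = z \<triangleright>\<^bsub>affine_quandle R \<alpha>\<^esub> x"
  proof (rule ex1I[of _ "inv \<alpha> \<otimes> (y \<ominus> (\<one> \<ominus> \<alpha>) \<otimes> x)"])
    have "\<alpha> \<otimes> (inv \<alpha> \<otimes> (y \<ominus> (\<one> \<ominus> \<alpha>) \<otimes> x)) = y \<ominus> (\<one> \<ominus> \<alpha>) \<otimes> x"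
      using inv \<alpha> xy by (simp flip: m_assoc)
    then show "inv \<alpha> \<otimes> (y \<ominus> (\<one> \<ominus> \<alpha>) \<otimes> x) \<in> carrier (affine_quandle R \<alpha>) \<and>
        y = (inv \<alpha> \<otimes> (y \<ominus> (\<one> \<ominus> \<alpha>) \<otimes> x)) \<triangleright>\<^bsub>affine_quandle R \<alpha>\<^esub> x"
      using inv \<alpha> xy by (simp, algebra)
    fix z assume z: "z \<in> carrier (affine_quandle R \<alpha>) \<and> y = z \<triangleright>\<^bsub>affine_quandle R \<alpha>\<^esub> x"
    then have "y \<ominus> (\<one> \<ominus> \<alpha>) \<otimes> x = \<alpha> \<otimes> z"
      using xy \<alpha> by (simp, algebra)
    moreover have "inv \<alpha> \<otimes> (\<alpha> \<otimes> z) = z"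
      using inv \<alpha> z by (simp add: m_comm flip: m_assoc)
    ultimately show "z = inv \<alpha> \<otimes> (y \<ominus> (\<one> \<ominus> \<alpha>) \<otimes> x)" by simp
  qed
  show "(x \<triangleright>\<^bsub>affine_quandle R \<alpha>\<^esub> y) \<triangleright>\<^bsub>affine_quandle R \<alpha>\<^esub> z =
      (x \<triangleright>\<^bsub>affine_quandle R \<alpha>\<^esub> z) \<triangleright>\<^bsub>affine_quandle R \<alpha>\<^esub> (y \<triangleright>\<^bsub>affine_quandle R \<alpha>\<^esub> z)"
    if "z \<in> carrier (affine_quandle R \<alpha>)" for z
    using that xy \<alpha> by (simp, algebra)
  show "x \<triangleright>\<^bsub>affine_quandle R \<alpha>\<^esub> x = x"
    using xy \<alpha> by (simp, algebra)
qed (use \<alpha> in auto)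

lemma pow_card_minus_one:
  assumes "finite (carrier R)" "x \<in> carrier R" "x \<noteq> \<zero>"
  shows "x [^] (card (carrier R) - 1) = \<one>"
  using group.pow_order_eq_1[OF mult_of_group, of x] order_mult_of assms
  by (simp add: nat_pow_mult_of Coset.order_def mult_of_eq)

lemma pow_card:
  assumes "finite (carrier R)" "x \<in> carrier R"
  shows "x [^] card (carrier R) = x"
proof -
  obtain m where m: "card (carrier R) = Suc m"
    using assms by (metis card_gt_0_iff empty_iff gr0_implies_Suc)
  then show ?thesis
    using pow_card_minus_one[OF assms] assms(2) by (cases "x = \<zero>") auto
qed

lemma card_ge_2: "finite (carrier R) \<Longrightarrow> card (carrier R) \<ge> 2"
  using card_mono[of "carrier R" "{\<zero>, \<one>}"] zero_not_one by simp

lemma primitive_element_enumeration: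
  assumes fin: "finite (carrier R)" and \<alpha>: "primitive_element R \<alpha>"
  shows "bij_betw (\<lambda>k::nat. \<alpha> [^] k) {..<card (carrier R) - 1} (carrier R - {\<zero>})"
proof -
  let ?m = "card (carrier R) - 1"
  have \<alpha>': "\<alpha> \<in> carrier R" "\<alpha> \<noteq> \<zero>" and range: "carrier R - {\<zero>} = range (\<lambda>k::nat. \<alpha> [^] k)"
    using \<alpha> primitive_element_iff[OF fin] by auto
  have mod: "\<alpha> [^] k = \<alpha> [^] (k mod ?m)" for k :: nat
  proof -
    have "\<alpha> [^] k = (\<alpha> [^] ?m) [^] (k div ?m) \<otimes> \<alpha> [^] (k mod ?m)"
      using \<alpha>' by (simp add: nat_pow_pow nat_pow_mult)
    then show ?thesis using pow_card_minus_one[OF fin \<alpha>'] \<alpha>' by simp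
  qed
  have "?m > 0" using card_ge_2[OF fin] by simp
  then have "\<alpha> [^] k \<in> (\<lambda>k::nat. \<alpha> [^] k) ` {..<?m}" for k :: nat
    by (subst mod) simp
  then have im: "carrier R - {\<zero>} = (\<lambda>k::nat. \<alpha> [^] k) ` {..<?m}"
    unfolding range by blast
  moreover have "card (carrier R - {\<zero>}) = ?m" using fin by (simp add: card_Diff_singleton)
  ultimately show ?thesis
    by (intro bij_betw_imageI eq_card_imp_inj_on) simp_all
qed

text \<open>In the coordinate centred at \<open>i\<close>, right multiplication by \<open>i\<close>
  is multiplication by \<alpha>. For primitive \<alpha> its long cycle therefore consists of the
  nonzero elements shifted by \<open>i\<close>.\<close>

lemma affine_qpow:
  assumes "\<alpha> \<in> carrier R" "i \<in> carrier R" "y \<in> carrier R"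
  shows "qpow (affine_quandle R \<alpha>) i k (i \<oplus> y) = i \<oplus> \<alpha> [^] k \<otimes> y"
proof (induction k)
  case (Suc k)
  have "\<alpha> [^] k \<in> carrier R" using assms by simp
  then show ?case
    using Suc assms by (simp, algebra)
qed (use assms in simp)

lemma cyclic_quandle_affine_quandle:
  assumes fin: "finite (carrier R)" and card: "card (carrier R) > 2" and \<alpha>: "primitive_element R \<alpha>"
  shows "cyclic_quandle (affine_quandle R \<alpha>)"
proof -
  let ?A = "affine_quandle R \<alpha>"
  have \<alpha>': "\<alpha> \<in> carrier R" "\<alpha> \<noteq> \<zero>"
    using \<alpha> primitive_element_iff[OF fin] by auto
  interpret A: quandle ?A by (rule quandle_affine_quandle[OF \<alpha>'])
  note pow = affine_qpow[OF \<alpha>'(1)]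
  show ?thesis
  proof (rule A.cyclic_quandleI)
    fix i assume i: "i \<in> carrier ?A"
    have eq: "qpow ?A i k (i \<oplus> \<one>) = i \<oplus> \<alpha> [^] k" for k
      using pow[of i \<one> k] i \<alpha>' by (simp only: affine_quandle_simps one_closed r_one nat_pow_closed)
    have "carrier R - {i} = (\<lambda>z. i \<oplus> z) ` (carrier R - {\<zero>})"
    proof (intro Set.set_eqI iffI)
      fix z assume z: "z \<in> carrier R - {i}"
      then have "z = i \<oplus> (z \<ominus> i)" "z \<ominus> i \<in> carrier R - {\<zero>}"
        using i by (simp_all, algebra)
      then show "z \<in> (\<lambda>z. i \<oplus> z) ` (carrier R - {\<zero>})" by blast
    qed (use i in auto)
    also have "\<dots> = (\<lambda>k. i \<oplus> \<alpha> [^] k) ` {..<card (carrier R) - 1}"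
      using bij_betw_imp_surj_on[OF primitive_element_enumeration[OF fin \<alpha>], symmetric]
      by (simp only: image_image)
    also have "\<dots> = (\<lambda>k. qpow ?A i k (i \<oplus> \<one>)) ` {..<card (carrier R) - 1}"
      by (simp only: eq)
    finally show "\<exists>b\<in>carrier ?A.
        carrier ?A - {i} = (\<lambda>k. qpow ?A i k b) ` {..<card (carrier ?A) - 1} \<and>
        qpow ?A i (card (carrier ?A) - 1) b = b"
      using i eq[of "card (carrier R) - 1"] pow_card_minus_one[OF fin \<alpha>']
      by (intro bexI[of _ "i \<oplus> \<one>"]) (simp_all only: affine_quandle_simps, auto)
  qed (use fin card in auto)
qed

end

lemma affine_quandle_ring_iso:
  assumes "ring K" "ring R" "h \<in> ring_iso K R" "\<alpha> \<in> carrier K"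
  shows "quandle_isomorphic (affine_quandle K \<alpha>) (affine_quandle R (h \<alpha>))"
proof -
  interpret ring_hom_ring K R h
    using assms by (intro ring_hom_ringI2) (auto simp: ring_iso_def)
  have "h \<in> quandle_hom (affine_quandle K \<alpha>) (affine_quandle R (h \<alpha>))"
    using assms(4) by (auto simp: quandle_hom_def a_minus_def)
  then show ?thesis
    using assms(3) unfolding quandle_isomorphic_def by (auto simp: ring_iso_def)
qed


section \<open>Integer polynomials in rings of prime characteristic\<close>

text \<open>Evaluating integer polynomials in an arbitrary ring avoids polynomials over the prime field.\<close>

definition int_poly_eval :: "('a, 'b) ring_scheme \<Rightarrow> 'a \<Rightarrow> int poly \<Rightarrow> 'a" where
  "int_poly_eval R x f =
     fold_coeffs (\<lambda>c s. [c] \<cdot>\<^bsub>R\<^esub> \<one>\<^bsub>R\<^esub> \<oplus>\<^bsub>R\<^esub> x \<otimes>\<^bsub>R\<^esub> s) f \<zero>\<^bsub>R\<^esub>"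

lemma (in ring) int_embed_0 [simp]: "[(0 :: int)] \<cdot> \<one> = \<zero>"
  by (simp add: add_pow_int_ge)

lemma (in ring) int_embed_add: "[(a + b :: int)] \<cdot> \<one> = [a] \<cdot> \<one> \<oplus> [b] \<cdot> \<one>"
  by (rule add.int_pow_mult) simp

lemma (in ring) int_embed_mult: "[(a * b :: int)] \<cdot> \<one> = ([a] \<cdot> \<one>) \<otimes> ([b] \<cdot> \<one>)"
  using add_pow_ldistr_int[of \<one> "[b] \<cdot> \<one>" a] add.int_pow_pow[of \<one> a b]
  by (simp add: mult.commute)

lemma int_poly_eval_0 [simp]: "int_poly_eval R x 0 = \<zero>\<^bsub>R\<^esub>"
  by (simp add: int_poly_eval_def)

context cring
begin

lemma int_poly_eval_pCons [simp]:
  assumes "x \<in> carrier R"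
  shows "int_poly_eval R x (pCons c f) = [c] \<cdot> \<one> \<oplus> x \<otimes> int_poly_eval R x f"
  using assms by (cases "c = 0 \<and> f = 0") (auto simp: int_poly_eval_def)

context
  fixes x assumes x [simp]: "x \<in> carrier R"
begin

lemma int_poly_eval_closed [simp]: "int_poly_eval R x f \<in> carrier R"
  by (induction f) auto

lemma int_poly_eval_add:
  "int_poly_eval R x (f + g) = int_poly_eval R x f \<oplus> int_poly_eval R x g"
proof (induction f g rule: poly_induct2)
  case (pCons a f b g)
  have "[a] \<cdot> \<one> \<in> carrier R" "[b] \<cdot> \<one> \<in> carrier R" by auto
  then show ?case using pCons by (simp add: int_embed_add r_distr a_ac)
qed simp

lemma int_poly_eval_smult: "int_poly_eval R x (smult c f) = ([c] \<cdot> \<one>) \<otimes> int_poly_eval R x f"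
  by (induction f) (simp_all add: int_embed_mult r_distr m_ac)

lemma int_poly_eval_mult:
  "int_poly_eval R x (f * g) = int_poly_eval R x f \<otimes> int_poly_eval R x g"
  by (induction f)
    (simp_all add: mult_pCons_left int_poly_eval_add int_poly_eval_smult l_distr m_assoc)

lemma int_poly_eval_1 [simp]: "int_poly_eval R x 1 = \<one>"
  by (simp add: one_pCons)

lemma int_poly_eval_power: "int_poly_eval R x (f ^ k) = int_poly_eval R x f [^] k"
  by (induction k) (simp_all add: int_poly_eval_mult m_comm)

lemma int_poly_eval_X [simp]: "int_poly_eval R x (Polynomial.monom 1 k) = x [^] k"
  by (induction k) (simp_all add: Polynomial.monom_0 Polynomial.monom_Suc m_comm)

lemma int_poly_eval_of_nat: "int_poly_eval R x (of_nat k) = [int k] \<cdot> \<one>"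
  by (simp add: of_nat_poly)

lemma int_poly_eval_diff:
  "int_poly_eval R x (f - g) = int_poly_eval R x f \<ominus> int_poly_eval R x g"
  using int_poly_eval_add[of "f - g" g]
  by (simp add: a_minus_def a_assoc r_neg)

end

section \<open>Reduction modulo the characteristic and additivity of the Frobenius map\<close>

lemma char_dvd_eq_zero:
  assumes "[(d::int)] \<cdot> \<one> = \<zero>" "d dvd c"
  shows "[c] \<cdot> \<one> = \<zero>"
  using assms by (auto simp: int_embed_mult elim!: dvdE)

lemma int_poly_eval_cong_mod:
  assumes "[(d::int)] \<cdot> \<one> = \<zero>" "x \<in> carrier R" "\<And>i. d dvd Polynomial.coeff f i"
  shows "int_poly_eval R x f = \<zero>"
  using assms(3)
proof (induction f)
  case (pCons a f)
  have "d dvd a" "\<And>i. d dvd Polynomial.coeff f i"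
    using pCons.prems[of 0] pCons.prems[of "Suc i" for i] by simp_all
  with pCons.IH show ?case using assms(1,2) char_dvd_eq_zero by simp
qed simp

text \<open>The binomial theorem is applied to integer polynomials, where \<open>p\<close> divides
  the mixed terms, and the identity is evaluated at \<open>z\<close>. Evaluation in one variable
  confines the other summand to 1.\<close>

lemma frobenius_one_add:
  assumes p: "Factorial_Ring.prime p" "[(int p)] \<cdot> \<one> = \<zero>" and z: "z \<in> carrier R"
  shows "(\<one> \<oplus> z) [^] p = \<one> \<oplus> z [^] p"
proof -
  define t :: "int poly" where "t = Polynomial.monom 1 1"
  have "p > 1" using prime_gt_1_nat[OF p(1)] .
  have "{..p} = insert 0 (insert p {0<..<p})" using \<open>p > 1\<close> by auto
  then have "(t + 1) ^ p = 1 + t ^ p + (\<Sum>k\<in>{0<..<p}. of_nat (p choose k) * t ^ k)"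
    using \<open>p > 1\<close> by (simp add: binomial_ring)
  moreover have "of_nat p dvd (\<Sum>k\<in>{0<..<p}. of_nat (p choose k) * t ^ k)"
  proof (intro dvd_sum dvd_mult2)
    fix k assume "k \<in> {0<..<p}"
    then have "p dvd (p choose k)" by (intro dvd_choose_prime p) auto
    then show "(of_nat p :: int poly) dvd of_nat (p choose k)" by (auto elim!: dvdE)
  qed
  ultimately obtain g where "(t + 1) ^ p = 1 + t ^ p + of_nat p * g"
    by (auto elim!: dvdE)
  then have "int_poly_eval R z ((t + 1) ^ p) = int_poly_eval R z (1 + t ^ p + of_nat p * g)"
    by simp
  then show ?thesis
    using z p(2)
    by (simp add: int_poly_eval_power int_poly_eval_add int_poly_eval_mult int_poly_eval_of_nat t_def a_comm)
qed

lemma frobenius_iterate_one_add: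
  assumes p: "Factorial_Ring.prime p" "[(int p)] \<cdot> \<one> = \<zero>" and z: "z \<in> carrier R"
  shows "(\<one> \<oplus> z) [^] (p ^ s) = \<one> \<oplus> z [^] (p ^ s)"
proof (induction s)
  case (Suc s)
  have "(\<one> \<oplus> z) [^] (p ^ Suc s) = ((\<one> \<oplus> z) [^] (p ^ s)) [^] p"
    using z by (simp add: nat_pow_pow mult.commute)
  also have "\<dots> = \<one> \<oplus> (z [^] (p ^ s)) [^] p"
    using Suc frobenius_one_add[OF p] z by simp
  finally show ?case using z by (simp add: nat_pow_pow mult.commute)
qed (use z in simp)

text \<open>Taking out the factor \<open>x\<close> reduces the sum to the form 1 + z, which is why
  \<open>x\<close> is a unit. Besides fields this serves polynomial rings, with a nonzero constant
  as \<open>x\<close>.\<close>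

lemma frobenius_add:
  assumes p: "Factorial_Ring.prime p" "[(int p)] \<cdot> \<one> = \<zero>"
    and x: "x \<in> Units R" and y: "y \<in> carrier R"
  shows "(x \<oplus> y) [^] (p ^ s) = x [^] (p ^ s) \<oplus> y [^] (p ^ s)"
proof -
  have x': "x \<in> carrier R" "inv x \<in> carrier R" "x \<otimes> inv x = \<one>" using x by auto
  have "x \<oplus> y = x \<otimes> (\<one> \<oplus> inv x \<otimes> y)"
    using x' y by (simp add: r_distr flip: m_assoc)
  then have "(x \<oplus> y) [^] (p ^ s) = x [^] (p ^ s) \<otimes> (\<one> \<oplus> (inv x \<otimes> y) [^] (p ^ s))"
    using x' y by (simp add: nat_pow_distrib frobenius_iterate_one_add[OF p])
  also have "\<dots> = x [^] (p ^ s) \<oplus> (x \<otimes> (inv x \<otimes> y)) [^] (p ^ s)"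
    using x' y by (simp add: r_distr nat_pow_distrib)
  also have "x \<otimes> (inv x \<otimes> y) = y" using x' y by (simp flip: m_assoc)
  finally show ?thesis .
qed

text \<open>A bridge to the univariate polynomials \<open>UP R\<close>, whose bound on the number of
  roots thereby applies to integer polynomials.\<close>

lemma int_poly_as_UP:
  "\<exists>g\<in>carrier (UP R). (\<forall>i. up_ring.coeff (UP R) g i = [Polynomial.coeff f i] \<cdot> \<one>) \<and>
     (\<forall>x\<in>carrier R. UnivPoly.eval R R id x g = int_poly_eval R x f)"
proof (induction f)
  case 0
  have z: "\<zero> \<in> carrier R" by simp
  interpret UP_cring R "UP R" by unfold_locales simp
  have "UnivPoly.eval R R id x \<zero>\<^bsub>UP R\<^esub> = int_poly_eval R x 0" if "x \<in> carrier R" for x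
    using evalRR_monom[OF z that, of 0] that by simp
  moreover have "up_ring.coeff (UP R) \<zero>\<^bsub>UP R\<^esub> i = [Polynomial.coeff (0::int poly) i] \<cdot> \<one>" for i
    by simp
  moreover have "\<zero>\<^bsub>UP R\<^esub> \<in> carrier (UP R)" by simp
  ultimately show ?case by blast
next
  case (pCons c f)
  have o: "\<one> \<in> carrier R" by simp
  interpret UP_cring R "UP R" by unfold_locales simp
  obtain g where g: "g \<in> carrier (UP R)" "\<And>i. up_ring.coeff (UP R) g i = [Polynomial.coeff f i] \<cdot> \<one>"
      "\<And>x. x \<in> carrier R \<Longrightarrow> UnivPoly.eval R R id x g = int_poly_eval R x f"
    using pCons.IH by blast
  define h where "h = up_ring.monom (UP R) ([c] \<cdot> \<one>) 0 \<oplus>\<^bsub>UP R\<^esub> up_ring.monom (UP R) \<one> 1 \<otimes>\<^bsub>UP R\<^esub> g"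
  have c: "[c] \<cdot> \<one> \<in> carrier R" by auto
  have "up_ring.coeff (UP R) (up_ring.monom (UP R) \<one> 1 \<otimes>\<^bsub>UP R\<^esub> g) 0 = \<zero>"
    using g(1) by (simp add: coeff_mult)
  then have "up_ring.coeff (UP R) h i = [Polynomial.coeff (pCons c f) i] \<cdot> \<one>" for i
    using coeff_monom_mult[OF o g(1), of 1] g c unfolding h_def
    by (cases i) (simp_all del: coeff_mult)
  moreover have "UnivPoly.eval R R id x h = int_poly_eval R x (pCons c f)" if "x \<in> carrier R" for x
    using that g c by (simp add: h_def evalRR_simps)
  moreover have "h \<in> carrier (UP R)" using g c by (simp add: h_def)
  ultimately show ?case by blast
qed

end

text \<open>If \<open>p\<close> did not divide \<open>c\<close>, a Bezout combination of the two
  would equal 1 and yet be mapped to zero.\<close>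

lemma (in domain) int_embed_eq_zero_iff:
  assumes p: "Factorial_Ring.prime p" "[(int p)] \<cdot> \<one> = \<zero>"
  shows "[(c::int)] \<cdot> \<one> = \<zero> \<longleftrightarrow> int p dvd c"
proof
  assume c: "[c] \<cdot> \<one> = \<zero>"
  show "int p dvd c"
  proof (rule ccontr)
    assume "\<not> int p dvd c"
    then have "coprime (int p) c" using p(1) by (intro prime_imp_coprime) auto
    then obtain u v where "int p * u + c * v = 1"
      using bezout_int[of "int p" c] by (auto simp: mult.commute)
    then have "[(int p * u + c * v)] \<cdot> \<one> = \<one>" by simp
    moreover have "[(int p * u + c * v)] \<cdot> \<one> = \<zero>"
      by (simp add: int_embed_add int_embed_mult c p(2))
    ultimately show False by simp
  qed
qed (rule char_dvd_eq_zero[OF p(2)])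

text \<open>The hypothesis \<open>nz\<close> says that the reduction of \<open>f\<close> is not the
  zero polynomial. Its degree may be smaller than the integer degree, which is still an upper
  bound.\<close>

lemma (in domain) int_poly_roots_bound:
  fixes f :: "int poly"
  assumes fin: "finite (carrier R)" and nz: "[Polynomial.coeff f i] \<cdot> \<one> \<noteq> \<zero>"
  shows "card {x \<in> carrier R. int_poly_eval R x f = \<zero>} \<le> Polynomial.degree f"
proof -
  interpret U: UP_domain R "UP R" by unfold_locales
  obtain g where g: "g \<in> carrier (UP R)" "\<And>i. up_ring.coeff (UP R) g i = [Polynomial.coeff f i] \<cdot> \<one>"
      "\<And>x. x \<in> carrier R \<Longrightarrow> UnivPoly.eval R R id x g = int_poly_eval R x f"
    using int_poly_as_UP by blast
  have "g \<noteq> \<zero>\<^bsub>UP R\<^esub>" using g(2)[of i] nz by auto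
  then have "card {x \<in> carrier R. UnivPoly.eval R R id x g = \<zero>} \<le> deg R g"
    using U.roots_bound[OF g(1) _ fin] by blast
  also have "deg R g \<le> Polynomial.degree f"
    by (rule U.deg_aboveI[OF _ g(1)]) (simp add: g(2) Polynomial.coeff_eq_0)
  also have "{x \<in> carrier R. UnivPoly.eval R R id x g = \<zero>} = {x \<in> carrier R. int_poly_eval R x f = \<zero>}"
    using g(3) by auto
  finally show ?thesis .
qed

text \<open>The order of the additive group annihilates 1, and the image of \<open>p ^ n\<close> is
  the n-th power of the image of \<open>p\<close>; a field has no nonzero nilpotent
  elements.\<close>

lemma (in field) char_of_card:
  assumes "card (carrier R) = p ^ n" "p > 0"
  shows "[(int p)] \<cdot> \<one> = \<zero>"
proof -
  have "[(p ^ n)] \<cdot> \<one> = \<zero>"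
    using group.pow_order_eq_1[OF a_group, of \<one>] assms(1) by (simp add: Coset.order_def add_pow_def)
  then have "[int (p ^ n)] \<cdot> \<one> = \<zero>"
    by (simp add: add_pow_int_ge del: of_nat_power)
  moreover have "[int (p ^ n)] \<cdot> \<one> = ([int p] \<cdot> \<one>) [^] n" for n
    by (induction n) (simp_all add: int_embed_mult m_comm)
  ultimately have "([int p] \<cdot> \<one>) [^] n = \<zero>" by simp
  then show ?thesis
    by (induction n) (auto dest!: integral)
qed


section \<open>Existence of finite fields\<close>

lemma (in ring_hom_ring) hom_int_embed: "h ([(c::int)] \<cdot>\<^bsub>R\<^esub> \<one>\<^bsub>R\<^esub>) = [c] \<cdot>\<^bsub>S\<^esub> \<one>\<^bsub>S\<^esub>"
proof -
  have nat: "h ([(k::nat)] \<cdot>\<^bsub>R\<^esub> \<one>\<^bsub>R\<^esub>) = [k] \<cdot>\<^bsub>S\<^esub> \<one>\<^bsub>S\<^esub>" for k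
    by (induction k) simp_all
  show ?thesis
    using nat by (cases "c \<ge> 0") (simp_all add: add_pow_int_ge add_pow_int_lt)
qed

lemma (in cring) add_diff_add_left:
  "\<lbrakk>x \<in> carrier R; y \<in> carrier R; z \<in> carrier R\<rbrakk> \<Longrightarrow> (x \<oplus> y) \<ominus> (x \<oplus> z) = y \<ominus> z"
  by algebra

lemma (in cring) mult_diff_one:
  "\<lbrakk>x \<in> carrier R; y \<in> carrier R\<rbrakk> \<Longrightarrow> x \<otimes> (y \<ominus> \<one>) = y \<otimes> x \<ominus> x"
  by algebra

text \<open>If \<open>a\<close> is a root, then $X^q - X = (X-a)^q - (X-a)$, which is not divisible by $(X-a)^2$.\<close>

lemma (in field) frobenius_poly_alg_mult:
  assumes p: "Factorial_Ring.prime p" "[(int p)] \<cdot> \<one> = \<zero>" and n: "n > 0" and a: "a \<in> carrier R"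
  shows "alg_mult (X [^]\<^bsub>poly_ring R\<^esub> (p ^ n) \<ominus>\<^bsub>poly_ring R\<^esub> X) a \<le> 1"
proof (rule ccontr)
  interpret UP: domain "poly_ring R" by (rule univ_poly_is_domain[OF carrier_is_subring])
  interpret C: ring_hom_ring R "poly_ring R" poly_of_const
    using canonical_embedding_ring_hom[OF carrier_is_subring] by simp
  interpret E: ring_hom_ring "poly_ring R" R "\<lambda>f. eval f a"
    by (rule eval_ring_hom[OF carrier_is_subring a])
  define A where "A = poly_of_const a"
  \<comment> \<open>Polynomials are lists with the leading coefficient first, so \<open>Y\<close> is
    X - a.\<close>
  define Y where "Y = [\<one>, \<ominus> a]"
  define P where "P = X [^]\<^bsub>poly_ring R\<^esub> (p ^ n) \<ominus>\<^bsub>poly_ring R\<^esub> X"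
  assume "\<not> alg_mult (X [^]\<^bsub>poly_ring R\<^esub> (p ^ n) \<ominus>\<^bsub>poly_ring R\<^esub> X) a \<le> 1"
  then have mult: "2 \<le> alg_mult P a" by (simp add: P_def)
  have X: "X \<in> carrier (poly_ring R)" by (rule var_closed[OF carrier_is_subring])
  have A: "A \<in> carrier (poly_ring R)" unfolding A_def using a by simp
  have Y: "Y \<in> carrier (poly_ring R)" "Y \<noteq> \<zero>\<^bsub>poly_ring R\<^esub>"
    using a by (auto simp: Y_def univ_poly_zero simp flip: univ_poly_carrier polynomial_def)
      (auto simp: polynomial_def)
  have P: "P \<in> carrier (poly_ring R)" using X by (simp add: P_def)
  have "is_root P a" using iffD1[OF alg_mult_gt_zero_iff_is_root[OF P, of a]] mult by linarith
  then have "eval P a = \<zero>" by (simp add: is_root_def)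
  moreover have "eval P a = a [^] (p ^ n) \<ominus> a"
    using E.hom_nat_pow[OF X, of "p ^ n"] X a by (simp add: P_def a_minus_def eval_var)
  ultimately have aq: "a [^] (p ^ n) = a" using a by simp
  obtain g where g: "g \<in> carrier (poly_ring R)" "P = Y [^]\<^bsub>poly_ring R\<^esub> (2::nat) \<otimes>\<^bsub>poly_ring R\<^esub> g"
    using le_alg_mult_imp_pdivides[OF a P mult] unfolding pdivides_def factor_def Y_def by auto
  have XAY: "X = A \<oplus>\<^bsub>poly_ring R\<^esub> Y"
    using a by (auto simp: A_def Y_def poly_of_const_def univ_poly_add var_def l_neg)
  have pchar: "[(int p)] \<cdot>\<^bsub>poly_ring R\<^esub> \<one>\<^bsub>poly_ring R\<^esub> = \<zero>\<^bsub>poly_ring R\<^esub>"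
    using C.hom_int_embed[of "int p"] p(2) by simp
  have "(A \<oplus>\<^bsub>poly_ring R\<^esub> Y) [^]\<^bsub>poly_ring R\<^esub> (p ^ n) =
      A [^]\<^bsub>poly_ring R\<^esub> (p ^ n) \<oplus>\<^bsub>poly_ring R\<^esub> Y [^]\<^bsub>poly_ring R\<^esub> (p ^ n)"
  \<comment> \<open>The sum rule asks for a unit as first summand, and the constant \<open>A\<close>
    is one exactly for nonzero \<open>a\<close>.\<close>
  proof (cases "a = \<zero>")
    case True
    then have "A = \<zero>\<^bsub>poly_ring R\<^esub>" by (simp add: A_def)
    then show ?thesis using Y p(1) by (simp add: UP.nat_pow_zero prime_gt_0_nat)
  next
    case False
    then have inv: "inv a \<in> carrier R" "a \<otimes> inv a = \<one>" using a field_Units by auto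
    then have "A \<otimes>\<^bsub>poly_ring R\<^esub> poly_of_const (inv a) = \<one>\<^bsub>poly_ring R\<^esub>"
      using C.hom_mult[OF a inv(1)] inv(2) C.hom_one unfolding A_def by metis
    then have "A \<in> Units (poly_ring R)"
      unfolding Units_def using A C.hom_closed[OF inv(1)] UP.m_comm[OF A C.hom_closed[OF inv(1)]]
      by (intro CollectI conjI bexI[of _ "poly_of_const (inv a)"]) simp_all
    then show ?thesis by (rule UP.frobenius_add[OF p(1) pchar _ Y(1)])
  qed
  moreover have "A [^]\<^bsub>poly_ring R\<^esub> (p ^ n) = A"
    using C.hom_nat_pow[OF a, of "p ^ n"] aq by (simp add: A_def)
  ultimately have "P = (A \<oplus>\<^bsub>poly_ring R\<^esub> Y [^]\<^bsub>poly_ring R\<^esub> (p ^ n)) \<ominus>\<^bsub>poly_ring R\<^esub> (A \<oplus>\<^bsub>poly_ring R\<^esub> Y)"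
    by (simp add: P_def XAY)
  also have "\<dots> = Y [^]\<^bsub>poly_ring R\<^esub> (p ^ n) \<ominus>\<^bsub>poly_ring R\<^esub> Y"
    by (rule UP.add_diff_add_left) (use A Y in simp_all)
  also have "p ^ n = Suc (p ^ n - 1)"
    using p(1) by (simp add: prime_gt_0_nat)
  also have "Y [^]\<^bsub>poly_ring R\<^esub> Suc (p ^ n - 1) \<ominus>\<^bsub>poly_ring R\<^esub> Y =
      Y \<otimes>\<^bsub>poly_ring R\<^esub> (Y [^]\<^bsub>poly_ring R\<^esub> (p ^ n - 1) \<ominus>\<^bsub>poly_ring R\<^esub> \<one>\<^bsub>poly_ring R\<^esub>)"
    unfolding UP.nat_pow_Suc
    by (rule UP.mult_diff_one[symmetric]) (use Y in simp_all)
  also have "P = Y \<otimes>\<^bsub>poly_ring R\<^esub> (Y \<otimes>\<^bsub>poly_ring R\<^esub> g)"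
    using g Y by (simp add: numeral_2_eq_2 UP.m_assoc)
  finally have "Y \<otimes>\<^bsub>poly_ring R\<^esub> g =
      Y [^]\<^bsub>poly_ring R\<^esub> (p ^ n - 1) \<ominus>\<^bsub>poly_ring R\<^esub> \<one>\<^bsub>poly_ring R\<^esub>"
    using UP.m_lcancel[OF Y(2,1)] g(1) Y(1) by simp
  \<comment> \<open>One factor \<open>Y\<close> has been cancelled. At \<open>a\<close> the left
    side still vanishes through \<open>Y\<close>, whereas the right side is -1, because the exponent
    p^n - 1 is positive.\<close>
  then have eq: "eval (Y \<otimes>\<^bsub>poly_ring R\<^esub> g) a =
      eval (Y [^]\<^bsub>poly_ring R\<^esub> (p ^ n - 1) \<ominus>\<^bsub>poly_ring R\<^esub> \<one>\<^bsub>poly_ring R\<^esub>) a"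
    by simp
  have e0: "eval Y a = \<zero>" using a by (simp add: Y_def r_neg)
  have "p ^ n - 1 \<noteq> 0" using one_less_power[OF prime_gt_1_nat[OF p(1)] n] by simp
  then have "eval (Y [^]\<^bsub>poly_ring R\<^esub> (p ^ n - 1)) a = \<zero>"
    unfolding E.hom_nat_pow[OF Y(1)] e0 by (rule nat_pow_zero)
  then have "eval (Y [^]\<^bsub>poly_ring R\<^esub> (p ^ n - 1) \<ominus>\<^bsub>poly_ring R\<^esub> \<one>\<^bsub>poly_ring R\<^esub>) a = \<ominus> \<one>"
    using Y(1) by (simp add: a_minus_def)
  moreover have "eval (Y \<otimes>\<^bsub>poly_ring R\<^esub> g) a = \<zero>"
    using E.hom_mult[OF Y(1) g(1)] E.hom_closed[OF g(1)] e0 by simp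
  ultimately have "\<ominus> \<one> = \<zero>" using eq by simp
  then have "\<one> = \<zero>" using minus_minus[of \<one>] minus_zero by (metis one_closed)
  then show False by simp
qed

text \<open>A split polynomial has as many roots as its degree, counted with multiplicity. Here all
  roots are simple, so they are p^n distinct elements.\<close>

lemma (in field) card_frobenius_fixed:
  assumes p: "Factorial_Ring.prime p" "[(int p)] \<cdot> \<one> = \<zero>" and n: "n > 0"
    and split: "splitted (X [^]\<^bsub>poly_ring R\<^esub> (p ^ n) \<ominus>\<^bsub>poly_ring R\<^esub> X)"
  shows "card {a \<in> carrier R. a [^] (p ^ n) = a} = p ^ n"
proof -
  interpret UP: domain "poly_ring R" by (rule univ_poly_is_domain[OF carrier_is_subring])
  define P where "P = X [^]\<^bsub>poly_ring R\<^esub> (p ^ n) \<ominus>\<^bsub>poly_ring R\<^esub> X"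
  have X: "X \<in> carrier (poly_ring R)" by (rule var_closed[OF carrier_is_subring])
  have P: "P \<in> carrier (poly_ring R)" using X by (simp add: P_def)
  have q: "p ^ n > 1" using one_less_power[OF prime_gt_1_nat[OF p(1)] n] .
  have deg: "length P - 1 = p ^ n"
  proof -
    have dX: "length X - 1 = 1" by (simp add: var_def)
    have "length (X [^]\<^bsub>poly_ring R\<^esub> (p ^ n)) - 1 = p ^ n"
      using polynomial_pow_degree[OF X] dX by simp
    moreover have "length (\<ominus>\<^bsub>poly_ring R\<^esub> X) - 1 = 1"
      using univ_poly_a_inv_degree[OF carrier_is_subring X] dX by simp
    moreover have "polynomial (carrier R) (X [^]\<^bsub>poly_ring R\<^esub> (p ^ n))"
        "polynomial (carrier R) (\<ominus>\<^bsub>poly_ring R\<^esub> X)"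
      using X by (simp_all add: univ_poly_carrier)
    ultimately show ?thesis
      using poly_add_degree_eq[OF carrier_is_subring, of "X [^]\<^bsub>poly_ring R\<^esub> (p ^ n)" "\<ominus>\<^bsub>poly_ring R\<^esub> X"]
        q n prime_gt_1_nat[OF p(1)]
      by (simp add: P_def a_minus_def univ_poly_add del: poly_add.simps)
  qed
  have P0: "P \<noteq> []" using deg q by (metis diff_0_eq_0 list.size(3) not_less_zero)
  have ev: "eval P a = a [^] (p ^ n) \<ominus> a" if a: "a \<in> carrier R" for a
  proof -
    interpret E: ring_hom_ring "poly_ring R" R "\<lambda>f. eval f a"
      by (rule eval_ring_hom[OF carrier_is_subring a])
    show ?thesis
      using E.hom_nat_pow[OF X, of "p ^ n"] X a by (simp add: P_def a_minus_def eval_var)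
  qed
  have set: "set_mset (roots P) = {a \<in> carrier R. a [^] (p ^ n) = a}"
  proof (rule Set.set_eqI)
    fix a
    show "a \<in># roots P \<longleftrightarrow> a \<in> {a \<in> carrier R. a [^] (p ^ n) = a}"
    proof (cases "a \<in> carrier R")
      case True
      then have "eval P a = \<zero> \<longleftrightarrow> a [^] (p ^ n) = a"
        unfolding ev[OF True] by (intro r_right_minus_eq nat_pow_closed)
      then show ?thesis
        unfolding roots_mem_iff_is_root[OF P] is_root_def using P0 True by simp
    qed (simp add: roots_mem_iff_is_root[OF P] is_root_def)
  qed
  have count: "count (roots P) a = 1" if "a \<in># roots P" for a
  proof -
    have "a \<in> carrier R" using that set by auto
    then have "count (roots P) a \<le> 1"
      using frobenius_poly_alg_mult[OF p n] alg_mult_eq_count_roots[OF P] by (simp add: P_def)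
    then show ?thesis using that by (simp add: le_Suc_eq count_eq_zero_iff)
  qed
  have "p ^ n = size (roots P)" using split deg by (simp add: P_def splitted_def)
  also have "\<dots> = card (set_mset (roots P))"
    by (simp add: size_multiset_overloaded_eq count)
  finally show ?thesis using set by simp
qed

lemma (in field) frobenius_add_field:
  assumes p: "Factorial_Ring.prime p" "[(int p)] \<cdot> \<one> = \<zero>"
    and "x \<in> carrier R" "y \<in> carrier R"
  shows "(x \<oplus> y) [^] (p ^ n) = x [^] (p ^ n) \<oplus> y [^] (p ^ n)"
proof (cases "x = \<zero>")
  case True
  then show ?thesis using assms by (simp add: nat_pow_zero prime_gt_0_nat)
next
  case False
  then show ?thesis using assms frobenius_add[OF p] field_Units by simp
qed

lemma (in field) frobenius_minus_field:
  assumes p: "Factorial_Ring.prime p" "[(int p)] \<cdot> \<one> = \<zero>" and "x \<in> carrier R"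
  shows "(\<ominus> x) [^] (p ^ n) = \<ominus> (x [^] (p ^ n))"
proof -
  have "(\<ominus> x) [^] (p ^ n) \<oplus> x [^] (p ^ n) = \<zero>"
    using frobenius_add_field[OF p, of "\<ominus> x" x n] assms
    by (simp add: l_neg nat_pow_zero prime_gt_0_nat)
  then show ?thesis using assms by (intro minus_equality[symmetric]) auto
qed

lemma (in field) subfield_frobenius_fixed:
  assumes p: "Factorial_Ring.prime p" "[(int p)] \<cdot> \<one> = \<zero>"
  shows "subfield {a \<in> carrier R. a [^] (p ^ n) = a} R"
proof -
  note add = frobenius_add_field[OF p] and neg = frobenius_minus_field[OF p]
  show ?thesis
  proof (rule subfieldI')
    show "subring {a \<in> carrier R. a [^] (p ^ n) = a} R"
      by (rule subringI) (auto simp: add neg nat_pow_distrib)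
    fix k assume "k \<in> {a \<in> carrier R. a [^] (p ^ n) = a} - {\<zero>}"
    then have k: "k \<in> carrier R" "k \<noteq> \<zero>" "k [^] (p ^ n) = k" by auto
    then have inv: "inv k \<in> carrier R" "k \<otimes> inv k = \<one>" using field_Units by auto
    then have "k \<otimes> (inv k) [^] (p ^ n) = \<one>"
      using nat_pow_distrib[of k "inv k" "p ^ n"] k by simp
    then have "(inv k) [^] (p ^ n) = inv k"
      using inv k m_lcancel[of k "(inv k) [^] (p ^ n)" "inv k"] by simp
    then show "inv k \<in> {a \<in> carrier R. a [^] (p ^ n) = a}" using inv by simp
  qed
qed

text \<open>The element type is dictated by the construction of the algebraic closure of a residue
  ring on the integers, in which the field is found.\<close>

lemma exists_field_of_prime_power_order:
  fixes p n :: nat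
  assumes p: "Factorial_Ring.prime p" and n: "n > 0"
  shows "\<exists>R :: ((int list \<times> nat) multiset \<Rightarrow> int) ring. field R \<and> card (carrier R) = p ^ n"
proof -
  interpret F: residues_prime p "residue_ring (int p)"
    using p by (simp add: residues_prime_def)
  have F: "[(int p)] \<cdot>\<^bsub>residue_ring (int p)\<^esub> \<one>\<^bsub>residue_ring (int p)\<^esub> = \<zero>\<^bsub>residue_ring (int p)\<^esub>"
    using F.char_of_card[of p 1] p by (simp add: F.res_carrier_eq prime_gt_0_nat)
  define L :: "((int list \<times> nat) multiset \<Rightarrow> int) ring" where "L = F.alg_closure"
  define K :: "((int list \<times> nat) multiset \<Rightarrow> int) set"
    where "K = F.indexed_const ` carrier (residue_ring (int p))"
  interpret L: algebraic_closure L K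
    unfolding L_def K_def by (rule F.alg_closureE)
  interpret h: ring_hom_ring "residue_ring (int p)" L F.indexed_const
    using F.alg_closureE(2) F.ring_axioms L.ring_axioms unfolding L_def
    by (intro ring_hom_ringI2)
  have char: "[(int p)] \<cdot>\<^bsub>L\<^esub> \<one>\<^bsub>L\<^esub> = \<zero>\<^bsub>L\<^esub>"
    using h.hom_int_embed[of "int p"] F by simp
  have K: "subring K L" by (rule subfieldE(1)[OF L.subfield_axioms])
  interpret UK: domain "K[X]\<^bsub>L\<^esub>" by (rule L.univ_poly_is_domain[OF K])
  have XK: "X\<^bsub>L\<^esub> \<in> carrier (K[X]\<^bsub>L\<^esub>)" by (rule L.var_closed[OF K])
  \<comment> \<open>The closure property concerns polynomials over the base field \<open>K\<close>,
    so X^(p^n) - X has to be recognised as one of them.\<close>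
  have "X\<^bsub>L\<^esub> [^]\<^bsub>K[X]\<^bsub>L\<^esub>\<^esub> (p ^ n) \<ominus>\<^bsub>K[X]\<^bsub>L\<^esub>\<^esub> X\<^bsub>L\<^esub> =
      X\<^bsub>L\<^esub> [^]\<^bsub>poly_ring L\<^esub> (p ^ n) \<ominus>\<^bsub>poly_ring L\<^esub> X\<^bsub>L\<^esub>"
    using L.univ_poly_a_minus_consistent[OF K XK]
      L.unitary_monom_eq_var_pow[OF K, of "p ^ n"]
      L.unitary_monom_eq_var_pow[OF L.carrier_is_subring, of "p ^ n"] by simp
  moreover have "X\<^bsub>L\<^esub> [^]\<^bsub>K[X]\<^bsub>L\<^esub>\<^esub> (p ^ n) \<ominus>\<^bsub>K[X]\<^bsub>L\<^esub>\<^esub> X\<^bsub>L\<^esub> \<in> carrier (K[X]\<^bsub>L\<^esub>)"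
    using XK by simp
  ultimately have "L.splitted (X\<^bsub>L\<^esub> [^]\<^bsub>poly_ring L\<^esub> (p ^ n) \<ominus>\<^bsub>poly_ring L\<^esub> X\<^bsub>L\<^esub>)"
    using L.roots_over_subfield by metis
  then have "card {a \<in> carrier L. a [^]\<^bsub>L\<^esub> (p ^ n) = a} = p ^ n"
    by (rule L.card_frobenius_fixed[OF p char n])
  moreover have "field (L \<lparr>carrier := {a \<in> carrier L. a [^]\<^bsub>L\<^esub> (p ^ n) = a}\<rparr>)"
    using L.subfield_iff(2)[OF L.subfield_frobenius_fixed[OF p char]] .
  ultimately show ?thesis
    by (intro exI[of _ "L \<lparr>carrier := {a \<in> carrier L. a [^]\<^bsub>L\<^esub> (p ^ n) = a}\<rparr>"]) simp
qed


section \<open>Uniqueness of finite fields\<close>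

text \<open>Pseudo-division multiplies the dividend by a power of the leading coefficient of
  \<open>m\<close>, which is 1 here.\<close>

lemma monic_division:
  fixes f m :: "int poly"
  assumes m: "Polynomial.coeff m (Polynomial.degree m) = 1"
  obtains g r where "f = m * g + r" "r = 0 \<or> Polynomial.degree r < Polynomial.degree m"
proof -
  have "m \<noteq> 0" using m by auto
  obtain g r where "pseudo_divmod f m = (g, r)" by fastforce
  from pseudo_divmod[OF \<open>m \<noteq> 0\<close> this] show thesis
    using m by (intro that[of g r]) auto
qed

context
  fixes K :: "('a, 'b) ring_scheme" and R :: "('c, 'd) ring_scheme" and p n :: nat and \<alpha> :: 'a
  assumes K: "field K" and R: "field R" and p: "Factorial_Ring.prime p"
    and card_K: "card (carrier K) = p ^ n" and card_R: "card (carrier R) = p ^ n"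
    and \<alpha>: "\<alpha> \<in> carrier K"
begin

interpretation K: field K by (rule K)
interpretation R: field R by (rule R)

lemma pow_gt_0: "p ^ n > 0" using p by (simp add: prime_gt_0_nat)

lemma finite_K: "finite (carrier K)" and finite_R: "finite (carrier R)"
  using card_K card_R pow_gt_0 by (metis card_ge_0_finite)+

lemma char_K: "[(int p)] \<cdot>\<^bsub>K\<^esub> \<one>\<^bsub>K\<^esub> = \<zero>\<^bsub>K\<^esub>" and char_R: "[(int p)] \<cdot>\<^bsub>R\<^esub> \<one>\<^bsub>R\<^esub> = \<zero>\<^bsub>R\<^esub>"
  using K.char_of_card[OF card_K] R.char_of_card[OF card_R] p prime_gt_0_nat by auto

text \<open>A monic integer polynomial of least degree that vanishes at \<open>\<alpha>\<close> divides $X^{p^n} - X$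
  modulo \<open>p\<close>, so counting roots shows that it has a root in \<open>R\<close>.\<close>

lemma exists_conjugate:
  "\<exists>b\<in>carrier R. \<forall>f. int_poly_eval K \<alpha> f = \<zero>\<^bsub>K\<^esub> \<longrightarrow> int_poly_eval R b f = \<zero>\<^bsub>R\<^esub>"
proof -
  define q where "q = p ^ n"
  have q: "q \<ge> 2" using K.card_ge_2[OF finite_K] card_K by (simp add: q_def)
  define M where "M = (\<lambda>d. \<exists>f. Polynomial.degree f = d \<and> Polynomial.coeff f d = 1 \<and>
    int_poly_eval K \<alpha> f = \<zero>\<^bsub>K\<^esub>)"
  \<comment> \<open>X^q - X vanishes on every field with \<open>q\<close> elements. It shows that
    monic polynomials vanishing at \<alpha> exist, and later it provides the roots in
    \<open>R\<close>.\<close>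
  define f0 :: "int poly" where "f0 = Polynomial.monom 1 q - Polynomial.monom 1 1"
  have f0: "Polynomial.degree f0 = q" "Polynomial.coeff f0 q = 1"
  proof -
    show c: "Polynomial.coeff f0 q = 1" using q by (simp add: f0_def)
    show "Polynomial.degree f0 = q"
    proof (rule antisym)
      show "Polynomial.degree f0 \<le> q"
        by (rule degree_le) (use q in \<open>simp add: f0_def\<close>)
      show "q \<le> Polynomial.degree f0"
        by (rule le_degree) (simp add: c)
    qed
  qed
  have f0_K: "int_poly_eval K \<alpha> f0 = \<zero>\<^bsub>K\<^esub>"
    unfolding f0_def K.int_poly_eval_diff[OF \<alpha>]
    using K.pow_card[OF finite_K \<alpha>] \<alpha> by (simp add: card_K q_def)
  have f0_R: "int_poly_eval R b f0 = \<zero>\<^bsub>R\<^esub>" if b: "b \<in> carrier R" for b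
    unfolding f0_def R.int_poly_eval_diff[OF b]
    using R.pow_card[OF finite_R b] b by (simp add: card_R q_def)
  have "M q" using f0 f0_K by (auto simp: M_def)
  define d where "d = (LEAST d. M d)"
  have "M d" unfolding d_def by (rule LeastI[of M q]) fact
  then obtain m where m: "Polynomial.degree m = d" "Polynomial.coeff m d = 1"
      "int_poly_eval K \<alpha> m = \<zero>\<^bsub>K\<^esub>"
    by (auto simp: M_def)
  have "d \<noteq> 0"
  proof
    assume "d = 0"
    then have "m = 1" using m(1,2) by (metis degree_eq_zeroE coeff_pCons_0 one_pCons)
    then show False using m(3) \<alpha> by simp
  qed
  \<comment> \<open>By minimality of \<open>d\<close>, a polynomial of smaller degree that vanishes
    at \<alpha> is zero modulo \<open>p\<close>; otherwise its highest coefficient prime to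
    \<open>p\<close> could be normalised to 1.\<close>
  have small: "int p dvd Polynomial.coeff r i"
    if r: "r = 0 \<or> Polynomial.degree r < d" "int_poly_eval K \<alpha> r = \<zero>\<^bsub>K\<^esub>" for r i
  proof (rule ccontr)
    define I where "I = {i. \<not> int p dvd Polynomial.coeff r i}"
    assume "\<not> int p dvd Polynomial.coeff r i"
    then have "i \<in> I" by (simp add: I_def)
    have I: "I \<subseteq> {..Polynomial.degree r}" by (auto simp: I_def intro: le_degree)
    define k where "k = Max I"
    have fin: "finite I" by (rule finite_subset[OF I]) simp
    have "k \<in> I" unfolding k_def by (rule Max_in) (use fin \<open>i \<in> I\<close> in auto)
    have above: "int p dvd Polynomial.coeff r j" if "j > k" for j
      using Max_ge[OF fin, of j] that by (auto simp: I_def k_def)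
    have "coprime (int p) (Polynomial.coeff r k)"
      using \<open>k \<in> I\<close> p by (intro prime_imp_coprime) (auto simp: I_def)
    then obtain c where c: "[c * Polynomial.coeff r k = 1] (mod int p)"
      using cong_solve_coprime_int[of "Polynomial.coeff r k" "int p"]
      by (auto simp: coprime_commute mult.commute)
    \<comment> \<open>The coefficients above \<open>k\<close> are multiples of \<open>p\<close> and
      are discarded; the one at \<open>k\<close> is replaced by 1, to which it is congruent. The
      result is monic and still vanishes at \<alpha>.\<close>
    define s where "s = poly_cutoff k (smult c r) + Polynomial.monom 1 k"
    have s: "Polynomial.coeff s k = 1" by (simp add: s_def coeff_poly_cutoff)
    have "Polynomial.degree s = k"
    proof (rule antisym)
      show "Polynomial.degree s \<le> k"
        by (rule degree_le) (simp add: s_def coeff_poly_cutoff)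
    qed (rule le_degree, simp add: s)
    moreover have "int_poly_eval K \<alpha> (smult c r - s) = \<zero>\<^bsub>K\<^esub>"
    proof (rule K.int_poly_eval_cong_mod[OF char_K \<alpha>])
      fix j
      consider "j < k" | "j = k" | "j > k" by linarith
      then show "int p dvd Polynomial.coeff (smult c r - s) j"
      proof cases
        case 2
        then show ?thesis using c s by (simp add: cong_iff_dvd_diff)
      qed (simp_all add: s_def coeff_poly_cutoff above)
    qed
    then have "int_poly_eval K \<alpha> s = \<zero>\<^bsub>K\<^esub>"
      using r(2) \<alpha> by (simp add: K.int_poly_eval_diff K.int_poly_eval_smult)
    ultimately have "M k" using s by (auto simp: M_def)
    then have "d \<le> k" unfolding d_def by (rule Least_le)
    moreover have "k \<le> Polynomial.degree r" using I \<open>k \<in> I\<close> by auto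
    moreover have "r \<noteq> 0" using \<open>k \<in> I\<close> by (auto simp: I_def)
    ultimately show False using r(1) by auto
  qed
  have factor: "\<exists>g r. f = m * g + r \<and> (r = 0 \<or> Polynomial.degree r < d) \<and>
      (\<forall>i. int p dvd Polynomial.coeff r i)" if f: "int_poly_eval K \<alpha> f = \<zero>\<^bsub>K\<^esub>" for f
  proof -
    obtain g r where gr: "f = m * g + r" "r = 0 \<or> Polynomial.degree r < d"
      using monic_division[of m f] m(1,2) by metis
    have "int_poly_eval K \<alpha> r = \<zero>\<^bsub>K\<^esub>"
      using f \<alpha> m(3) by (simp add: gr(1) K.int_poly_eval_add K.int_poly_eval_mult)
    then show ?thesis using gr small by blast
  qed
  obtain g r where gr: "f0 = m * g + r" "r = 0 \<or> Polynomial.degree r < d"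
      "\<And>i. int p dvd Polynomial.coeff r i"
    using factor[OF f0_K] by blast
  \<comment> \<open>Otherwise every coefficient of \<open>f0\<close> would be a multiple of
    \<open>p\<close>, but its leading one is 1.\<close>
  have "\<not> (\<forall>i. int p dvd Polynomial.coeff g i)"
  proof
    assume "\<forall>i. int p dvd Polynomial.coeff g i"
    then have "int p dvd Polynomial.coeff f0 q"
      unfolding gr(1) Polynomial.coeff_add Polynomial.coeff_mult
      by (intro dvd_add dvd_sum dvd_mult gr(3)) auto
    then show False using f0(2) prime_gt_1_nat[OF p] by simp
  qed
  then obtain i where i: "\<not> int p dvd Polynomial.coeff g i" by auto
  have "[Polynomial.coeff g i] \<cdot>\<^bsub>R\<^esub> \<one>\<^bsub>R\<^esub> \<noteq> \<zero>\<^bsub>R\<^esub>"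
    using i by (simp add: R.int_embed_eq_zero_iff[OF p char_R])
  then have "card {b \<in> carrier R. int_poly_eval R b g = \<zero>\<^bsub>R\<^esub>} \<le> Polynomial.degree g"
    by (rule R.int_poly_roots_bound[OF finite_R])
  also have "Polynomial.degree g < q"
  proof -
    have "g \<noteq> 0" "m \<noteq> 0" using i m by auto
    then have "d + Polynomial.degree g = Polynomial.degree (m * g)"
      using m(1) by (simp add: degree_mult_eq)
    also have "m * g = f0 - r" using gr(1) by simp
    also have "Polynomial.degree (f0 - r) \<le> max (Polynomial.degree f0) (Polynomial.degree r)"
      by (rule degree_diff_le_max)
    also have "\<dots> \<le> q"
    proof -
      have "d \<le> q" unfolding d_def by (rule Least_le) fact
      then show ?thesis using f0(1) gr(2) by auto
    qed
    finally show ?thesis using \<open>d \<noteq> 0\<close> by simp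
  qed
  \<comment> \<open>The cofactor \<open>g\<close> has too few roots to cover \<open>R\<close>. At a
    point \<open>b\<close> that is not a root of \<open>g\<close>, the vanishing of
    \<open>f0\<close> forces that of \<open>m\<close>.\<close>
  finally have "{b \<in> carrier R. int_poly_eval R b g = \<zero>\<^bsub>R\<^esub>} \<noteq> carrier R"
    using card_R by (auto simp: q_def)
  then obtain b where b: "b \<in> carrier R" "int_poly_eval R b g \<noteq> \<zero>\<^bsub>R\<^esub>" by auto
  have eval_R: "int_poly_eval R b (m * g + r) = int_poly_eval R b m \<otimes>\<^bsub>R\<^esub> int_poly_eval R b g"
    if "\<And>i. int p dvd Polynomial.coeff r i" for g r
    using R.int_poly_eval_cong_mod[OF char_R b(1) that] b(1)
    by (simp add: R.int_poly_eval_add R.int_poly_eval_mult)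
  have mb: "int_poly_eval R b m = \<zero>\<^bsub>R\<^esub>"
    using f0_R[OF b(1)] eval_R[OF gr(3), of g] b R.integral[of "int_poly_eval R b m" "int_poly_eval R b g"]
    by (auto simp flip: gr(1))
  have "int_poly_eval R b f = \<zero>\<^bsub>R\<^esub>" if f: "int_poly_eval K \<alpha> f = \<zero>\<^bsub>K\<^esub>" for f
  proof -
    obtain g r where gr: "f = m * g + r" "\<And>i. int p dvd Polynomial.coeff r i"
      using factor[OF f] by blast
    show ?thesis using eval_R[OF gr(2), of g] mb b(1) by (simp add: gr(1))
  qed
  with b(1) show ?thesis by blast
qed

text \<open>Every element of \<open>K\<close> is the value at \<alpha> of an integer polynomial,
  because \<alpha> is primitive, and sending f(\<alpha>) to f(b) for a conjugate \<open>b\<close> is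
  well defined. A homomorphism of fields is injective, and the cardinalities agree.\<close>

lemma finite_field_iso:
  assumes prim: "primitive_element K \<alpha>"
  shows "\<exists>h. h \<in> ring_iso K R"
proof -
  obtain b where b: "b \<in> carrier R"
    and conj: "\<And>f. int_poly_eval K \<alpha> f = \<zero>\<^bsub>K\<^esub> \<Longrightarrow> int_poly_eval R b f = \<zero>\<^bsub>R\<^esub>"
    using exists_conjugate by blast
  have surj: "\<exists>f. int_poly_eval K \<alpha> f = x" if x: "x \<in> carrier K" for x
  proof (cases "x = \<zero>\<^bsub>K\<^esub>")
    case True
    then show ?thesis by (intro exI[of _ 0]) simp
  next
    case False
    then obtain k :: nat where "x = \<alpha> [^]\<^bsub>K\<^esub> k"
      using iffD1[OF K.primitive_element_iff[OF finite_K] prim] x by blast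
    then show ?thesis using \<alpha> by (intro exI[of _ "Polynomial.monom 1 k"]) simp
  qed
  define h where "h = (\<lambda>x. int_poly_eval R b (SOME f. int_poly_eval K \<alpha> f = x))"
  have h: "h (int_poly_eval K \<alpha> f) = int_poly_eval R b f" for f
  proof -
    define g where "g = (SOME g. int_poly_eval K \<alpha> g = int_poly_eval K \<alpha> f)"
    have "int_poly_eval K \<alpha> g = int_poly_eval K \<alpha> f" unfolding g_def by (rule someI) simp
    then have "int_poly_eval K \<alpha> (g - f) = \<zero>\<^bsub>K\<^esub>"
      unfolding K.int_poly_eval_diff[OF \<alpha>] using \<alpha> by simp
    then have "int_poly_eval R b (g - f) = \<zero>\<^bsub>R\<^esub>" by (rule conj)
    then have "int_poly_eval R b g = int_poly_eval R b f"
      unfolding R.int_poly_eval_diff[OF b] using b by simp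
    then show ?thesis by (simp add: h_def g_def)
  qed
  have hom: "h \<in> ring_hom K R"
  proof (rule ring_hom_memI)
    fix x y assume "x \<in> carrier K" "y \<in> carrier K"
    then obtain f g where fg: "x = int_poly_eval K \<alpha> f" "y = int_poly_eval K \<alpha> g"
      using surj by metis
    show "h x \<in> carrier R" using b by (simp add: fg h)
    show "h (x \<otimes>\<^bsub>K\<^esub> y) = h x \<otimes>\<^bsub>R\<^esub> h y"
      unfolding fg K.int_poly_eval_mult[OF \<alpha>, symmetric] h by (rule R.int_poly_eval_mult[OF b])
    show "h (x \<oplus>\<^bsub>K\<^esub> y) = h x \<oplus>\<^bsub>R\<^esub> h y"
      unfolding fg K.int_poly_eval_add[OF \<alpha>, symmetric] h by (rule R.int_poly_eval_add[OF b])
  next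
    show "h \<one>\<^bsub>K\<^esub> = \<one>\<^bsub>R\<^esub>" using h[of 1] \<alpha> b by simp
  qed
  interpret h: ring_hom_ring K R h by (rule ring_hom_ringI2[OF K.ring_axioms R.ring_axioms hom])
  have "inj_on h (carrier K)"
  proof (rule inj_onI, rule ccontr)
    fix x y assume xy: "x \<in> carrier K" "y \<in> carrier K" "h x = h y" "x \<noteq> y"
    define z where "z = x \<ominus>\<^bsub>K\<^esub> y"
    have z: "z \<in> carrier K" "z \<noteq> \<zero>\<^bsub>K\<^esub>" using xy by (auto simp: z_def)
    have "h z = \<zero>\<^bsub>R\<^esub>" using xy by (simp add: z_def a_minus_def R.r_neg)
    moreover have inv: "inv\<^bsub>K\<^esub> z \<in> carrier K" "z \<otimes>\<^bsub>K\<^esub> inv\<^bsub>K\<^esub> z = \<one>\<^bsub>K\<^esub>"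
      using z K.field_Units by auto
    ultimately show False using h.hom_mult[OF z(1) inv(1)] by simp
  qed
  then have "bij_betw h (carrier K) (carrier R)"
    using card_image[of h "carrier K"] card_K card_R finite_R h.hom_closed
    by (intro bij_betw_imageI card_subset_eq) auto
  with hom show ?thesis by (auto simp: ring_iso_def)
qed

end

lemma primitive_element_ring_iso:
  assumes K: "field K" "finite (carrier K)" and R: "field R"
    and h: "h \<in> ring_iso K R" and \<alpha>: "primitive_element K \<alpha>"
  shows "primitive_element R (h \<alpha>)"
proof -
  interpret K: field K by fact
  interpret R: field R by fact
  interpret h: ring_hom_ring K R h
    using h by (intro ring_hom_ringI2) (auto simp: ring_iso_def K.ring_axioms R.ring_axioms)
  have bij: "h ` carrier K = carrier R" "inj_on h (carrier K)"
    using h by (auto simp: ring_iso_def bij_betw_def)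
  have \<alpha>': "\<alpha> \<in> carrier K - {\<zero>\<^bsub>K\<^esub>}" "carrier K - {\<zero>\<^bsub>K\<^esub>} = range (\<lambda>k::nat. \<alpha> [^]\<^bsub>K\<^esub> k)"
    using \<alpha> K.primitive_element_iff[OF K(2)] by auto
  have im: "h ` (carrier K - {\<zero>\<^bsub>K\<^esub>}) = carrier R - {\<zero>\<^bsub>R\<^esub>}"
    using inj_on_image_set_diff[OF bij(2), of "carrier K" "{\<zero>\<^bsub>K\<^esub>}"] bij(1) by simp
  have "carrier R - {\<zero>\<^bsub>R\<^esub>} = range (\<lambda>k::nat. h \<alpha> [^]\<^bsub>R\<^esub> k)"
    unfolding im[symmetric] \<alpha>'(2) image_image using \<alpha>'(1) h.hom_nat_pow by simp
  moreover have "finite (carrier R)" using bij(1) K(2) by (metis finite_imageI)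
  ultimately show ?thesis
    using R.primitive_element_iff[of "h \<alpha>"] im \<alpha>'(1) by blast
qed


section \<open>Isomorphisms of affine quandles\<close>

locale finite_field_prime_power = field R for R (structure) +
  fixes p n :: nat
  assumes p: "Factorial_Ring.prime p" and card: "card (carrier R) = p ^ n" and gt_2: "p ^ n > 2"
begin

section \<open>The Frobenius map on a field with p^n elements\<close>

lemma n_pos: "n > 0"
  using gt_2 by (cases n) auto

lemma p_gt_1: "p > 1"
  using prime_gt_1_nat[OF p] .

lemma finite_carrier: "finite (carrier R)"
  using card gt_2 by (intro card_ge_0_finite) linarith

lemma char: "[(int p)] \<cdot> \<one> = \<zero>"
  using char_of_card[OF card] p_gt_1 by simp

lemmas frob_add = frobenius_add_field[OF p char] and frob_minus = frobenius_minus_field[OF p char]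

lemma pow_card_iterate: "x \<in> carrier R \<Longrightarrow> x [^] (p ^ (n * s)) = x"
proof (induction s)
  case (Suc s)
  have "x [^] (p ^ (n * Suc s)) = (x [^] (p ^ n)) [^] (p ^ (n * s))"
    using Suc.prems by (simp add: nat_pow_pow power_add)
  then show ?case
    using Suc pow_card[OF finite_carrier Suc.prems] by (simp add: card)
qed simp

text \<open>The exponents \<open>s\<close> and \<open>(n - 1) * s\<close> add up to a multiple of
  \<open>n\<close>. The inverse of a power of the Frobenius map is thus again such a power, which
  makes prime-power equivalence symmetric.\<close>

lemma frob_inverse: "x \<in> carrier R \<Longrightarrow> (x [^] (p ^ s)) [^] (p ^ ((n - 1) * s)) = x"
  using pow_card_iterate[of x s] n_pos
  by (cases n) (simp_all add: nat_pow_pow flip: power_add)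

lemma frob_bij: "bij_betw (\<lambda>x. x [^] (p ^ s)) (carrier R) (carrier R)"
proof -
  have "inj_on (\<lambda>x. x [^] (p ^ s)) (carrier R)"
    by (rule inj_on_inverseI[where g = "\<lambda>x. x [^] (p ^ ((n - 1) * s))"]) (rule frob_inverse)
  moreover have "(\<lambda>x. x [^] (p ^ s)) ` carrier R \<subseteq> carrier R" by auto
  ultimately show ?thesis
    using endo_inj_surj[OF finite_carrier] by (simp add: bij_betw_def)
qed

lemma prime_power_equiv_sym:
  assumes "\<beta> \<in> carrier R" "prime_power_equiv R p \<alpha> \<beta>"
  shows "prime_power_equiv R p \<beta> \<alpha>"
  using assms frob_inverse unfolding prime_power_equiv_def by metis

lemma primitive_elementD:
  assumes "primitive_element R \<alpha>"
  shows "\<alpha> \<in> carrier R" "\<alpha> \<noteq> \<zero>" "\<one> \<ominus> \<alpha> \<in> carrier R" "\<one> \<ominus> \<alpha> \<noteq> \<zero>"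
    "\<And>x. x \<in> carrier R \<Longrightarrow> x \<noteq> \<zero> \<Longrightarrow> \<exists>k<p ^ n - 1. x = \<alpha> [^] k"
proof -
  show \<alpha>: "\<alpha> \<in> carrier R" "\<alpha> \<noteq> \<zero>"
    using assms primitive_element_iff[OF finite_carrier] by auto
  then show "\<one> \<ominus> \<alpha> \<in> carrier R" by simp
  show ex: "\<exists>k<p ^ n - 1. x = \<alpha> [^] k" if "x \<in> carrier R" "x \<noteq> \<zero>" for x
    using bij_betw_imp_surj_on[OF primitive_element_enumeration[OF finite_carrier assms]] that
    unfolding card by blast
  \<comment> \<open>With \<alpha> = 1 the field would consist of 0 and 1, against
    \<open>gt_2\<close>.\<close>
  show "\<one> \<ominus> \<alpha> \<noteq> \<zero>"
  proof
    assume "\<one> \<ominus> \<alpha> = \<zero>"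
    then have "\<alpha> = \<one>" using \<alpha> by simp
    then have "carrier R - {\<zero>} \<subseteq> {\<one>}" using ex by fastforce
    then have "carrier R \<subseteq> {\<zero>, \<one>}" by blast
    then have "card (carrier R) \<le> 2" using card_mono[of "{\<zero>, \<one>}" "carrier R"] by simp
    then show False using card gt_2 by simp
  qed
qed

lemma primitive_element_frob:
  assumes "primitive_element R \<alpha>"
  shows "primitive_element R (\<alpha> [^] (p ^ s))"
proof -
  note \<alpha> = primitive_elementD[OF assms]
  have "x \<in> range (\<lambda>k::nat. (\<alpha> [^] (p ^ s)) [^] k)" if x: "x \<in> carrier R" "x \<noteq> \<zero>" for x
  proof -
    obtain y where y: "y \<in> carrier R" "x = y [^] (p ^ s)"
      using frob_bij[of s] x(1) unfolding bij_betw_def by auto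
    then have "y \<noteq> \<zero>" using x(2) p_gt_1 by (auto simp: nat_pow_zero)
    then obtain k :: nat where "y = \<alpha> [^] k" using \<alpha>(5) y(1) by blast
    then show ?thesis using y(2) \<alpha>(1) by (auto simp: nat_pow_pow mult.commute)
  qed
  moreover have "\<alpha> [^] k \<noteq> \<zero>" for k :: nat
    using Units_pow_closed[of \<alpha> k] \<alpha>(1,2) field_Units by simp
  ultimately show ?thesis
    using \<alpha>(1) by (auto simp: primitive_element_iff[OF finite_carrier] nat_pow_pow)
qed

lemma affine_quandle_frob:
  assumes \<beta>: "\<beta> \<in> carrier R"
  shows "quandle_isomorphic (affine_quandle R \<beta>) (affine_quandle R (\<beta> [^] (p ^ s)))"
  unfolding quandle_isomorphic_def
proof (rule bexI)
  show "bij_betw (\<lambda>x. x [^] (p ^ s)) (carrier (affine_quandle R \<beta>))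
      (carrier (affine_quandle R (\<beta> [^] (p ^ s))))"
    using frob_bij by simp
  have "(\<one> \<ominus> \<beta>) [^] (p ^ s) = \<one> \<ominus> \<beta> [^] (p ^ s)"
    using \<beta> by (simp add: a_minus_def frob_add frob_minus)
  then show "(\<lambda>x. x [^] (p ^ s)) \<in>
      quandle_hom (affine_quandle R \<beta>) (affine_quandle R (\<beta> [^] (p ^ s)))"
    using \<beta> by (auto simp: quandle_hom_def frob_add nat_pow_distrib)
qed

text \<open>Write $k = p^s u$ with $p \nmid u$.  Since $x \mapsto x^{p^s}$ is an automorphism, the
  polynomial $(1+Y)^u - 1 - Y^u$ vanishes on the whole field.  For $u > 1$ its degree is less than
  $u$, but the coefficient \<open>u\<close> of \<open>Y\<close> is not zero.\<close>

lemma additive_power_is_frob: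
  assumes k: "0 < k" "k < p ^ n"
    and add: "\<And>x. x \<in> carrier R \<Longrightarrow> (\<one> \<oplus> x) [^] k = \<one> \<oplus> x [^] k"
  shows "\<exists>s. k = p ^ s"
proof -
  obtain u where u: "k = p ^ multiplicity p k * u" "\<not> p dvd u"
    using multiplicity_decompose'[of k p] k p_gt_1 by auto
  define s where "s = multiplicity p k"
  have u1: "(\<one> \<oplus> y) [^] u = \<one> \<oplus> y [^] u" if y: "y \<in> carrier R" for y
  proof -
    obtain x where x: "x \<in> carrier R" "y = x [^] (p ^ s)"
      using frob_bij[of s] y unfolding bij_betw_def by auto
    have "(\<one> \<oplus> y) [^] u = ((\<one> \<oplus> x) [^] (p ^ s)) [^] u"
      using x by (simp add: frob_add)
    also have "\<dots> = (\<one> \<oplus> x) [^] k"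
      using x(1) u(1) by (simp add: nat_pow_pow s_def)
    also have "\<dots> = \<one> \<oplus> (x [^] (p ^ s)) [^] u"
      using add[OF x(1)] x(1) u(1) by (simp add: nat_pow_pow s_def)
    finally show ?thesis using x by simp
  qed
  have "u \<noteq> 0" using u(2) by (intro notI) simp
  have "u = 1"
  proof (rule ccontr)
    assume "u \<noteq> 1"
    with \<open>u \<noteq> 0\<close> have u2: "u \<ge> 2" by simp
    define f :: "int poly" where "f = [:1, 1:] ^ u - 1 - Polynomial.monom 1 u"
    have coeff: "Polynomial.coeff f i =
        int (u choose i) - (if i = 0 then 1 else 0) - (if i = u then 1 else 0)" for i
    proof -
      have "Polynomial.coeff ([:1, 1:] ^ u :: int poly) i = int (u choose i)"
        by (cases "i \<le> u")
          (simp_all add: coeff_linear_poly_power degree_linear_power Polynomial.coeff_eq_0 binomial_eq_0)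
      then show ?thesis by (simp add: f_def)
    qed
    have "Polynomial.degree f \<le> u - 1"
      by (rule degree_le) (use u2 in \<open>auto simp: coeff binomial_eq_0\<close>)
    \<comment> \<open>The index 1 differs from \<open>u\<close>, as \<open>u\<close> is at least 2,
      so only the binomial coefficient contributes.\<close>
    moreover have "Polynomial.coeff f 1 = int u" using u2 by (simp add: coeff)
    then have "[(Polynomial.coeff f 1)] \<cdot> \<one> \<noteq> \<zero>"
      using u(2) by (simp add: int_embed_eq_zero_iff[OF p char])
    then have "card {x \<in> carrier R. int_poly_eval R x f = \<zero>} \<le> Polynomial.degree f"
      by (rule int_poly_roots_bound[OF finite_carrier])
    moreover have "int_poly_eval R x f = \<zero>" if x: "x \<in> carrier R" for x
    proof -
      have "int_poly_eval R x ([:1, 1:] ^ u) = \<one> \<oplus> x [^] u"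
        using u1[OF x] x by (simp add: int_poly_eval_power)
      moreover have "(\<one> \<oplus> z) \<ominus> \<one> \<ominus> z = \<zero>" if "z \<in> carrier R" for z
        using that by algebra
      ultimately show ?thesis
        unfolding f_def int_poly_eval_diff[OF x] using x by simp
    qed
    then have "{x \<in> carrier R. int_poly_eval R x f = \<zero>} = carrier R" by auto
    ultimately have "p ^ n \<le> u - 1" using card by simp
    moreover have "u \<le> k" using u(1) k(1) by (metis dvd_imp_le dvd_triv_right)
    ultimately show False using k(2) by simp
  qed
  then show ?thesis using u(1) by auto
qed

lemma affine_quandle_isomorphic_imp:
  assumes \<alpha>: "primitive_element R \<alpha>" and \<beta>: "primitive_element R \<beta>"
    and iso: "quandle_isomorphic (affine_quandle R \<alpha>) (affine_quandle R \<beta>)"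
  shows "prime_power_equiv R p \<beta> \<alpha>"
proof -
  note A = primitive_elementD[OF \<alpha>] and B = primitive_elementD[OF \<beta>]
  obtain h where h: "h \<in> carrier R \<rightarrow> carrier R" "inj_on h (carrier R)"
    and hom: "\<And>x y. \<lbrakk>x \<in> carrier R; y \<in> carrier R\<rbrakk> \<Longrightarrow>
      h (\<alpha> \<otimes> x \<oplus> (\<one> \<ominus> \<alpha>) \<otimes> y) = \<beta> \<otimes> h x \<oplus> (\<one> \<ominus> \<beta>) \<otimes> h y"
    using iso unfolding quandle_isomorphic_def quandle_hom_def bij_betw_def by auto
  have hc [simp]: "h x \<in> carrier R" if "x \<in> carrier R" for x using h(1) that by auto
  \<comment> \<open>Composing \<open>h\<close> with the affine map that takes h(0) to 0 and h(1) to
    1 keeps it a homomorphism, since affine maps commute with the operation.\<close>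
  define c where "c = inv (h \<one> \<ominus> h \<zero>)"
  have "h \<one> \<ominus> h \<zero> \<noteq> \<zero>" using inj_onD[OF h(2), of \<one> \<zero>] by auto
  then have c: "c \<in> carrier R" "(h \<one> \<ominus> h \<zero>) \<otimes> c = \<one>"
    using field_Units by (auto simp: c_def)
  define g where "g = (\<lambda>x. (h x \<ominus> h \<zero>) \<otimes> c)"
  have gc [simp]: "g x \<in> carrier R" if "x \<in> carrier R" for x using that c by (simp add: g_def)
  have g0: "g \<zero> = \<zero>" using c by (simp add: g_def r_neg a_minus_def)
  have g1: "g \<one> = \<one>" using c by (simp add: g_def)
  have gA: "g (\<alpha> \<otimes> x \<oplus> (\<one> \<ominus> \<alpha>) \<otimes> y) = \<beta> \<otimes> g x \<oplus> (\<one> \<ominus> \<beta>) \<otimes> g y"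
    if "x \<in> carrier R" "y \<in> carrier R" for x y
  proof -
    have "(\<beta> \<otimes> a \<oplus> (\<one> \<ominus> \<beta>) \<otimes> b \<ominus> z) \<otimes> c = \<beta> \<otimes> ((a \<ominus> z) \<otimes> c) \<oplus> (\<one> \<ominus> \<beta>) \<otimes> ((b \<ominus> z) \<otimes> c)"
      if "a \<in> carrier R" "b \<in> carrier R" "z \<in> carrier R" for a b z
      using that B(1) c(1) by algebra
    then show ?thesis using that by (simp add: g_def hom)
  qed
  have g\<alpha>: "g (\<alpha> \<otimes> x) = \<beta> \<otimes> g x" if "x \<in> carrier R" for x
    using gA[OF that zero_closed] that A B g0 by simp
  have g1\<alpha>: "g ((\<one> \<ominus> \<alpha>) \<otimes> x) = (\<one> \<ominus> \<beta>) \<otimes> g x" if "x \<in> carrier R" for x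
    using gA[OF zero_closed that] that A B g0 by simp
  \<comment> \<open>Both \<alpha> and 1-\<alpha> are invertible, so any two summands have the form
    \<alpha>u and (1-\<alpha>)v, and for these the homomorphism property is additivity.\<close>
  have g_add: "g (x \<oplus> y) = g x \<oplus> g y" if xy: "x \<in> carrier R" "y \<in> carrier R" for x y
  proof -
    have inv: "inv \<alpha> \<in> carrier R" "\<alpha> \<otimes> inv \<alpha> = \<one>" "inv (\<one> \<ominus> \<alpha>) \<in> carrier R"
        "(\<one> \<ominus> \<alpha>) \<otimes> inv (\<one> \<ominus> \<alpha>) = \<one>"
      using A field_Units by auto
    define u where "u = inv \<alpha> \<otimes> x"
    define v where "v = inv (\<one> \<ominus> \<alpha>) \<otimes> y"
    have "\<alpha> \<otimes> u = x" "(\<one> \<ominus> \<alpha>) \<otimes> v = y" "u \<in> carrier R" "v \<in> carrier R"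
      using inv xy A by (simp_all add: u_def v_def flip: m_assoc)
    then show ?thesis using gA[of u v] g\<alpha>[of u] g1\<alpha>[of v] by simp
  qed
  have g_pow: "g (\<alpha> [^] j) = \<beta> [^] j" for j :: nat
  proof (induction j)
    case (Suc j)
    then show ?case using g\<alpha>[of "\<alpha> [^] j"] A B by (simp add: m_comm)
  qed (simp add: g1)
  \<comment> \<open>The exponent of \<beta> as a power of \<alpha> is also that of the power map
    \<open>g\<close>. It is nonzero because \<beta> is not 1, so the power map has the right value
    at 0 as well.\<close>
  obtain k where k: "k < p ^ n - 1" "\<beta> = \<alpha> [^] k" using A(5) B(1,2) by blast
  have "k \<noteq> 0" using k(2) B(4) by (intro notI) simp
  have g: "g x = x [^] k" if x: "x \<in> carrier R" for x
  proof (cases "x = \<zero>")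
    case True
    then show ?thesis using g0 \<open>k \<noteq> 0\<close> by (simp add: nat_pow_zero)
  next
    case False
    then obtain j :: nat where "x = \<alpha> [^] j" using A(5) x by blast
    then show ?thesis using g_pow[of j] k(2) A(1) by (simp add: nat_pow_pow mult.commute)
  qed
  have "\<exists>s. k = p ^ s"
  proof (rule additive_power_is_frob)
    show "(\<one> \<oplus> x) [^] k = \<one> \<oplus> x [^] k" if "x \<in> carrier R" for x
      using g_add[OF one_closed that] that by (simp add: g g1)
  qed (use \<open>k \<noteq> 0\<close> k(1) in auto)
  then show ?thesis using k(2) by (auto simp: prime_power_equiv_def)
qed

lemma affine_quandle_isomorphic_iff:
  assumes \<alpha>: "primitive_element R \<alpha>" and \<beta>: "primitive_element R \<beta>"
  shows "quandle_isomorphic (affine_quandle R \<alpha>) (affine_quandle R \<beta>) \<longleftrightarrow> prime_power_equiv R p \<alpha> \<beta>"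
proof
  assume "quandle_isomorphic (affine_quandle R \<alpha>) (affine_quandle R \<beta>)"
  then show "prime_power_equiv R p \<alpha> \<beta>"
    using affine_quandle_isomorphic_imp[OF \<alpha> \<beta>] prime_power_equiv_sym primitive_elementD(1)[OF \<alpha>]
    by blast
next
  assume "prime_power_equiv R p \<alpha> \<beta>"
  then have "prime_power_equiv R p \<beta> \<alpha>"
    using prime_power_equiv_sym primitive_elementD(1)[OF \<beta>] by blast
  then show "quandle_isomorphic (affine_quandle R \<alpha>) (affine_quandle R \<beta>)"
    using affine_quandle_frob primitive_elementD(1)[OF \<alpha>] unfolding prime_power_equiv_def by blast
qed

text \<open>The conjugate \<beta>^(p^s) depends only on s modulo n, and for s < n the exponents p^s
  stay below the order p^n - 1 of \<beta>, so they give different elements.\<close>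

lemma card_prime_power_equiv_class:
  assumes \<beta>: "primitive_element R \<beta>"
  shows "card {\<alpha>. prime_power_equiv R p \<alpha> \<beta>} = n"
proof -
  note B = primitive_elementD[OF \<beta>]
  \<comment> \<open>The bound fails for \<open>p = 2\<close> and \<open>n = 1\<close>, a case that
    \<open>gt_2\<close> excludes.\<close>
  have lt: "p ^ s < p ^ n - 1" if "s < n" for s
  proof -
    have "p ^ s \<le> p ^ (n - 1)" using that p_gt_1 by (intro power_increasing) auto
    moreover have "p ^ n = p * p ^ (n - 1)" using n_pos by (cases n) auto
    moreover have "p ^ (n - 1) + 1 < p * p ^ (n - 1)"
    proof (cases "p = 2")
      case True
      then have "n - 1 \<noteq> 0" using gt_2 n_pos by (cases n; cases "n - 1") auto
      then have "2 ^ (n - 1) > (1::nat)" by (intro one_less_power) auto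
      then show ?thesis using True by simp
    next
      case False
      then have "3 \<le> p" using p_gt_1 by simp
      then have "3 * p ^ (n - 1) \<le> p * p ^ (n - 1)" by (rule mult_right_mono) simp
      moreover have "p ^ (n - 1) \<ge> 1" using p_gt_1 by simp
      ultimately show ?thesis by linarith
    qed
    ultimately show ?thesis by linarith
  qed
  have "{\<alpha>. prime_power_equiv R p \<alpha> \<beta>} = (\<lambda>s. \<beta> [^] (p ^ s)) ` {..<n}"
  proof (intro Set.set_eqI iffI)
    fix \<alpha> assume "\<alpha> \<in> {\<alpha>. prime_power_equiv R p \<alpha> \<beta>}"
    then obtain s where s: "\<alpha> = \<beta> [^] (p ^ s)" by (auto simp: prime_power_equiv_def)
    have "p ^ s = p ^ (n * (s div n)) * p ^ (s mod n)" by (simp flip: power_add)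
    then have "\<alpha> = (\<beta> [^] (p ^ (n * (s div n)))) [^] (p ^ (s mod n))"
      using B(1) by (simp add: s nat_pow_pow)
    then have "\<alpha> = \<beta> [^] (p ^ (s mod n))" using pow_card_iterate[OF B(1)] by simp
    then show "\<alpha> \<in> (\<lambda>s. \<beta> [^] (p ^ s)) ` {..<n}" using n_pos by simp
  qed (auto simp: prime_power_equiv_def)
  moreover have "inj_on (\<lambda>s. \<beta> [^] (p ^ s)) {..<n}"
  proof (rule inj_onI)
    fix s t assume st: "s \<in> {..<n}" "t \<in> {..<n}" "\<beta> [^] (p ^ s) = \<beta> [^] (p ^ t)"
    have "p ^ s = p ^ t"
      using inj_onD[OF bij_betw_imp_inj_on[OF primitive_element_enumeration[OF finite_carrier \<beta>]] st(3)]
        lt st(1,2) by (simp add: card)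
    then show "s = t" using p_gt_1 by simp
  qed
  ultimately show ?thesis by (simp add: card_image)
qed

text \<open>A primitive element is one of order p^n - 1. The count of elements of a given order
  applies once one of them exists, which cyclicity of the multiplicative group provides.\<close>

lemma card_primitive_elements: "card {\<alpha>. primitive_element R \<alpha>} = totient (p ^ n - 1)"
proof -
  interpret M: group "mult_of R" by (rule mult_of_group)
  have ord: "Coset.order (mult_of R) = p ^ n - 1"
    using order_mult_of[OF finite_carrier] by (simp add: Coset.order_def card mult_of_eq)
  have iff: "primitive_element R \<alpha> \<longleftrightarrow> \<alpha> \<in> carrier (mult_of R) \<and> M.ord \<alpha> = p ^ n - 1" for \<alpha>
  proof (cases "\<alpha> \<in> carrier (mult_of R)")
    case True
    have fin: "finite (carrier (mult_of R))" using finite_carrier by simp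
    have sub: "generate (mult_of R) {\<alpha>} \<subseteq> carrier (mult_of R)"
      using M.generate_incl[of "{\<alpha>}"] True by simp
    have "generate (mult_of R) {\<alpha>} = carrier (mult_of R) \<longleftrightarrow>
        card (generate (mult_of R) {\<alpha>}) = card (carrier (mult_of R))"
      by (rule iffI) (erule arg_cong, rule card_subset_eq[OF fin sub])
    then show ?thesis
      using True ord unfolding primitive_element_def M.generate_pow_card[OF True] Coset.order_def
      by simp
  qed (auto simp: primitive_element_def)
  obtain a where "a \<in> carrier (mult_of R)" "carrier (mult_of R) = {a [^] i | i::nat. i \<in> UNIV}"
    using finite_field_mult_group_has_gen[OF finite_carrier] unfolding mult_of_eq by blast
  then have "primitive_element R a"
    unfolding primitive_element_iff[OF finite_carrier] carrier_mult_of by blast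
  then have "\<exists>a\<in>carrier (mult_of R). M.ord a = p ^ n - 1" using iff by blast
  then have "card {a \<in> carrier (mult_of R). M.ord a = p ^ n - 1} = phi' (p ^ n - 1)"
    using num_elems_of_ord_eq_phi'[OF finite_carrier, of "p ^ n - 1"] ord by (simp add: mult_of_eq)
  moreover have "phi' (p ^ n - 1) = totient (p ^ n - 1)"
    unfolding phi'_def totient_def totatives_def
    by (rule arg_cong[of _ _ Finite_Set.card]) auto
  ultimately show ?thesis by (simp add: iff)
qed

end


section \<open>The quandles given by generators and relations\<close>

text \<open>An injective map of a finite set into itself is onto, so \<open>S\<close> is also closed
  under right division by \<open>i\<close>. This is how terms built with \<open>Rdiv\<close> are
  handled.\<close>

lemma (in quandle) right_mult_surj_on:
  assumes "finite S" "S \<subseteq> carrier Q" "i \<in> carrier Q" "\<And>z. z \<in> S \<Longrightarrow> z \<triangleright> i \<in> S" "s \<in> S"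
  shows "\<exists>z\<in>S. s = z \<triangleright> i"
proof -
  have inj: "inj_on (\<lambda>z. z \<triangleright> i) S"
  proof (rule inj_onI)
    fix y z assume "y \<in> S" "z \<in> S" "y \<triangleright> i = z \<triangleright> i"
    then show "y = z" using right_cancel[OF assms(3) subsetD[OF assms(2)] subsetD[OF assms(2)]] by blast
  qed
  have "(\<lambda>z. z \<triangleright> i) ` S \<subseteq> S" using assms(4) by auto
  then have "(\<lambda>z. z \<triangleright> i) ` S = S"
    by (rule endo_inj_surj[OF assms(1) _ inj])
  then show ?thesis using assms(5) by blast
qed

lemma qeval_qword: "qeval Q f (qword a b k) = qpow Q (qeval Q f b) k (qeval Q f a)"
  by (induction k) (simp_all add: qword_def)

lemma class_qword:
  "qcong rels `` {qword a b k} = qpow (presented_quandle rels) (qcong rels `` {b}) k (qcong rels `` {a})"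
  by (induction k) (simp_all add: qword_def flip: qop_presented_quandle)

lemma qcong_class_eqI: "(s, t) \<in> rels \<Longrightarrow> qcong rels `` {s} = qcong rels `` {t}"
  by (simp add: qcong_class_eq_iff qcong.relation)

context finite_field_prime_power
begin

context
  fixes \<alpha> assumes \<alpha>: "primitive_element R \<alpha>"
begin

lemmas \<alpha>_props = primitive_elementD[OF \<alpha>]

lemma pow_inj: "\<lbrakk>i \<le> p ^ n - 2; j \<le> p ^ n - 2; \<alpha> [^] i = \<alpha> [^] j\<rbrakk> \<Longrightarrow> i = j"
  using inj_onD[OF bij_betw_imp_inj_on[OF primitive_element_enumeration[OF finite_carrier \<alpha>]], of i j]
    gt_2 by (auto simp: card)

lemma field_log:
  assumes "r \<in> carrier R" "r \<noteq> \<zero>"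
  shows "field_log R \<alpha> r \<le> p ^ n - 2" "\<alpha> [^] field_log R \<alpha> r = r"
proof -
  obtain k where k: "k \<le> p ^ n - 2" "r = \<alpha> [^] k"
  proof -
    obtain k where "k < p ^ n - 1" "r = \<alpha> [^] k" using \<alpha>_props(5)[OF assms] by blast
    then show thesis by (intro that[of k]) linarith
  qed
  have "\<exists>!i. i \<le> card (carrier R) - 2 \<and> \<alpha> [^] i = r"
    unfolding card k(2)
  proof (rule ex1I[of _ k])
    fix i assume "i \<le> p ^ n - 2 \<and> \<alpha> [^] i = \<alpha> [^] k"
    then show "i = k" using k(1) by (intro pow_inj) simp_all
  qed (simp add: k(1))
  from theI'[OF this] show "field_log R \<alpha> r \<le> p ^ n - 2" "\<alpha> [^] field_log R \<alpha> r = r"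
    by (simp_all add: field_log_def card)
qed

lemma field_log_pow:
  assumes "k \<le> p ^ n - 2"
  shows "field_log R \<alpha> (\<alpha> [^] k) = k"
proof -
  have "\<alpha> [^] k \<in> carrier R" "\<alpha> [^] k \<noteq> \<zero>"
    using Units_pow_closed[of \<alpha> k] field_Units \<alpha>_props(1,2) by simp_all
  then show ?thesis using field_log[of "\<alpha> [^] k"] assms by (intro pow_inj) simp_all
qed

text \<open>A variant of the Zech logarithm, with 1 - \<alpha>^k in place of 1 + \<alpha>^k.\<close>

abbreviation zech :: "nat \<Rightarrow> nat" where
  "zech k \<equiv> field_log R \<alpha> (\<one> \<ominus> \<alpha> [^] k)"

text \<open>In this range 1 - \<alpha>^k is neither 0 nor 1, so its logarithm stays in the range,
  and 1 - (1 - t) = t makes the map an involution.\<close>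

lemma zech:
  assumes "1 \<le> k" "k \<le> p ^ n - 2"
  shows "1 \<le> zech k" "zech k \<le> p ^ n - 2" "\<alpha> [^] zech k = \<one> \<ominus> \<alpha> [^] k" "zech (zech k) = k"
proof -
  have pk: "\<alpha> [^] k \<in> carrier R" "\<alpha> [^] k \<noteq> \<zero>"
    using Units_pow_closed[of \<alpha> k] field_Units \<alpha>_props(1,2) by simp_all
  have "\<one> \<ominus> \<alpha> [^] k \<noteq> \<zero>"
  proof
    assume "\<one> \<ominus> \<alpha> [^] k = \<zero>"
    then have "\<alpha> [^] k = \<alpha> [^] (0::nat)" using pk by simp
    then have "k = 0" using assms by (intro pow_inj) simp_all
    then show False using assms by simp
  qed
  then show z: "zech k \<le> p ^ n - 2" "\<alpha> [^] zech k = \<one> \<ominus> \<alpha> [^] k"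
    using field_log[of "\<one> \<ominus> \<alpha> [^] k"] pk by auto
  have one: "\<one> \<ominus> (\<one> \<ominus> \<alpha> [^] k) = \<alpha> [^] k" using pk(1) by algebra
  show "1 \<le> zech k"
  proof (rule ccontr)
    assume "\<not> 1 \<le> zech k"
    then have "\<one> \<ominus> \<alpha> [^] k = \<one>" using z(2) by (simp add: not_le)
    moreover have "\<one> \<ominus> \<one> = \<zero>" by simp
    ultimately show False using one pk(2) by metis
  qed
  show "zech (zech k) = k"
    unfolding z(2) one by (rule field_log_pow) (rule assms)
qed

lemma F_rels_iff:
  "(s, t) \<in> F_rels R \<alpha> \<longleftrightarrow>
    (\<exists>(a, b)\<in>{(Gen Gen_x, Gen Gen_y), (Gen Gen_y, Gen Gen_x)}.
      (s = qword a b (p ^ n - 1) \<and> t = a) \<or>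
      (\<exists>k. 1 \<le> k \<and> k \<le> p ^ n - 2 \<and> s = qword a b k \<and> t = qword b a (zech k)))"
  unfolding F_rels_def Let_def card by (simp; blast)

text \<open>Sending x to 0 and y to 1 respects the relations, since y x^k goes to \<alpha>^k and x
  y^k to 1 - \<alpha>^k. The image contains 0 and all powers of \<alpha>, and the source has at most
  p^n elements, so the map is bijective.\<close>

lemma F_quandle_isomorphic_affine_quandle:
  "quandle_isomorphic (F_quandle R \<alpha>) (affine_quandle R \<alpha>)"
proof -
  let ?A = "affine_quandle R \<alpha>" and ?F = "F_quandle R \<alpha>"
  let ?c = "\<lambda>s. qcong (F_rels R \<alpha>) `` {s}"
  have cyc: "cyclic_quandle ?A"
    by (rule cyclic_quandle_affine_quandle[OF finite_carrier _ \<alpha>]) (simp add: card gt_2)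
  interpret A: cyclic_type_quandle ?A
    using cyc by (auto simp: cyclic_quandle_def cyclic_type_quandle_def cyclic_type_quandle_axioms_def)
  interpret F: quandle ?F unfolding F_quandle_def by (rule quandle_presented_quandle)
  define f where "f = (\<lambda>g. case g of Gen_x \<Rightarrow> \<zero> | Gen_y \<Rightarrow> \<one>)"
  have f: "range f \<subseteq> carrier ?A" by (auto simp: f_def split: gen.split)
  have pow0: "qpow ?A \<zero> k \<one> = \<alpha> [^] k" for k
    using affine_qpow[OF \<alpha>_props(1), of \<zero> \<one> k] \<alpha>_props(1) by (simp del: affine_quandle_simps)
  have pow1: "qpow ?A \<one> k \<zero> = \<one> \<ominus> \<alpha> [^] k" for k
    using affine_qpow[OF \<alpha>_props(1), of \<one> "\<ominus> \<one>" k] \<alpha>_props(1)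
    by (simp add: r_neg r_minus a_minus_def del: affine_quandle_simps)
  have zech1: "\<one> \<ominus> \<alpha> [^] zech k = \<alpha> [^] k" if "1 \<le> k" "k \<le> p ^ n - 2" for k
  proof -
    have "\<alpha> [^] k \<in> carrier R" using \<alpha>_props(1) by simp
    then have "\<one> \<ominus> (\<one> \<ominus> \<alpha> [^] k) = \<alpha> [^] k" by algebra
    then show ?thesis unfolding zech(3)[OF that] .
  qed
  have order: "qpow ?A i (p ^ n - 1) b = b" if "i \<in> carrier R" "b \<in> carrier R" for i b
    using A.qpow_order[of i b] that by (simp add: card del: affine_quandle_simps(2))
  have rels: "qeval ?A f s = qeval ?A f t" if st: "(s, t) \<in> F_rels R \<alpha>" for s t
  proof -
    have fxy: "f Gen_x = \<zero>" "f Gen_y = \<one>" by (simp_all add: f_def)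
    from st obtain a b where ab: "(a, b) \<in> {(Gen Gen_x, Gen Gen_y), (Gen Gen_y, Gen Gen_x)}"
      and or: "(s = qword a b (p ^ n - 1) \<and> t = a) \<or>
        (\<exists>k. 1 \<le> k \<and> k \<le> p ^ n - 2 \<and> s = qword a b k \<and> t = qword b a (zech k))"
      unfolding F_rels_iff by blast
    from or show ?thesis
    proof (elim disjE exE conjE)
      assume "s = qword a b (p ^ n - 1)" "t = a"
      then show ?thesis
        using ab order by (auto simp: qeval_qword fxy simp del: affine_quandle_simps(2))
    next
      fix k assume k: "1 \<le> k" "k \<le> p ^ n - 2" and s: "s = qword a b k" and t: "t = qword b a (zech k)"
      have "qpow ?A \<one> k \<zero> = qpow ?A \<zero> (zech k) \<one>" "qpow ?A \<zero> k \<one> = qpow ?A \<one> (zech k) \<zero>"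
        by (simp only: pow0 pow1 zech(3)[OF k], simp only: pow0 pow1 zech1[OF k])
      then show ?thesis
        using ab by (auto simp only: s t qeval_qword fxy qeval.simps prod.inject insert_iff empty_iff)
    qed
  qed
  obtain h where h: "h \<in> quandle_hom ?F ?A" "\<And>g. h (?c (Gen g)) = f g"
    using A.presented_quandle_universal[OF f rels] unfolding F_quandle_def by blast
  define x0 where "x0 = ?c (Gen Gen_x)"
  define y where "y = (\<lambda>k. qpow ?F x0 k (?c (Gen Gen_y)))"
  have carrier: "carrier ?F = range ?c"
    by (simp add: F_quandle_def carrier_presented_quandle)
  have Xc: "x0 \<in> carrier ?F" and Yc: "?c (Gen Gen_y) \<in> carrier ?F" by (auto simp: x0_def carrier)
  have yc: "y k \<in> carrier ?F" for k by (simp add: y_def Xc Yc)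
  have qop: "?c s \<triangleright>\<^bsub>?F\<^esub> ?c t = ?c (Rmul s t)" for s t
    by (simp add: F_quandle_def qop_presented_quandle)
  have word: "?c (qword a b k) = qpow ?F (?c b) k (?c a)" for a b k
    by (simp add: F_quandle_def class_qword)
  have y0: "y 0 = ?c (Gen Gen_y)" by (simp add: y_def)
  have y_order: "y (p ^ n - 1) = y 0"
    unfolding y0 unfolding y_def x0_def word[symmetric]
    by (rule qcong_class_eqI) (auto simp: F_rels_iff)
  have x_order: "qpow ?F (y 0) (p ^ n - 1) x0 = x0"
    unfolding y0 unfolding y_def x0_def word[symmetric]
    by (rule qcong_class_eqI) (auto simp: F_rels_iff)
  have x_pow: "qpow ?F (y 0) k x0 = y (zech k)" if "1 \<le> k" "k \<le> p ^ n - 2" for k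
    unfolding y0 unfolding y_def x0_def word[symmetric]
    by (rule qcong_class_eqI) (use that in \<open>auto simp: F_rels_iff\<close>)
  \<comment> \<open>\<open>y k\<close> is the word y x^k, destined for \<alpha>^k. Once
    \<open>S\<close> is closed under the operation, it contains the class of every term.\<close>
  define S where "S = insert x0 (y ` {..<p ^ n - 1})"
  have S: "finite S" "S \<subseteq> carrier ?F" by (auto simp: S_def Xc yc)
  have x0_S: "x0 \<in> S" by (simp add: S_def)
  have y_S: "y k \<in> S" if "k \<le> p ^ n - 1" for k
  proof (cases "k = p ^ n - 1")
    case True
    then show ?thesis using y_order gt_2 by (auto simp: S_def)
  qed (use that in \<open>auto simp: S_def\<close>)
  have y_Suc: "y k \<triangleright>\<^bsub>?F\<^esub> x0 = y (Suc k)" for k by (simp add: y_def)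
  have S_X: "z \<triangleright>\<^bsub>?F\<^esub> x0 \<in> S" if z: "z \<in> S" for z
  proof (cases "z = x0")
    case True
    then show ?thesis using F.idem[OF Xc] x0_S by simp
  next
    case False
    then obtain k where "k < p ^ n - 1" "z = y k" using z by (auto simp: S_def)
    then show ?thesis using y_S[of "Suc k"] by (simp add: y_Suc)
  qed
  have x_pow_S: "qpow ?F (y 0) k x0 \<in> S" if "k \<le> p ^ n - 1" for k
  proof -
    consider "k = 0" | "1 \<le> k" "k \<le> p ^ n - 2" | "k = p ^ n - 1" using \<open>k \<le> p ^ n - 1\<close> by linarith
    then show ?thesis
    proof cases
      case 2
      then show ?thesis using x_pow[OF 2] zech(2)[OF 2] y_S[of "zech k"] by simp
    next
      case 3
      then show ?thesis using x0_S x_order by metis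
    qed (simp add: x0_S)
  qed
  \<comment> \<open>Since \<open>zech\<close> is an involution, each \<open>y k\<close> with 1 \<le>
    k \<le> p^n - 2 also has the form x y^j, and right multiplication by \<open>y 0\<close> just
    raises j.\<close>
  have S_y0: "z \<triangleright>\<^bsub>?F\<^esub> y 0 \<in> S" if z: "z \<in> S" for z
  proof -
    have "\<exists>k<p ^ n - 1. z = qpow ?F (y 0) k x0" if "z \<noteq> y 0"
    proof (cases "z = x0")
      case True
      then show ?thesis using gt_2 by (intro exI[of _ 0]) simp
    next
      case False
      then obtain k where k: "k < p ^ n - 1" "z = y k" using z by (auto simp: S_def)
      then have k': "1 \<le> k" "k \<le> p ^ n - 2" using \<open>z \<noteq> y 0\<close> by (cases k; simp)+
      note zech_k = zech[OF k']
      have "z = qpow ?F (y 0) (zech k) x0"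
        unfolding x_pow[OF zech_k(1,2)] zech_k(4) by (rule k(2))
      moreover have "zech k < p ^ n - 1" using zech_k(2) gt_2 by linarith
      ultimately show ?thesis by blast
    qed
    then show ?thesis
    proof (cases "z = y 0")
      case True
      then show ?thesis using F.idem[OF yc] y_S[of 0] by simp
    next
      case False
      with \<open>z \<noteq> y 0 \<Longrightarrow> \<exists>k<p ^ n - 1. z = qpow ?F (y 0) k x0\<close>
      obtain k where "k < p ^ n - 1" "z = qpow ?F (y 0) k x0" by blast
      then show ?thesis using x_pow_S[of "Suc k"] by simp
    qed
  qed
  \<comment> \<open>\<open>y (Suc k)\<close> is \<open>y k \<triangleright> x0\<close>. If
    \<open>z\<close> is written as \<open>z' \<triangleright> x0\<close> inside \<open>S\<close>,
    self-distributivity takes the common \<open>x0\<close> outside and leaves a product with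
    \<open>y k\<close>.\<close>
  have S_y: "z \<triangleright>\<^bsub>?F\<^esub> y k \<in> S" if z: "z \<in> S" for z k
    using z
  proof (induction k arbitrary: z)
    case 0
    then show ?case by (rule S_y0)
  next
    case (Suc k)
    then obtain z' where z': "z' \<in> S" "z = z' \<triangleright>\<^bsub>?F\<^esub> x0"
      using F.right_mult_surj_on[OF S Xc S_X] by blast
    then have "z \<triangleright>\<^bsub>?F\<^esub> y (Suc k) = (z' \<triangleright>\<^bsub>?F\<^esub> y k) \<triangleright>\<^bsub>?F\<^esub> x0"
      using F.self_dist[of z' "y k" x0] S(2) yc Xc by (auto simp flip: y_Suc)
    then show ?case using S_X Suc.IH[OF z'(1)] by simp
  qed
  have S_closed: "z \<triangleright>\<^bsub>?F\<^esub> s \<in> S" if "z \<in> S" "s \<in> S" for z s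
  proof -
    from that(2) consider "s = x0" | k where "s = y k" unfolding S_def by blast
    then show ?thesis using that(1) S_X S_y by cases simp_all
  qed
  have "?c s \<in> S" for s
  proof (induction s)
    case (Gen g)
    then show ?case using x0_S y_S[of 0] by (cases g) (simp_all add: x0_def y0)
  next
    case (Rmul s t)
    then show ?case using S_closed by (simp flip: qop)
  next
    case (Rdiv s t)
    have tc: "?c t \<in> carrier ?F" by (simp add: carrier)
    obtain z where z: "z \<in> S" "?c s = z \<triangleright>\<^bsub>?F\<^esub> ?c t"
      using F.right_mult_surj_on[OF S tc S_closed[OF _ Rdiv(2)] Rdiv(1)] by blast
    have "?c (Rdiv s t) \<triangleright>\<^bsub>?F\<^esub> ?c t = ?c s"
      unfolding qop qcong_class_eq_iff by (rule qcong.Rmul_Rdiv)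
    then have "?c (Rdiv s t) = z"
      using F.right_cancel[OF tc, of "?c (Rdiv s t)" z] z S(2) by (auto simp: carrier)
    then show ?case using z by simp
  qed
  then have FS: "carrier ?F = S" using S(2) carrier by auto
  have "card S \<le> Suc (card (y ` {..<p ^ n - 1}))" unfolding S_def by (rule card_insert_le_m1) auto
  also have "\<dots> \<le> Suc (p ^ n - 1)" using card_image_le[of "{..<p ^ n - 1}" y] by simp
  also have "\<dots> = p ^ n" using gt_2 by simp
  finally have card_F: "card (carrier ?F) \<le> p ^ n" by (simp add: FS)
  have hom: "h (a \<triangleright>\<^bsub>?F\<^esub> b) = h a \<triangleright>\<^bsub>?A\<^esub> h b" if "a \<in> carrier ?F" "b \<in> carrier ?F" for a b
    using h(1) that by (simp add: quandle_hom_def)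
  have hX: "h x0 = \<zero>" and hy: "h (y k) = qpow ?A \<zero> k \<one>" for k
  proof -
    show hX: "h x0 = \<zero>" using h(2)[of Gen_x] by (simp add: x0_def f_def)
    show "h (y k) = qpow ?A \<zero> k \<one>"
    proof (induction k)
      case 0
      show ?case using h(2)[of Gen_y] by (simp add: y0 f_def)
    next
      case (Suc k)
      then show ?case using hom[OF yc[of k] Xc] by (simp only: y_Suc hX funpow.simps comp_apply)
    qed
  qed
  have "carrier R \<subseteq> h ` carrier ?F"
  proof
    fix r assume r: "r \<in> carrier R"
    show "r \<in> h ` carrier ?F"
    proof (cases "r = \<zero>")
      case True
      then show ?thesis using hX Xc by (metis imageI)
    next
      case False
      then obtain k :: nat where "r = \<alpha> [^] k" using \<alpha>_props(5) r by blast
      then have "r = h (y k)" using hy pow0 by metis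
      then show ?thesis using yc by simp
    qed
  qed
  moreover have "h ` carrier ?F \<subseteq> carrier R" using h(1) by (auto simp: quandle_hom_def)
  ultimately have im: "h ` carrier ?F = carrier R" by blast
  have finF: "finite (carrier ?F)" using S(1) FS by simp
  have "card (h ` carrier ?F) = card (carrier ?F)"
    using card_F card_image_le[OF finF, of h] by (simp add: im card)
  then have "inj_on h (carrier ?F)" by (rule eq_card_imp_inj_on[OF finF])
  then show ?thesis
    using im h(1) unfolding quandle_isomorphic_def by (auto simp: bij_betw_def)
qed

end

end


section \<open>Isomorphism classes\<close>

lemma (in quandle) exists_nat_copy:
  assumes "finite (carrier Q)"
  shows "\<exists>K :: nat quandle. quandle_isomorphic Q K"
proof -
  obtain f where f: "bij_betw f (carrier Q) {..<card (carrier Q)}"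
    using ex_bij_betw_finite_nat[OF assms] by (auto simp: atLeast0LessThan)
  define g where "g = the_inv_into (carrier Q) f"
  have g: "g (f x) = x" if "x \<in> carrier Q" for x
    unfolding g_def using f that by (simp add: bij_betw_def the_inv_into_f_f)
  define K :: "nat quandle" where
    "K = \<lparr>carrier = {..<card (carrier Q)}, qop = \<lambda>x y. f (g x \<triangleright> g y)\<rparr>"
  have "f \<in> quandle_hom Q K"
    using bij_betwE[OF f] by (simp add: quandle_hom_def K_def g)
  then show ?thesis
    using f unfolding quandle_isomorphic_def by (intro exI[of _ K] bexI[of _ f]) (simp_all add: K_def)
qed

lemma equiv_cyclic_quandles:
  "equiv (cyclic_quandles m)
    {(Q, K). Q \<in> cyclic_quandles m \<and> K \<in> cyclic_quandles m \<and> quandle_isomorphic Q K}"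
proof (rule equivI)
  show "refl_on (cyclic_quandles m)
      {(Q, K). Q \<in> cyclic_quandles m \<and> K \<in> cyclic_quandles m \<and> quandle_isomorphic Q K}"
    by (rule refl_onI) (simp add: quandle_isomorphic_refl)
  show "sym {(Q, K). Q \<in> cyclic_quandles m \<and> K \<in> cyclic_quandles m \<and> quandle_isomorphic Q K}"
    by (rule symI) (auto simp: cyclic_quandles_def cyclic_quandle_def intro: quandle.quandle_isomorphic_sym)
  show "trans {(Q, K). Q \<in> cyclic_quandles m \<and> K \<in> cyclic_quandles m \<and> quandle_isomorphic Q K}"
    by (rule transI) (blast intro: quandle_isomorphic_trans)
qed auto

text \<open>The primitive elements are counted along the map to the class of the affine quandle. It
  is onto, since the field of any cyclic quandle of this order is isomorphic to \<open>R\<close>,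
  and its fibres are Frobenius orbits. \<open>N\<close> picks copies on natural numbers, the type on
  which classes are formed.\<close>

lemma (in finite_field_prime_power) card_cyclic_quandle_classes:
  "n * card (cyclic_quandle_classes (p ^ n)) = totient (p ^ n - 1)"
proof -
  let ?A = "\<lambda>\<alpha>. affine_quandle R \<alpha>"
  define P where "P = {\<alpha>. primitive_element R \<alpha>}"
  define r where "r = {(Q, K). Q \<in> cyclic_quandles (p ^ n) \<and> K \<in> cyclic_quandles (p ^ n) \<and>
    quandle_isomorphic Q (K :: nat quandle)}"
  have r: "equiv (cyclic_quandles (p ^ n)) r"
    unfolding r_def by (rule equiv_cyclic_quandles)
  have A: "cyclic_quandle (?A \<alpha>)" if "\<alpha> \<in> P" for \<alpha>
    by (rule cyclic_quandle_affine_quandle[OF finite_carrier])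
      (use that gt_2 in \<open>simp_all add: P_def card\<close>)
  have AQ: "quandle (?A \<alpha>)" if "\<alpha> \<in> P" for \<alpha>
    using A[OF that] by (simp add: cyclic_quandle_def)
  have "\<exists>K :: nat quandle. quandle_isomorphic (?A \<alpha>) K" if "\<alpha> \<in> P" for \<alpha>
    by (rule quandle.exists_nat_copy[OF AQ[OF that]]) (simp add: finite_carrier)
  then obtain N :: "'a \<Rightarrow> nat quandle" where N: "\<And>\<alpha>. \<alpha> \<in> P \<Longrightarrow> quandle_isomorphic (?A \<alpha>) (N \<alpha>)"
    by metis
  have NC: "N \<alpha> \<in> cyclic_quandles (p ^ n)" if "\<alpha> \<in> P" for \<alpha>
    using quandle_isomorphic_cyclic_quandle[OF A[OF that] N[OF that]]
    by (simp add: cyclic_quandles_def card)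
  have NQ: "quandle (N \<alpha>)" if "\<alpha> \<in> P" for \<alpha>
    using NC[OF that] by (simp add: cyclic_quandles_def cyclic_quandle_def)
  have class_eq: "r `` {N \<alpha>} = r `` {N \<beta>} \<longleftrightarrow> prime_power_equiv R p \<alpha> \<beta>"
    if P: "\<alpha> \<in> P" "\<beta> \<in> P" for \<alpha> \<beta>
  proof -
    have "r `` {N \<alpha>} = r `` {N \<beta>} \<longleftrightarrow> (N \<alpha>, N \<beta>) \<in> r"
      by (rule eq_equiv_class_iff[OF r NC[OF P(1)] NC[OF P(2)]])
    also have "\<dots> \<longleftrightarrow> quandle_isomorphic (N \<alpha>) (N \<beta>)"
      using NC[OF P(1)] NC[OF P(2)] by (simp add: r_def)
    also have "\<dots> \<longleftrightarrow> quandle_isomorphic (?A \<alpha>) (?A \<beta>)"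
      using N[OF P(1)] N[OF P(2)] quandle.quandle_isomorphic_sym[OF AQ[OF P(1)] N[OF P(1)]]
        quandle.quandle_isomorphic_sym[OF AQ[OF P(2)] N[OF P(2)]]
      by (meson quandle_isomorphic_trans)
    also have "\<dots> \<longleftrightarrow> prime_power_equiv R p \<alpha> \<beta>"
      by (rule affine_quandle_isomorphic_iff) (use P in \<open>simp_all add: P_def\<close>)
    finally show ?thesis .
  qed
  have classes: "cyclic_quandle_classes (p ^ n) = (\<lambda>\<alpha>. r `` {N \<alpha>}) ` P"
  proof -
    have "cyclic_quandle_classes (p ^ n) = cyclic_quandles (p ^ n) // r"
      by (simp add: cyclic_quandle_classes_def r_def)
    also have "\<dots> = (\<lambda>\<alpha>. r `` {N \<alpha>}) ` P"
    proof
      show "(\<lambda>\<alpha>. r `` {N \<alpha>}) ` P \<subseteq> cyclic_quandles (p ^ n) // r"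
        using NC by (auto intro: quotientI)
      show "cyclic_quandles (p ^ n) // r \<subseteq> (\<lambda>\<alpha>. r `` {N \<alpha>}) ` P"
      proof
        fix C assume "C \<in> cyclic_quandles (p ^ n) // r"
        then obtain Q where Q: "Q \<in> cyclic_quandles (p ^ n)" "C = r `` {Q}"
          by (rule quotientE)
        then have cyc: "cyclic_quandle Q" and card_Q: "card (carrier Q) = p ^ n"
          by (simp_all add: cyclic_quandles_def)
        obtain K :: "nat ring" and \<gamma> where K: "field K" "carrier K = carrier Q" "primitive_element K \<gamma>"
            "quandle_isomorphic Q (affine_quandle K \<gamma>)"
          using cyclic_quandle_affine[OF cyc] .
        have fin: "finite (carrier K)" using cyc K(2) by (simp add: cyclic_quandle_def)
        have \<gamma>: "\<gamma> \<in> carrier K" using K(3) by (simp add: primitive_element_def)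
        obtain h where h: "h \<in> ring_iso K R"
          using finite_field_iso[OF K(1) field_axioms p _ card \<gamma> K(3)] card_Q K(2) by auto
        have "h \<gamma> \<in> P"
          using primitive_element_ring_iso[OF K(1) fin field_axioms h K(3)] by (simp add: P_def)
        moreover have "quandle_isomorphic (affine_quandle K \<gamma>) (?A (h \<gamma>))"
          by (rule affine_quandle_ring_iso[OF field.is_ring[OF K(1)] ring_axioms h \<gamma>])
        ultimately have "quandle_isomorphic Q (N (h \<gamma>))"
          using K(4) N by (blast intro: quandle_isomorphic_trans)
        then have "(Q, N (h \<gamma>)) \<in> r" using Q(1) NC[OF \<open>h \<gamma> \<in> P\<close>] by (simp add: r_def)
        then have "C = r `` {N (h \<gamma>)}" unfolding Q(2) by (rule equiv_class_eq[OF r])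
        with \<open>h \<gamma> \<in> P\<close> show "C \<in> (\<lambda>\<alpha>. r `` {N \<alpha>}) ` P" by blast
      qed
    qed
    finally show ?thesis .
  qed
  have fibre: "card {\<alpha> \<in> P. r `` {N \<alpha>} = r `` {N \<beta>}} = n" if "\<beta> \<in> P" for \<beta>
  proof -
    have \<beta>: "primitive_element R \<beta>" using that by (simp add: P_def)
    have "{\<alpha> \<in> P. r `` {N \<alpha>} = r `` {N \<beta>}} = {\<alpha> \<in> P. prime_power_equiv R p \<alpha> \<beta>}"
      using class_eq that by blast
    \<comment> \<open>Frobenius conjugates of a primitive element are primitive, so the restriction
      to \<open>P\<close> loses none of them.\<close>
    also have "\<dots> = {\<alpha>. prime_power_equiv R p \<alpha> \<beta>}"
      using primitive_element_frob[OF \<beta>] unfolding P_def prime_power_equiv_def by blast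
    finally show ?thesis using card_prime_power_equiv_class[OF \<beta>] by simp
  qed
  have finP: "finite P"
    by (rule finite_subset[OF _ finite_carrier]) (auto simp: P_def primitive_element_def)
  have "card P = (\<Sum>C\<in>(\<lambda>\<alpha>. r `` {N \<alpha>}) ` P. card {\<alpha> \<in> P. r `` {N \<alpha>} = C})"
    using sum.image_gen[OF finP, of "\<lambda>_. 1 :: nat" "\<lambda>\<alpha>. r `` {N \<alpha>}"] by simp
  also have "\<dots> = (\<Sum>C\<in>(\<lambda>\<alpha>. r `` {N \<alpha>}) ` P. n)"
    by (rule sum.cong[OF HOL.refl]) (elim imageE, simp only: fibre)
  also have "\<dots> = n * card (cyclic_quandle_classes (p ^ n))"
    by (simp add: classes)
  finally show ?thesis using card_primitive_elements by (simp add: P_def)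
qed

theorem theorem3p7:
  fixes p n :: nat
  assumes "Factorial_Ring.prime p" and "p ^ n > 2"
  shows "(\<forall>(R :: ('a, 'b) ring_scheme) \<alpha> \<beta>.
            field R \<and> card (carrier R) = p ^ n \<and>
            primitive_element R \<alpha> \<and> primitive_element R \<beta> \<longrightarrow>
            (quandle_isomorphic (F_quandle R \<alpha>) (F_quandle R \<beta>) \<longleftrightarrow> prime_power_equiv R p \<alpha> \<beta>)) \<and>
         real (card (cyclic_quandle_classes (p ^ n))) = real (totient (p ^ n - 1)) / real n"
proof (intro conjI allI impI; (elim conjE)?)
  fix R :: "('a, 'b) ring_scheme" and \<alpha> \<beta>
  assume R: "field R" "card (carrier R) = p ^ n"
    and \<alpha>: "primitive_element R \<alpha>" and \<beta>: "primitive_element R \<beta>"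
  interpret finite_field_prime_power R p n
    using R assms by (simp add: finite_field_prime_power_def finite_field_prime_power_axioms_def)
  have FQ: "quandle (F_quandle R \<gamma>)" for \<gamma>
    unfolding F_quandle_def by (rule quandle_presented_quandle)
  note F\<alpha> = F_quandle_isomorphic_affine_quandle[OF \<alpha>] and F\<beta> = F_quandle_isomorphic_affine_quandle[OF \<beta>]
  have "quandle_isomorphic (F_quandle R \<alpha>) (F_quandle R \<beta>) \<longleftrightarrow>
      quandle_isomorphic (affine_quandle R \<alpha>) (affine_quandle R \<beta>)"
    using F\<alpha> F\<beta> quandle.quandle_isomorphic_sym[OF FQ F\<alpha>] quandle.quandle_isomorphic_sym[OF FQ F\<beta>]
    by (meson quandle_isomorphic_trans)
  then show "quandle_isomorphic (F_quandle R \<alpha>) (F_quandle R \<beta>) \<longleftrightarrow> prime_power_equiv R p \<alpha> \<beta>"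
    using affine_quandle_isomorphic_iff[OF \<alpha> \<beta>] by simp
next
  have "n > 0" using assms(2) by (cases n) auto
  \<comment> \<open>Any field of order p^n serves here, since the count does not refer to
    it.\<close>
  obtain R :: "((int list \<times> nat) multiset \<Rightarrow> int) ring" where R: "field R" "card (carrier R) = p ^ n"
    using exists_field_of_prime_power_order[OF assms(1) \<open>n > 0\<close>] by blast
  interpret finite_field_prime_power R p n
    using R assms by (simp add: finite_field_prime_power_def finite_field_prime_power_axioms_def)
  have "real n * real (card (cyclic_quandle_classes (p ^ n))) = real (totient (p ^ n - 1))"
    unfolding card_cyclic_quandle_classes[symmetric] by simp
  then show "real (card (cyclic_quandle_classes (p ^ n))) = real (totient (p ^ n - 1)) / real n"
    using \<open>n > 0\<close> by (simp add: field_simps)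
qed

end
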